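(* Let $d\ge1$ and let $\mathcal{M}_{[d+1]}(\Delta_d)\subset\mathbb{P}^{\binom{2d+1}{d}-1}$ be the variety of moments of order $\le d+1$ of $d$-simplices. Homogeneous equations that define $\mathcal{M}_{[d+1]}(\Delta_d)$ set-theoretically are obtained by substituting into Brill's equations the polynomials in the $m_I$ that are the coefficients of the polynomial (in $t_1,\ldots,t_d$, of degree $\le d+1$) $$(1+\mathbb{L})^{-1}=1-\mathbb{L}+\mathbb{L}^2-\cdots+(-1)^{d+1}\mathbb{L}^{d+1}\quad\bmod\ \langle t_1,\ldots,t_d\rangle^{d+2},$$ where $$\mathbb{L}=\sum_{1\le i_1+\cdots+i_d\le d+1}\frac{(i_1+\cdots+i_d+d)!}{i_1!\cdots i_d!\,d!}\,m_{i_1\cdots i_d}\,t_1^{i_1}\cdots t_d^{i_d}.$$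
   Context: $\Delta_d=\mathrm{conv}(x_1,\ldots,x_{d+1})\subset\mathbb{R}^d$ is a $d$-simplex; its moments $m_I=\int w^I\,d\mu_{\Delta_d}$, $I\in\mathbb{N}^d$, with respect to the uniform probability distribution $\mu_{\Delta_d}$ are polynomials in the vertex coordinates $X=(x_{kl})$. $\mathcal{M}_{[d+1]}(\Delta_d)$ is the Zariski closure of the image of $\mathbb{C}^{(d+1)\times d}\dashrightarrow\mathbb{P}^{\binom{2d+1}{d}-1}$, $X\mapsto(m_I(X):|I|\le d+1)$. Polynomial relations among the moments are homogenized with the special unknown $m_{00\cdots0}$, which represents the total mass of the simplex. Brill's equations are the classical polynomial equations in the coefficients of a polynomial of degree $\le d+1$ in $d$ variables that characterize those polynomials that are products of linear factors. For the moments of a simplex, $(1+\mathbb{L})^{-1}=\prod_{k=1}^{d+1}(1-x_{k1}t_1-\cdots-x_{kd}t_d)$.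
   Formalization: Homogenizing only the substituted Brill equations adds spurious zeros at m_0=0 (for d=2 all points with m_00=m_10=m_01=0). Proved instead: the homogenizations of all relations in the ideal they generate define the variety, and the substituted equations themselves define it where m_0≠0. *)

theory Defs
  imports
    "HOL-Analysis.Analysis"
    "HOL-Library.Poly_Mapping"
    "HOL-Computational_Algebra.Polynomial"
begin

section \<open>Multivariate polynomials\<close>

text \<open>Polynomials with coefficients in \<^typ>\<open>'r\<close> and unknowns indexed by \<^typ>\<open>'v\<close>; the ring structure
  is the convolution product of \<^theory>\<open>HOL-Library.Poly_Mapping\<close>.\<close>

type_synonym ('v, 'r) mpol = "('v \<Rightarrow>\<^sub>0 nat) \<Rightarrow>\<^sub>0 'r"

definition mdeg :: "('v \<Rightarrow>\<^sub>0 nat) \<Rightarrow> nat"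
  where "mdeg a = (\<Sum>v\<in>Poly_Mapping.keys a. Poly_Mapping.lookup a v)"

definition mconst :: "'r \<Rightarrow> ('v, 'r::comm_ring_1) mpol"
  where "mconst c = Poly_Mapping.single 0 c"

definition mvar :: "'v \<Rightarrow> ('v, 'r::comm_ring_1) mpol"
  where "mvar v = Poly_Mapping.single (Poly_Mapping.single v 1) 1"

text \<open>Substitution of \<^term>\<open>a v\<close> for the unknown \<^term>\<open>v\<close>, where the coefficients are carried
  to the target ring by \<^term>\<open>h\<close>.\<close>

definition msubst :: "('r::comm_ring_1 \<Rightarrow> 's::comm_ring_1) \<Rightarrow> ('v \<Rightarrow> 's) \<Rightarrow> ('v, 'r) mpol \<Rightarrow> 's"
  where "msubst h a p =
    (\<Sum>m\<in>Poly_Mapping.keys p.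
       h (Poly_Mapping.lookup p m) * (\<Prod>v\<in>Poly_Mapping.keys m. a v ^ Poly_Mapping.lookup m v))"

abbreviation meval :: "('v \<Rightarrow> 'r) \<Rightarrow> ('v, 'r::comm_ring_1) mpol \<Rightarrow> 'r"
  where "meval \<equiv> msubst (\<lambda>c. c)"

definition mvars :: "('v, 'r::comm_ring_1) mpol \<Rightarrow> 'v set"
  where "mvars p = (\<Union>m\<in>Poly_Mapping.keys p. Poly_Mapping.keys m)"

definition total_deg :: "('v, 'r::comm_ring_1) mpol \<Rightarrow> nat"
  where "total_deg p = Max (insert 0 (mdeg ` Poly_Mapping.keys p))"

definition homogeneous :: "('v, 'r::comm_ring_1) mpol \<Rightarrow> bool"
  where "homogeneous p \<longleftrightarrow> (\<exists>k. \<forall>m\<in>Poly_Mapping.keys p. mdeg m = k)"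

text \<open>Homogenization with the special unknown \<^term>\<open>v0\<close> (meant for polynomials not involving it).\<close>

definition homogenize :: "'v \<Rightarrow> ('v, 'r::comm_ring_1) mpol \<Rightarrow> ('v, 'r) mpol"
  where "homogenize v0 p =
    (\<Sum>m\<in>Poly_Mapping.keys p.
       Poly_Mapping.single (m + Poly_Mapping.single v0 (total_deg p - mdeg m)) (Poly_Mapping.lookup p m))"

abbreviation mideal :: "('v, 'r::comm_ring_1) mpol set \<Rightarrow> ('v, 'r) mpol set"
  where "mideal \<equiv> module.span (*)"


section \<open>Complex projective space and its Zariski topology\<close>

text \<open>The point of projective space with homogeneous coordinates \<^term>\<open>v \<noteq> 0\<close> is the punctured line
  through \<^term>\<open>v\<close>; projective space is the set of all these lines.\<close>

definition proj_point :: "complex^'n \<Rightarrow> (complex^'n) set"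
  where "proj_point v = {c *s v | c. c \<noteq> 0}"

definition proj_zeros :: "('n, complex) mpol set \<Rightarrow> (complex^'n) set set"
  where "proj_zeros S = {proj_point v | v. v \<noteq> 0 \<and> (\<forall>F\<in>S. meval (\<lambda>i. v $ i) F = 0)}"

definition zariski_closure :: "(complex^'n) set set \<Rightarrow> (complex^'n) set set"
  where "zariski_closure A =
    \<Inter> {proj_zeros S | S. (\<forall>F\<in>S. homogeneous F) \<and> A \<subseteq> proj_zeros S}"


section \<open>Exponents of order at most d + 1\<close>

text \<open>Throughout, d is the cardinality of the finite type \<^typ>\<open>'d\<close>. The type \<open>'d exps\<close> of
  multi-indices of order at most d + 1 has \<open>(2d+1) choose d\<close> elements and indexes both the moments of
  order at most d + 1 and the coefficients of the polynomials of degree at most d + 1 in d variables.\<close>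

typedef (overloaded) ('d::finite) exps = "{I :: 'd \<Rightarrow>\<^sub>0 nat. mdeg I \<le> CARD('d) + 1}"
  morphisms exponent exps_of
  by (rule exI[of _ 0]) (simp add: mdeg_def)

instance exps :: (finite) finite
proof
  let ?A = "{I :: 'a \<Rightarrow>\<^sub>0 nat. mdeg I \<le> CARD('a) + 1}"
  let ?B = "{f :: 'a \<Rightarrow> nat. range f \<subseteq> {..CARD('a) + 1}}"
  have "finite (PiE (UNIV :: 'a set) (\<lambda>_. {..CARD('a) + 1}))"
    by (rule finite_PiE) auto
  moreover have "?B \<subseteq> PiE (UNIV :: 'a set) (\<lambda>_. {..CARD('a) + 1})"
    by auto
  ultimately have "finite ?B"
    by (rule rev_finite_subset)
  moreover have "Poly_Mapping.lookup ` ?A \<subseteq> ?B"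
  proof clarsimp
    fix I :: "'a \<Rightarrow>\<^sub>0 nat" and i
    assume I: "mdeg I \<le> Suc CARD('a)"
    show "Poly_Mapping.lookup I i \<le> Suc CARD('a)"
    proof (cases "i \<in> Poly_Mapping.keys I")
      case True
      then have "Poly_Mapping.lookup I i \<le> mdeg I"
        unfolding mdeg_def by (intro member_le_sum) auto
      with I show ?thesis by simp
    qed (simp add: in_keys_iff)
  qed
  ultimately have "finite (Poly_Mapping.lookup ` ?A)"
    by (rule rev_finite_subset)
  then have "finite ?A"
    by (rule finite_imageD) (simp add: inj_on_def Poly_Mapping.lookup_inject)
  then have "finite (exps_of ` ?A)"
    by simp
  moreover have "exps_of ` ?A = (UNIV :: 'a exps set)"
    using type_definition.Abs_image[OF type_definition_exps] .
  ultimately show "finite (UNIV :: 'a exps set)"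
    by simp
qed

definition zero_exps :: "'d::finite exps"
  where "zero_exps = exps_of 0"


section \<open>The moment variety of simplices\<close>

text \<open>A matrix \<^term>\<open>X\<close> lists the d + 1 vertices, indexed by \<^typ>\<open>'d option\<close>, as its rows.\<close>

definition simplex_of :: "real^'d^('d option) \<Rightarrow> (real^'d::finite) set"
  where "simplex_of X = convex hull (range (\<lambda>k. X $ k))"

definition moment :: "('d \<Rightarrow>\<^sub>0 nat) \<Rightarrow> real^'d^('d option) \<Rightarrow> real"
  where "moment I X =
    (\<integral>w. (\<Prod>l\<in>UNIV. (w $ l) ^ Poly_Mapping.lookup I l) \<partial>uniform_measure lborel (simplex_of X))"

text \<open>The moment as a polynomial in the vertex coordinates. It is unique because the matrices of
  d-simplices form a nonempty open set of real matrices.\<close>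

definition moment_poly :: "('d::finite \<Rightarrow>\<^sub>0 nat) \<Rightarrow> ('d option \<times> 'd, complex) mpol"
  where "moment_poly I = (THE p. \<forall>X :: real^'d^('d option).
    int CARD('d) simplex simplex_of X \<longrightarrow>
      meval (\<lambda>(k, l). complex_of_real (X $ k $ l)) p = complex_of_real (moment I X))"

definition moment_map :: "complex^'d^('d option) \<Rightarrow> complex^('d::finite exps)"
  where "moment_map X = (\<chi> I. meval (\<lambda>(k, l). X $ k $ l) (moment_poly (exponent I)))"

definition moment_variety :: "(complex^('d::finite exps)) set set"
  where "moment_variety = zariski_closure {proj_point (moment_map X) | X. moment_map X \<noteq> 0}"


section \<open>Brill's equations\<close>

text \<open>The polynomial \<open>\<Sum> c\<^sub>I t\<^sup>I\<close> of degree at most d + 1, homogenized to a form of degree d + 1 in d + 1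
  variables (\<^term>\<open>None\<close> is the homogenizing one) and evaluated at \<^term>\<open>v\<close>.\<close>

definition hform :: "('d::finite exps \<Rightarrow> 's::comm_ring_1) \<Rightarrow> ('d option \<Rightarrow> 's) \<Rightarrow> 's"
  where "hform c v =
    (\<Sum>I\<in>UNIV. c I * v None ^ (CARD('d) + 1 - mdeg (exponent I)) *
       (\<Prod>l\<in>UNIV. v (Some l) ^ Poly_Mapping.lookup (exponent I) l))"

text \<open>Newton's identities with denominators cleared: if \<open>e i / e 0\<close> are the elementary symmetric
  functions of some quantities, then \<open>newton_pow e k\<close> is \<open>e 0 ^ k\<close> times their k-th power sum, for
  \<open>k > 0\<close>.\<close>

fun newton_pow :: "(nat \<Rightarrow> 's::comm_ring_1) \<Rightarrow> nat \<Rightarrow> 's"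
  where
    "newton_pow e 0 = 0"
  | "newton_pow e (Suc k) =
      (\<Sum>i<k. (-1) ^ i * e (Suc i) * e 0 ^ i * newton_pow e (k - i))
        + (-1) ^ k * of_nat (Suc k) * e (Suc k) * e 0 ^ k"

text \<open>The vertical (Young) product of two forms g and h of degree n, at the points x and y, given
  the univariate polynomials \<open>G = g(\<alpha>x + y)\<close> and \<open>H = h(\<alpha>x + y)\<close> in \<open>\<alpha>\<close>. It is the bilinear map that
  sends \<open>(\<Prod>\<^sub>i a\<^sub>i, \<Prod>\<^sub>i b\<^sub>i)\<close>, with \<open>a\<^sub>i\<close> and \<open>b\<^sub>i\<close> linear, to
  \<open>\<Sum>\<^sub>\<sigma> \<Prod>\<^sub>i (a\<^sub>i(x) b\<^sub>\<sigma>\<^sub>i(y) - a\<^sub>i(y) b\<^sub>\<sigma>\<^sub>i(x))\<close>, summed over the permutations \<open>\<sigma>\<close>.\<close>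

definition vertical_product :: "nat \<Rightarrow> 's::comm_ring_1 poly \<Rightarrow> 's poly \<Rightarrow> 's"
  where "vertical_product n G H =
    (\<Sum>k\<le>n. (-1) ^ k * of_nat (fact k * fact (n - k)) * coeff G (n - k) * coeff H k)"

text \<open>Brill's form of f at x, y, z, after Gelfand, Kapranov and Zelevinsky, ``Discriminants,
  Resultants and Multidimensional Determinants'', Section 4.2: the vertical product of f and the form
  \<open>P(w) = newton_pow e n\<close>, where \<open>n = d + 1\<close> and \<open>e i\<close> is the coefficient of \<open>\<lambda>\<^sup>i\<close> in \<open>f(z + \<lambda>w)\<close>. For a
  product of linear forms \<open>l\<^sub>i\<close>, \<open>P(w) = \<Sum>\<^sub>i (l\<^sub>i(w) \<Prod>\<^sub>j\<^sub>\<noteq>\<^sub>i l\<^sub>j(z))\<^sup>n\<close>. Below, \<open>w = \<alpha>x + y\<close>, the outer polynomial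
  variable is \<open>\<lambda>\<close>, and the inner one is \<open>\<alpha>\<close>.\<close>

definition brill_form ::
    "('d::finite exps \<Rightarrow> 's::comm_ring_1) \<Rightarrow> ('d option \<Rightarrow> 's) \<Rightarrow> ('d option \<Rightarrow> 's) \<Rightarrow> ('d option \<Rightarrow> 's) \<Rightarrow> 's"
  where "brill_form c x y z =
    (let n = CARD('d) + 1;
         w = (\<lambda>i. [:y i, x i:]);
         G = hform (\<lambda>I. [:c I:]) w;
         E = hform (\<lambda>I. [:[:c I:]:]) (\<lambda>i. [:[:z i:], w i:])
     in vertical_product n G (newton_pow (\<lambda>i. coeff E i) n))"

text \<open>Brill's equations: the coefficients, with respect to all the variables x, y, z, of Brill's form of
  the generic polynomial, whose coefficients are unknowns.\<close>

definition brill_equations :: "('d::finite exps, complex) mpol set"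
  where "brill_equations =
    range (Poly_Mapping.lookup
      (brill_form (\<lambda>I. mconst (mvar I)) (\<lambda>i. mvar (Inl i)) (\<lambda>i. mvar (Inr (Inl i))) (\<lambda>i. mvar (Inr (Inr i)))
        :: ('d option + 'd option + 'd option, ('d exps, complex) mpol) mpol))"


section \<open>The equations for the moments\<close>

definition L_series :: "('d::finite, ('d exps, complex) mpol) mpol"
  where "L_series =
    (\<Sum>I | 1 \<le> mdeg (exponent I).
       Poly_Mapping.single (exponent I)
         (mconst (of_nat (fact (mdeg (exponent I) + CARD('d)))
            / of_nat ((\<Prod>l\<in>UNIV. fact (Poly_Mapping.lookup (exponent I) l)) * fact CARD('d)))
          * mvar I))"

text \<open>The coefficient of \<open>t\<^sup>I\<close> in \<open>1 - L + L\<^sup>2 - \<dots>\<close>; as \<open>I\<close> has order at most d + 1, this is the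
  coefficient in the truncation modulo \<open>\<langle>t\<^sub>1, \<dots>, t\<^sub>d\<rangle>\<close> to the power d + 2.\<close>

definition inverse_coeff :: "'d::finite exps \<Rightarrow> ('d exps, complex) mpol"
  where "inverse_coeff I =
    Poly_Mapping.lookup (\<Sum>j\<le>CARD('d) + 1. (-1) ^ j * L_series ^ j) (exponent I)"

text \<open>The substituted equations are relations among the moments of positive order in the chart where
  the total mass is 1. They cut out the moment variety in this chart, but their individual
  homogenizations can have further common zeros on the hyperplane of total mass 0 (already for d = 2),
  as is usual for the generators of an ideal. Equations for the whole projective variety are the
  homogenizations of all the relations in the ideal that they generate.\<close>

definition moment_brill_equations :: "('d::finite exps, complex) mpol set"
  where "moment_brill_equations = msubst mconst inverse_coeff ` brill_equations"

end

theory Submission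
  imports Defs "HOL-Computational_Algebra.Fundamental_Theorem_Algebra"
begin

text \<open>The Dirichlet integral and the multinomial theorem show that the moment generating function of a
  simplex is the inverse of \<open>\<Prod>\<^sub>k (1 - x\<^sub>k \<cdot> t)\<close>. Inversion modulo degree d + 2 is bijective, so that the
  points with total mass 1 where the substituted equations vanish correspond to the polynomials
  with constant term 1 that satisfy Brill's equations. These are exactly the products of linear factors,
  hence the affine variety is the image of the moment map itself, without any closure. The
  projective closure is then governed by Hilbert's Nullstellensatz: a form that vanishes on the image has,
  after dehomogenization, a power in the ideal of the substituted equations.\<close>

section \<open>Evaluation homomorphisms\<close>

text \<open>The delicate direction is that Brill's equations force linear factors even when f has
  repeated ones. At a singular zero z the first two coefficients of f(z + \<lambda>w) vanish, hence
  so does the form P, and Brill's form says nothing there. The equations are therefore used over a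
  ring of polynomials in a parameter \<epsilon>: z moves along an arc into the zero, the common
  power of \<epsilon> is divided out, and only then \<epsilon> is set to 0. This is why forms,
  Newton sums and Brill's form live over arbitrary commutative rings and are transported by ring
  homomorphisms, for which \<open>rhom\<close> is an unbundled predicate covering evaluation,
  coefficient embeddings, composition and \<open>map_poly\<close> at once. What this yields is a
  single line on the hypersurface in each plane through a zero; the linear factors have to be
  assembled from such lines, with multiplicities. The constant term 1 helps twice: the origin is
  never a zero, and every factor can be normalized to 1 - x . t.\<close>

definition rhom :: "('r::comm_ring_1 \<Rightarrow> 's::comm_ring_1) \<Rightarrow> bool"
  where "rhom h \<longleftrightarrow> h 1 = 1 \<and> (\<forall>x y. h (x + y) = h x + h y) \<and> (\<forall>x y. h (x * y) = h x * h y)"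

lemma rhom_add: "rhom h \<Longrightarrow> h (x + y) = h x + h y"
  and rhom_mult: "rhom h \<Longrightarrow> h (x * y) = h x * h y"
  and rhom_one: "rhom h \<Longrightarrow> h 1 = 1"
  by (auto simp: rhom_def)

lemma rhom_zero: "rhom h \<Longrightarrow> h 0 = 0"
  using rhom_add[of h 0 0] by simp

lemma rhom_uminus: "rhom h \<Longrightarrow> h (- x) = - h x"
  using rhom_add[of h x "- x"] by (simp add: rhom_zero eq_neg_iff_add_eq_0 add.commute)

lemma rhom_diff: "rhom h \<Longrightarrow> h (x - y) = h x - h y"
  using rhom_add[of h x "- y"] by (simp add: rhom_uminus)

lemma rhom_sum: "rhom h \<Longrightarrow> h (sum f A) = (\<Sum>x\<in>A. h (f x))"
  by (induction A rule: infinite_finite_induct) (auto simp: rhom_add rhom_zero)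

lemma rhom_prod: "rhom h \<Longrightarrow> h (prod f A) = (\<Prod>x\<in>A. h (f x))"
  by (induction A rule: infinite_finite_induct) (auto simp: rhom_mult rhom_one)

lemma rhom_power: "rhom h \<Longrightarrow> h (x ^ k) = h x ^ k"
  by (induction k) (auto simp: rhom_mult rhom_one)

lemma rhom_of_nat: "rhom h \<Longrightarrow> h (of_nat k) = of_nat k"
  by (induction k) (auto simp: rhom_add rhom_one rhom_zero)

lemmas rhom_simps = rhom_add rhom_mult rhom_one rhom_zero rhom_uminus rhom_diff rhom_sum
  rhom_prod rhom_power rhom_of_nat

lemma rhom_id: "rhom (\<lambda>x. x)"
  by (simp add: rhom_def)

lemma rhom_comp: "rhom g \<Longrightarrow> rhom h \<Longrightarrow> rhom (\<lambda>x. g (h x))"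
  by (simp add: rhom_def)

lemma rhom_pCons: "rhom (\<lambda>x. [:x:])"
  by (simp add: rhom_def one_pCons)

lemma rhom_const: "rhom h \<Longrightarrow> rhom (\<lambda>x. [:h x:])"
  by (rule rhom_comp[OF rhom_pCons])

lemma rhom_mconst: "rhom mconst"
  by (simp add: rhom_def mconst_def single_add mult_single)

lemma rhom_of_real: "rhom complex_of_real"
  by (simp add: rhom_def)

lemma rhom_poly: "rhom (\<lambda>p. poly p a)"
  by (simp add: rhom_def)

lemma rhom_pcompose: "rhom (\<lambda>p. pcompose p q)"
  by (simp add: rhom_def pcompose_add pcompose_mult pcompose_1)

lemma rhom_map_poly: assumes "rhom h" shows "rhom (map_poly h)"
proof -
  have [simp]: "coeff (map_poly h p) i = h (coeff p i)" for p i
    by (simp add: coeff_map_poly rhom_zero[OF assms])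
  show ?thesis
    unfolding rhom_def
    by (auto intro!: poly_eqI simp: coeff_mult rhom_simps[OF assms] one_pCons coeff_pCons split: nat.splits)
qed

section \<open>Monomials, degrees and substitution as a ring homomorphism\<close>

lemma sum_single: "p = (\<Sum>m\<in>Poly_Mapping.keys p. Poly_Mapping.single m (Poly_Mapping.lookup p m))"
proof (rule poly_mapping_eqI)
  fix k
  show "Poly_Mapping.lookup p k = Poly_Mapping.lookup
    (\<Sum>m\<in>Poly_Mapping.keys p. Poly_Mapping.single m (Poly_Mapping.lookup p m)) k"
    by (simp add: lookup_sum lookup_single when_def in_keys_iff sum.delta)
qed

definition mmon :: "('v \<Rightarrow> 's::comm_ring_1) \<Rightarrow> ('v \<Rightarrow>\<^sub>0 nat) \<Rightarrow> 's"
  where "mmon a m = (\<Prod>v\<in>Poly_Mapping.keys m. a v ^ Poly_Mapping.lookup m v)"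

lemma mmon_superset:
  assumes "finite A" "Poly_Mapping.keys m \<subseteq> A"
  shows "mmon a m = (\<Prod>v\<in>A. a v ^ Poly_Mapping.lookup m v)"
  unfolding mmon_def using assms
  by (intro prod.mono_neutral_left) (auto simp: in_keys_iff)

lemma mmon_UNIV: "mmon a m = (\<Prod>v\<in>UNIV. a v ^ Poly_Mapping.lookup m (v::'v::finite))"
  by (rule mmon_superset) auto

lemma mmon_0 [simp]: "mmon a 0 = 1"
  by (simp add: mmon_def)

lemma mmon_add: "mmon a (m + k) = mmon a m * mmon a k"
proof -
  let ?A = "Poly_Mapping.keys m \<union> Poly_Mapping.keys k"
  have "Poly_Mapping.keys (m + k) \<subseteq> ?A" by (rule keys_add)
  then show ?thesis
    by (simp add: mmon_superset[of ?A] lookup_add power_add prod.distrib)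
qed

lemma mmon_single: "mmon a (Poly_Mapping.single v k) = a v ^ k"
  by (simp add: mmon_superset[of "{v}"])

lemma mmon_scale: "mmon (\<lambda>v. t * a v) m = t ^ mdeg m * mmon a m"
  by (simp add: mmon_def mdeg_def power_mult_distrib prod.distrib power_sum)

lemma mdeg_superset:
  assumes "finite A" "Poly_Mapping.keys m \<subseteq> A"
  shows "mdeg m = (\<Sum>v\<in>A. Poly_Mapping.lookup m v)"
  unfolding mdeg_def using assms
  by (intro sum.mono_neutral_left) (auto simp: in_keys_iff)

lemma mdeg_UNIV: "mdeg m = (\<Sum>v\<in>UNIV. Poly_Mapping.lookup m (v::'v::finite))"
  by (rule mdeg_superset) auto

lemma mdeg_add: "mdeg (m + k) = mdeg m + mdeg k"
proof -
  let ?A = "Poly_Mapping.keys m \<union> Poly_Mapping.keys k"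
  have "Poly_Mapping.keys (m + k) \<subseteq> ?A" by (rule keys_add)
  then show ?thesis
    by (simp add: mdeg_superset[of ?A] lookup_add sum.distrib)
qed

lemma mdeg_0 [simp]: "mdeg 0 = 0"
  by (simp add: mdeg_def)

lemma mdeg_single [simp]: "mdeg (Poly_Mapping.single v k) = k"
  by (simp add: mdeg_superset[of "{v}"])

lemma msubst_mmon:
  "msubst h a p = (\<Sum>m\<in>Poly_Mapping.keys p. h (Poly_Mapping.lookup p m) * mmon a m)"
  by (simp add: msubst_def mmon_def)

lemma msubst_superset:
  assumes "rhom h" "finite A" "Poly_Mapping.keys p \<subseteq> A"
  shows "msubst h a p = (\<Sum>m\<in>A. h (Poly_Mapping.lookup p m) * mmon a m)"
  unfolding msubst_mmon using assms
  by (intro sum.mono_neutral_left) (auto simp: in_keys_iff rhom_zero)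

lemma msubst_single: assumes "rhom h" shows "msubst h a (Poly_Mapping.single m c) = h c * mmon a m"
  by (simp add: msubst_superset[OF assms, of "{m}"] assms)

lemma msubst_add: assumes "rhom h" shows "msubst h a (p + q) = msubst h a p + msubst h a q"
proof -
  let ?A = "Poly_Mapping.keys p \<union> Poly_Mapping.keys q"
  have "Poly_Mapping.keys (p + q) \<subseteq> ?A" by (rule keys_add)
  then show ?thesis
    by (simp add: msubst_superset[OF assms, of ?A] lookup_add rhom_add[OF assms] sum.distrib
      algebra_simps)
qed

lemma msubst_0: "msubst h a 0 = 0"
  by (simp add: msubst_def)

lemma msubst_sum: assumes "rhom h" shows "msubst h a (sum f A) = (\<Sum>x\<in>A. msubst h a (f x))"
  by (induction A rule: infinite_finite_induct) (auto simp: msubst_add[OF assms] msubst_0)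

lemma msubst_mult: assumes "rhom h" shows "msubst h a (p * q) = msubst h a p * msubst h a q"
proof -
  have "msubst h a (p * q) = msubst h a
    ((\<Sum>m\<in>Poly_Mapping.keys p. Poly_Mapping.single m (Poly_Mapping.lookup p m)) *
     (\<Sum>m\<in>Poly_Mapping.keys q. Poly_Mapping.single m (Poly_Mapping.lookup q m)))"
    by (simp flip: sum_single)
  also have "\<dots> = msubst h a p * msubst h a q"
    by (simp add: sum_product msubst_sum[OF assms] mult_single msubst_single[OF assms] mmon_add
      rhom_mult[OF assms] msubst_mmon[of h a p] msubst_mmon[of h a q] mult_ac)
  finally show ?thesis .
qed

lemma rhom_msubst: assumes "rhom h" shows "rhom (msubst h a)"
  using msubst_single[OF assms, of a 0 1]
  by (simp add: rhom_def msubst_add[OF assms] msubst_mult[OF assms] rhom_one[OF assms])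

lemma msubst_mconst: "rhom h \<Longrightarrow> msubst h a (mconst c) = h c"
  by (simp add: mconst_def msubst_single)

lemma msubst_mvar: "rhom h \<Longrightarrow> msubst h a (mvar v) = a v"
  by (simp add: mvar_def msubst_single mmon_single rhom_one)

lemma rhom_mmon: "rhom g \<Longrightarrow> g (mmon a m) = mmon (\<lambda>v. g (a v)) m"
  by (simp add: mmon_def rhom_simps)

lemma rhom_of_msubst: "rhom g \<Longrightarrow> g (msubst h a p) = msubst (\<lambda>c. g (h c)) (\<lambda>v. g (a v)) p"
  by (simp add: msubst_mmon rhom_simps rhom_mmon)

lemma mmon_mvar: "mmon mvar m = Poly_Mapping.single m (1::'r::comm_ring_1)"
proof -
  have "mmon mvar (\<Sum>v\<in>A. Poly_Mapping.single v (f v)) =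
      Poly_Mapping.single (\<Sum>v\<in>A. Poly_Mapping.single v (f v)) (1::'r)" if "finite A"
    for A :: "'a set" and f :: "'a \<Rightarrow> nat"
    using that
  proof (induction A)
    case (insert v A)
    have "mvar v ^ k = Poly_Mapping.single (Poly_Mapping.single v k) (1::'r)" for k
      by (induction k) (auto simp: mvar_def mult_single single_add[symmetric])
    with insert show ?case by (simp add: mmon_add mmon_single mult_single)
  qed simp
  from this[of "Poly_Mapping.keys m" "Poly_Mapping.lookup m"] show ?thesis
    by (simp flip: sum_single)
qed

lemma msubst_mvar_id: "msubst mconst mvar p = p"
  by (subst (2) sum_single) (simp add: msubst_mmon mmon_mvar mconst_def mult_single)

text \<open>Applying h to all coefficients is itself a substitution, hence a ring homomorphism. In
  this way h passes through \<open>lookup\<close> of products and powers without expanding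
  them.\<close>

lemma lookup_msubst_coeffs:
  assumes "rhom h"
  shows "Poly_Mapping.lookup (msubst (\<lambda>c. mconst (h c)) mvar p) m = h (Poly_Mapping.lookup p m)"
proof -
  have "msubst (\<lambda>c. mconst (h c)) mvar p =
    (\<Sum>m\<in>Poly_Mapping.keys p. Poly_Mapping.single m (h (Poly_Mapping.lookup p m)))"
    by (simp add: msubst_mmon mmon_mvar mconst_def mult_single)
  then show ?thesis
    by (simp add: lookup_sum lookup_single when_def sum.delta in_keys_iff rhom_zero[OF assms])
qed

lemma msubst_cong_vars:
  assumes "\<And>v. v \<in> mvars p \<Longrightarrow> a v = b v"
  shows "msubst h a p = msubst h b p"
  unfolding msubst_def
  by (intro sum.cong prod.cong refl arg_cong2[where f="(*)"] arg_cong2[where f="(^)"])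
     (use assms in \<open>auto simp: mvars_def\<close>)

section \<open>The unknowns that occur in a polynomial\<close>

lemma mvars_add: "mvars (p + q) \<subseteq> mvars p \<union> mvars q"
  using keys_add[of p q] by (auto simp: mvars_def)

lemma mvars_mult: "mvars (p * q) \<subseteq> mvars p \<union> mvars q"
proof
  fix v assume "v \<in> mvars (p * q)"
  then obtain m where m: "m \<in> Poly_Mapping.keys (p * q)" "v \<in> Poly_Mapping.keys m"
    by (auto simp: mvars_def)
  with keys_mult[of p q] obtain a b where
    "m = a + b" "a \<in> Poly_Mapping.keys p" "b \<in> Poly_Mapping.keys q" by blast
  with m keys_add[of a b] show "v \<in> mvars p \<union> mvars q" by (auto simp: mvars_def)
qed

lemma mvars_mconst [simp]: "mvars (mconst c) = {}"
  by (simp add: mvars_def mconst_def)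

lemma mvars_mvar: "mvars (mvar v :: ('v, 'r::comm_ring_1) mpol) = {v}"
  by (simp add: mvars_def mvar_def)

lemma mvars_sum: "(\<And>x. x \<in> A \<Longrightarrow> mvars (f x) \<subseteq> V) \<Longrightarrow> mvars (sum f A) \<subseteq> V"
proof (induction A rule: infinite_finite_induct)
  case (insert x A)
  then show ?case using mvars_add[of "f x" "sum f A"] by (fastforce simp: insert)
qed (auto simp: mvars_def)

lemma mvars_one: "mvars (1 :: ('v, 'r::comm_ring_1) mpol) = {}"
  using mvars_mconst[of 1] by (simp add: mconst_def)

lemma mvars_prod: "(\<And>x. x \<in> A \<Longrightarrow> mvars (f x) \<subseteq> V) \<Longrightarrow> mvars (prod f A) \<subseteq> V"
proof (induction A rule: infinite_finite_induct)
  case (insert x A)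
  then show ?case using mvars_mult[of "f x" "prod f A"] by (fastforce simp: insert)
qed (auto simp: mvars_one)

lemma mvars_power: "mvars p \<subseteq> V \<Longrightarrow> mvars (p ^ k) \<subseteq> V"
  using mvars_prod[of "{..<k}" "\<lambda>_. p" V] by simp

lemma mvars_msubst:
  assumes "\<And>c. mvars (h c) \<subseteq> V" "\<And>v. v \<in> mvars p \<Longrightarrow> mvars (a v) \<subseteq> V"
  shows "mvars (msubst h a p) \<subseteq> V"
  unfolding msubst_def
  by (intro mvars_sum order.trans[OF mvars_mult] Un_least assms mvars_prod mvars_power)
     (auto simp: mvars_def)

section \<open>Polynomial functions\<close>

text \<open>Along one variable the polynomial has infinitely many roots, so each coefficient
  polynomial in the remaining variables vanishes on the grid; induct on the set of variables. Grids
  rather than all points are considered because moments are only tested at real matrices near a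
  standard simplex.\<close>

lemma mpol_eq_0_if_vanishes_on_grid:
  fixes p :: "('v::finite, 'r::idom) mpol"
  assumes inf: "\<And>v. infinite (S v)"
    and zero: "\<And>a. (\<And>v. a v \<in> S v) \<Longrightarrow> meval a p = 0"
  shows "p = 0"
proof -
  have main: "(\<forall>m\<in>Poly_Mapping.keys p. Poly_Mapping.keys m \<subseteq> V) \<longrightarrow>
      (\<forall>a. (\<forall>v. a v \<in> S v) \<longrightarrow> meval a p = 0) \<longrightarrow> p = 0"
    if "finite V" for V :: "'v set" and p :: "('v, 'r) mpol"
    using that
  proof (induction V arbitrary: p)
    case empty
    show ?case
    proof (intro impI)
      assume k: "\<forall>m\<in>Poly_Mapping.keys p. Poly_Mapping.keys m \<subseteq> {}"
        and z: "\<forall>a. (\<forall>v. a v \<in> S v) \<longrightarrow> meval a p = 0"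
      have "Poly_Mapping.keys p \<subseteq> {0}" using k keys_eq_empty by auto
      then have p: "p = Poly_Mapping.single 0 (Poly_Mapping.lookup p 0)"
        by (intro poly_mapping_eqI) (auto simp: lookup_single when_def in_keys_iff)
      have "\<forall>v. \<exists>s. s \<in> S v" using inf by (metis finite.emptyI equals0I)
      then obtain a where "\<forall>v. a v \<in> S v" by metis
      with z have "meval a p = 0" by blast
      then have "Poly_Mapping.lookup p 0 = 0"
        by (subst (asm) p) (simp add: msubst_single[OF rhom_id])
      with p show "p = 0" by simp
    qed
  next
    case (insert x V)
    show ?case
    proof (intro impI)
      assume k: "\<forall>m\<in>Poly_Mapping.keys p. Poly_Mapping.keys m \<subseteq> insert x V"
        and z: "\<forall>a. (\<forall>v. a v \<in> S v) \<longrightarrow> meval a p = 0"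
      \<comment> \<open>\<open>strip m\<close> removes x from a monomial, and \<open>q j\<close>
        collects the terms of degree j in x, so that p is the sum of the
        \<open>q j * mvar x ^ j\<close>.\<close>
      define strip where "strip m = Poly_Mapping.update x 0 m" for m :: "'v \<Rightarrow>\<^sub>0 nat"
      have strip: "m = strip m + Poly_Mapping.single x (Poly_Mapping.lookup m x)" for m
        unfolding strip_def
        by (rule poly_mapping_eqI) (auto simp: lookup_add lookup_update lookup_single when_def)
      have strip_keys: "Poly_Mapping.keys (strip m) \<subseteq> Poly_Mapping.keys m - {x}" for m
        by (auto simp: strip_def in_keys_iff lookup_update split: if_splits)
      define q where "q j = (\<Sum>m | m \<in> Poly_Mapping.keys p \<and> Poly_Mapping.lookup m x = j.
          Poly_Mapping.single (strip m) (Poly_Mapping.lookup p m))" for j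
      define N where "N = Suc (Max (insert 0 ((\<lambda>m. Poly_Mapping.lookup m x) ` Poly_Mapping.keys p)))"
      have N: "Poly_Mapping.lookup m x < N" if "m \<in> Poly_Mapping.keys p" for m
        unfolding N_def less_Suc_eq_le by (rule Max_ge) (use that in auto)
      have ev: "meval a p = (\<Sum>j<N. meval a (q j) * a x ^ j)" for a
      proof -
        have "meval a p = (\<Sum>m\<in>Poly_Mapping.keys p. Poly_Mapping.lookup p m * mmon a (strip m) *
            a x ^ Poly_Mapping.lookup m x)"
          unfolding msubst_mmon
          by (intro sum.cong refl, subst (1) strip) (simp add: mmon_add mmon_single mult_ac)
        also have "\<dots> = (\<Sum>j<N. \<Sum>m | m \<in> Poly_Mapping.keys p \<and> Poly_Mapping.lookup m x = j.
           Poly_Mapping.lookup p m * mmon a (strip m) * a x ^ Poly_Mapping.lookup m x)"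
          by (rule sum.group[symmetric]) (use N in auto)
        also have "\<dots> = (\<Sum>j<N. meval a (q j) * a x ^ j)"
          by (intro sum.cong refl)
             (simp add: q_def msubst_sum[OF rhom_id] msubst_single[OF rhom_id] sum_distrib_right)
        finally show ?thesis .
      qed
      have kq: "\<forall>m\<in>Poly_Mapping.keys (q j). Poly_Mapping.keys m \<subseteq> V" for j
      proof
        fix m assume "m \<in> Poly_Mapping.keys (q j)"
        then obtain m' where "m' \<in> Poly_Mapping.keys p" "m = strip m'"
          unfolding q_def using keys_sum[of "\<lambda>m. Poly_Mapping.single (strip m) (Poly_Mapping.lookup p m)"]
          by (fastforce split: if_splits)
        with k strip_keys[of m'] show "Poly_Mapping.keys m \<subseteq> V" by blast
      qed
      have "q j = 0" for j
      proof -
        have "meval a (q j) = 0" if a: "\<forall>v. a v \<in> S v" for a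
        proof -
          \<comment> \<open>With the other coordinates frozen, \<open>P\<close> is p as a univariate
            polynomial in the value s of x: \<open>q j\<close> does not involve x and keeps its
            value under \<open>a(x := s)\<close>.\<close>
          define P where "P = (\<Sum>j<N. monom (meval a (q j)) j)"
          have "poly P s = 0" if s: "s \<in> S x" for s
          proof -
            have "meval (a(x := s)) p = (\<Sum>j<N. meval (a(x := s)) (q j) * s ^ j)"
              by (simp add: ev)
            also have "\<dots> = (\<Sum>j<N. meval a (q j) * s ^ j)"
              using kq insert(2)
              by (intro sum.cong refl arg_cong2[where f="(*)"] msubst_cong_vars) (fastforce simp: mvars_def)
            also have "\<dots> = poly P s" by (simp add: P_def poly_sum poly_monom)
            finally show ?thesis using z a s by simp
          qed
          then have "S x \<subseteq> {s. poly P s = 0}" by auto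
          with inf[of x] have "P = 0" using poly_roots_finite finite_subset by blast
          then have "coeff P j = 0" by simp
          moreover have "coeff P j = (if j < N then meval a (q j) else 0)"
            by (simp add: P_def coeff_sum coeff_monom)
          moreover have "q j = 0" if "\<not> j < N"
            unfolding q_def using N that by (intro sum.neutral) auto
          ultimately show ?thesis by (cases "j < N") (auto simp: msubst_0)
        qed
        with insert.IH[of "q j"] kq[of j] show ?thesis by blast
      qed
      moreover have "p = (\<Sum>j<N. q j * mvar x ^ j)"
      proof -
        have "p = (\<Sum>m\<in>Poly_Mapping.keys p. Poly_Mapping.single (strip m) (Poly_Mapping.lookup p m) *
            mvar x ^ Poly_Mapping.lookup m x)"
          by (subst sum_single, intro sum.cong refl, subst (1) strip)
             (simp add: mmon_single[of mvar, symmetric] mmon_mvar mult_single)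
        also have "\<dots> = (\<Sum>j<N. \<Sum>m | m \<in> Poly_Mapping.keys p \<and> Poly_Mapping.lookup m x = j.
           Poly_Mapping.single (strip m) (Poly_Mapping.lookup p m) * mvar x ^ Poly_Mapping.lookup m x)"
          by (rule sum.group[symmetric]) (use N in auto)
        also have "\<dots> = (\<Sum>j<N. q j * mvar x ^ j)"
          by (intro sum.cong refl) (simp add: q_def sum_distrib_right)
        finally show ?thesis .
      qed
      ultimately show "p = 0" by simp
    qed
  qed
  show ?thesis using main[of UNIV p] zero by auto
qed

corollary mpol_eq_if_meval_eq:
  fixes p q :: "('v::finite, 'r::{idom,ring_char_0}) mpol"
  assumes "\<And>a. meval a p = meval a q"
  shows "p = q"
proof -
  have "p - q = 0"
    by (rule mpol_eq_0_if_vanishes_on_grid[of "\<lambda>_. UNIV"])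
       (simp_all add: rhom_diff[OF rhom_msubst[OF rhom_id]] assms infinite_UNIV_char_0)
  then show ?thesis by simp
qed

section \<open>Binary forms and Brill's form\<close>

text \<open>The value at \<open>(s, t)\<close> of the binary form of degree N that dehomogenizes to p at \<open>t = 1\<close>.\<close>

definition hp2 :: "nat \<Rightarrow> 'r::comm_ring_1 poly \<Rightarrow> 'r \<Rightarrow> 'r \<Rightarrow> 'r"
  where "hp2 N p s t = (\<Sum>j\<le>N. coeff p j * s ^ j * t ^ (N - j))"

lemma hp2_sum: "hp2 N (sum f A) s t = (\<Sum>x\<in>A. hp2 N (f x) s t)"
  by (simp add: hp2_def coeff_sum sum_distrib_right sum.swap[of _ "{..N}"])

lemma coeff_mult_linear: "coeff (p * [:a, b:]) k = a * coeff p k + (case k of 0 \<Rightarrow> 0 | Suc i \<Rightarrow> b * coeff p i)"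
  by (subst mult.commute) (simp add: coeff_pCons split: nat.splits)

lemma hp2_mult_linear:
  assumes "degree p \<le> N"
  shows "hp2 (Suc N) (p * [:a, b:]) s t = hp2 N p s t * (a * t + b * s)"
proof -
  have z: "coeff p (Suc N) = 0" using assms by (intro coeff_eq_0) simp
  have "hp2 (Suc N) (p * [:a, b:]) s t =
      (\<Sum>j\<le>Suc N. a * coeff p j * s ^ j * t ^ (Suc N - j)) +
      (\<Sum>j\<le>Suc N. (case j of 0 \<Rightarrow> 0 | Suc i \<Rightarrow> b * coeff p i) * s ^ j * t ^ (Suc N - j))"
    unfolding hp2_def coeff_mult_linear distrib_right sum.distrib by (rule refl)
  also have "(\<Sum>j\<le>Suc N. a * coeff p j * s ^ j * t ^ (Suc N - j)) = hp2 N p s t * (a * t)"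
    by (simp add: z hp2_def sum_distrib_left sum_distrib_right Suc_diff_le mult_ac)
  also have "(\<Sum>j\<le>Suc N. (case j of 0 \<Rightarrow> 0 | Suc i \<Rightarrow> b * coeff p i) * s ^ j * t ^ (Suc N - j))
      = hp2 N p s t * (b * s)"
    by (simp add: sum.atMost_Suc_shift hp2_def sum_distrib_left sum_distrib_right mult_ac del: sum.atMost_Suc)
  finally show ?thesis by (simp add: algebra_simps)
qed

lemma degree_mult_linear_power: "degree p \<le> N \<Longrightarrow> degree (p * [:a, b:] ^ k) \<le> N + k"
proof (induction k)
  case (Suc k)
  have "degree (p * [:a, b:] ^ k * [:a, b:]) \<le> degree (p * [:a, b:] ^ k) + degree [:a, b:]"
    by (rule degree_mult_le)
  also have "\<dots> \<le> N + k + 1" using Suc by (intro add_mono) auto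
  finally show ?case by (simp add: mult_ac)
qed simp

lemma hp2_mult_linear_power:
  assumes "degree p \<le> N"
  shows "hp2 (N + k) (p * [:a, b:] ^ k) s t = hp2 N p s t * (a * t + b * s) ^ k"
proof (induction k)
  case (Suc k)
  have "hp2 (N + Suc k) (p * [:a, b:] ^ Suc k) s t = hp2 (Suc (N + k)) (p * [:a, b:] ^ k * [:a, b:]) s t"
    by (simp only: power_Suc mult_ac add_Suc_right)
  also have "\<dots> = hp2 N p s t * (a * t + b * s) ^ Suc k"
    by (subst hp2_mult_linear) (auto intro: degree_mult_linear_power assms simp: Suc algebra_simps)
  finally show ?case .
qed simp

text \<open>Degree bound and value go through one induction, since splitting a linear factor off
  \<open>hp2\<close> presupposes the degree bound for the rest of the product.\<close>

lemma hp2_mult_prod_linear_power: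
  assumes "degree p \<le> N" "finite A"
  shows "degree (p * (\<Prod>i\<in>A. [:a i, b i:] ^ k i)) \<le> N + sum k A \<and>
    hp2 (N + sum k A) (p * (\<Prod>i\<in>A. [:a i, b i:] ^ k i)) s t = hp2 N p s t * (\<Prod>i\<in>A. (a i * t + b i * s) ^ k i)"
  using assms(2)
proof induction
  case (insert x A)
  let ?q = "p * (\<Prod>i\<in>A. [:a i, b i:] ^ k i)"
  have 1: "p * (\<Prod>i\<in>insert x A. [:a i, b i:] ^ k i) = ?q * [:a x, b x:] ^ k x"
    using insert by (simp add: mult_ac)
  have 2: "N + sum k (insert x A) = N + sum k A + k x" using insert by simp
  show ?case
    using insert degree_mult_linear_power[of ?q "N + sum k A"]
    unfolding 1 2 by (subst hp2_mult_linear_power) (simp_all add: mult_ac)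
qed (use assms in simp)

lemma hp2_prod_linear:
  assumes "finite A"
  shows "hp2 (card A) (\<Prod>i\<in>A. [:a i, b i:]) s t = (\<Prod>i\<in>A. a i * t + b i * s)"
  using hp2_mult_prod_linear_power[of 1 0 A a b "\<lambda>_. 1" s t] assms by (simp add: hp2_def)

lemma mdeg_exponent: "mdeg (exponent (I :: 'd::finite exps)) \<le> CARD('d) + 1"
  using exponent[of I] by simp

text \<open>On the span of a and b the form becomes a binary form. This links the univariate
  polynomial entering \<open>vertical_product\<close> to values of the form at actual
  points.\<close>

lemma hform_line:
  fixes c :: "'d::finite exps \<Rightarrow> 's::comm_ring_1"
  shows "hform c (\<lambda>i. t * a i + s * b i) =
    hp2 (CARD('d) + 1) (hform (\<lambda>I. [:c I:]) (\<lambda>i. [:a i, b i:])) s t"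
proof -
  have "hp2 (CARD('d) + 1) ([:c I:] * [:a None, b None:] ^ (CARD('d) + 1 - mdeg (exponent I)) *
        (\<Prod>l\<in>UNIV. [:a (Some l), b (Some l):] ^ Poly_Mapping.lookup (exponent I) l)) s t
     = c I * (t * a None + s * b None) ^ (CARD('d) + 1 - mdeg (exponent I)) *
       (\<Prod>l\<in>UNIV. (t * a (Some l) + s * b (Some l)) ^ Poly_Mapping.lookup (exponent I) l)" for I
  proof -
    let ?k = "CARD('d) + 1 - mdeg (exponent I)"
    let ?p = "[:c I:] * [:a None, b None:] ^ ?k"
    have n: "CARD('d) + 1 = (0 + ?k) + (\<Sum>l\<in>UNIV. Poly_Mapping.lookup (exponent I) l)"
      using mdeg_exponent[of I] by (simp add: mdeg_UNIV[symmetric])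
    have d: "degree ?p \<le> 0 + ?k" by (rule degree_mult_linear_power) simp
    have e: "hp2 (0 + ?k) ?p s t = c I * (t * a None + s * b None) ^ ?k"
      by (subst hp2_mult_linear_power) (auto simp: hp2_def mult_ac)
    show ?thesis
      by (subst (1) n, subst hp2_mult_prod_linear_power[THEN conjunct2, OF d]) (simp_all only: e finite, simp add: mult_ac)
  qed
  then show ?thesis by (simp add: hform_def hp2_sum)
qed

text \<open>\<open>hform\<close> is linear but not multiplicative in its coefficients. Scaling the
  affine variables by a polynomial unknown and homogenizing the resulting univariate polynomial
  gives the same value, and this route respects products: \<open>msubst\<close> is a homomorphism
  and \<open>hp2\<close> splits off linear factors.\<close>

lemma hform_eq_hp2:
  fixes P :: "('d::finite, 'r::comm_ring_1) mpol"
  assumes g: "rhom g" and P: "\<And>m. m \<in> Poly_Mapping.keys P \<Longrightarrow> mdeg m \<le> CARD('d) + 1"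
  shows "hform (\<lambda>I. g (Poly_Mapping.lookup P (exponent I))) v =
    hp2 (CARD('d) + 1) (msubst (\<lambda>c. [:g c:]) (\<lambda>l. [:0, v (Some l):]) P) 1 (v None)"
proof -
  let ?c = "\<lambda>I. g (Poly_Mapping.lookup P (exponent I))"
  have img: "exponent ` (UNIV :: 'd exps set) = {I. mdeg I \<le> CARD('d) + 1}"
    using type_definition.Rep_range[OF type_definition_exps] .
  have inj: "inj exponent" by (simp add: inj_def exponent_inject)
  have "msubst (\<lambda>c. [:g c:]) (\<lambda>l. [:0, v (Some l):]) P =
    (\<Sum>m\<in>range exponent. [:g (Poly_Mapping.lookup P m):] * mmon (\<lambda>l. [:0, v (Some l):]) m)"
    by (rule msubst_superset[OF rhom_const[OF g]], simp) (use P in \<open>unfold img, auto\<close>)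
  also have "\<dots> = (\<Sum>I\<in>UNIV. [:?c I:] * mmon (\<lambda>l. [:0, v (Some l):]) (exponent I))"
    by (simp add: sum.reindex[OF inj])
  finally have 1: "msubst (\<lambda>c. [:g c:]) (\<lambda>l. [:0, v (Some l):]) P = \<dots>" .
  have 2: "hp2 (CARD('d) + 1) ([:?c I:] * mmon (\<lambda>l. [:0, v (Some l):]) (exponent I)) 1 (v None)
     = ?c I * v None ^ (CARD('d) + 1 - mdeg (exponent I)) *
       (\<Prod>l\<in>UNIV. v (Some l) ^ Poly_Mapping.lookup (exponent I) l)" for I
  proof -
    let ?k = "CARD('d) + 1 - mdeg (exponent I)"
    let ?p = "[:?c I:] * [:1, 0:] ^ ?k"
    have n: "CARD('d) + 1 = (0 + ?k) + (\<Sum>l\<in>UNIV. Poly_Mapping.lookup (exponent I) l)"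
      using mdeg_exponent[of I] by (simp add: mdeg_UNIV[symmetric])
    have d: "degree ?p \<le> 0 + ?k" by (rule degree_mult_linear_power) simp
    have e: "hp2 (0 + ?k) ?p 1 (v None) = ?c I * v None ^ ?k"
      by (subst hp2_mult_linear_power) (auto simp: hp2_def mult_ac)
    have f: "[:?c I:] * mmon (\<lambda>l. [:0, v (Some l):]) (exponent I) =
      ?p * (\<Prod>l\<in>UNIV. [:0, v (Some l):] ^ Poly_Mapping.lookup (exponent I) l)"
      by (simp add: mmon_UNIV one_pCons[symmetric])
    show ?thesis
      by (subst (1) n, subst f, subst hp2_mult_prod_linear_power[THEN conjunct2, OF d]) (simp_all only: e finite, simp add: mult_ac)
  qed
  show ?thesis by (simp only: 1 hp2_sum 2 hform_def)
qed

lemma mdeg_keys_mult: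
  assumes "\<And>m. m \<in> Poly_Mapping.keys p \<Longrightarrow> mdeg m \<in> D"
    and "\<And>m. m \<in> Poly_Mapping.keys q \<Longrightarrow> mdeg m \<in> E"
    and "m \<in> Poly_Mapping.keys (p * q)"
  shows "\<exists>i\<in>D. \<exists>j\<in>E. mdeg m = i + j"
proof -
  obtain a b where "m = a + b" "a \<in> Poly_Mapping.keys p" "b \<in> Poly_Mapping.keys q"
    using assms(3) keys_mult[of p q] by auto
  with assms(1,2) show ?thesis by (auto simp: mdeg_add)
qed

section \<open>Degree bounds and homogeneous polynomials\<close>

definition mdle :: "nat \<Rightarrow> ('v, 'r::comm_ring_1) mpol \<Rightarrow> bool"
  where "mdle N p \<longleftrightarrow> (\<forall>m\<in>Poly_Mapping.keys p. mdeg m \<le> N)"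

lemma mdle_mult: "mdle N p \<Longrightarrow> mdle M q \<Longrightarrow> mdle (N + M) (p * q)"
  unfolding mdle_def
proof
  fix m assume "\<forall>m\<in>Poly_Mapping.keys p. mdeg m \<le> N" "\<forall>m\<in>Poly_Mapping.keys q. mdeg m \<le> M"
    "m \<in> Poly_Mapping.keys (p * q)"
  with mdeg_keys_mult[of p "{..N}" q "{..M}" m] show "mdeg m \<le> N + M" by fastforce
qed

lemma mdle_add: "mdle N p \<Longrightarrow> mdle N q \<Longrightarrow> mdle N (p + q)"
  using keys_add[of p q] by (auto simp: mdle_def)

lemma mdle_diff: "mdle N p \<Longrightarrow> mdle N q \<Longrightarrow> mdle N (p - q)"
  using keys_diff[of p q] by (auto simp: mdle_def)

lemma mdle_sum: "(\<And>x. x \<in> A \<Longrightarrow> mdle N (f x)) \<Longrightarrow> mdle N (sum f A)"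
  by (induction A rule: infinite_finite_induct) (auto simp: mdle_add mdle_def[of N 0])

lemma mdle_mconst: "mdle N (mconst c)"
  by (simp add: mdle_def mconst_def)

lemma mdle_one: "mdle N 1"
  using mdle_mconst[of N 1] by (simp add: mconst_def)

lemma mdle_mvar: "mdle 1 (mvar v)"
  by (simp add: mdle_def mvar_def)

lemma mdle_prod: "(\<And>x. x \<in> A \<Longrightarrow> mdle (f x) (g x)) \<Longrightarrow> mdle (sum f A) (prod g A)"
  by (induction A rule: infinite_finite_induct) (auto simp: mdle_mult mdle_one)

definition hdeg :: "nat \<Rightarrow> ('v, 'r::comm_ring_1) mpol \<Rightarrow> bool"
  where "hdeg N p \<longleftrightarrow> (\<forall>m\<in>Poly_Mapping.keys p. mdeg m = N)"

lemma hdeg_mult: "hdeg N p \<Longrightarrow> hdeg M q \<Longrightarrow> hdeg (N + M) (p * q)"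
  unfolding hdeg_def
proof
  fix m assume "\<forall>m\<in>Poly_Mapping.keys p. mdeg m = N" "\<forall>m\<in>Poly_Mapping.keys q. mdeg m = M"
    "m \<in> Poly_Mapping.keys (p * q)"
  with mdeg_keys_mult[of p "{N}" q "{M}" m] show "mdeg m = N + M" by fastforce
qed

lemma hdeg_add: "hdeg N p \<Longrightarrow> hdeg N q \<Longrightarrow> hdeg N (p + q)"
  using keys_add[of p q] by (auto simp: hdeg_def)

lemma hdeg_sum: "(\<And>x. x \<in> A \<Longrightarrow> hdeg N (f x)) \<Longrightarrow> hdeg N (sum f A)"
  by (induction A rule: infinite_finite_induct) (auto simp: hdeg_add hdeg_def[of N 0])

lemma hdeg_mconst: "hdeg 0 (mconst c)"
  by (simp add: hdeg_def mconst_def)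

lemma hdeg_mvar: "hdeg 1 (mvar v)"
  by (simp add: hdeg_def mvar_def)

lemma hdeg_prod: "(\<And>x. x \<in> A \<Longrightarrow> hdeg (f x) (g x)) \<Longrightarrow> hdeg (sum f A) (prod g A)"
  by (induction A rule: infinite_finite_induct) (auto simp: hdeg_mult hdeg_def[of 0 1])

lemma hdeg_power: "hdeg N p \<Longrightarrow> hdeg (k * N) (p ^ k)"
  using hdeg_prod[of "{..<k}" "\<lambda>_. N" "\<lambda>_. p"] by simp

section \<open>Products of linear factors with constant term 1\<close>

definition lin_prod :: "('k::finite \<Rightarrow> 'd::finite \<Rightarrow> 'r::comm_ring_1) \<Rightarrow> ('d, 'r) mpol"
  where "lin_prod X = (\<Prod>k\<in>UNIV. 1 - (\<Sum>l\<in>UNIV. mconst (X k l) * mvar l))"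

lemma msubst_lin_prod:
  "rhom g \<Longrightarrow> msubst g v (lin_prod X) = (\<Prod>k\<in>UNIV. 1 - (\<Sum>l\<in>UNIV. g (X k l) * v l))"
  by (simp add: lin_prod_def rhom_simps[OF rhom_msubst] msubst_mconst msubst_mvar)

lemma mdle_lin_prod: "mdle CARD('k) (lin_prod (X :: 'k::finite \<Rightarrow> 'd::finite \<Rightarrow> 'r::comm_ring_1))"
proof -
  have "mdle (\<Sum>k\<in>(UNIV::'k set). 1) (lin_prod X)"
    unfolding lin_prod_def
    by (intro mdle_prod mdle_diff mdle_one mdle_sum) (use mdle_mult[OF mdle_mconst mdle_mvar, of 0] in simp)
  then show ?thesis by simp
qed

text \<open>There are exactly d + 1 factors, and each homogenizes to a linear form, a zero row of X
  giving \<open>v None\<close>; so the homogenization to degree d + 1 is the product of these forms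
  even when the degree of the affine product drops.\<close>

lemma hform_lin_prod:
  fixes X :: "'d option \<Rightarrow> 'd::finite \<Rightarrow> 'r::comm_ring_1"
  assumes g: "rhom g"
  shows "hform (\<lambda>I. g (Poly_Mapping.lookup (lin_prod X) (exponent I))) v =
    (\<Prod>k\<in>UNIV. v None - (\<Sum>l\<in>UNIV. g (X k l) * v (Some l)))"
proof -
  have "hform (\<lambda>I. g (Poly_Mapping.lookup (lin_prod X) (exponent I))) v =
    hp2 (CARD('d) + 1) (msubst (\<lambda>c. [:g c:]) (\<lambda>l. [:0, v (Some l):]) (lin_prod X)) 1 (v None)"
    by (rule hform_eq_hp2[OF g]) (use mdle_lin_prod[of X] in \<open>simp add: mdle_def\<close>)
  also have "msubst (\<lambda>c. [:g c:]) (\<lambda>l. [:0, v (Some l):]) (lin_prod X) =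
     (\<Prod>k\<in>UNIV. [:1, - (\<Sum>l\<in>UNIV. g (X k l) * v (Some l)):])"
  proof -
    have "1 - (\<Sum>l\<in>UNIV. [:0, g (X k l) * v (Some l):]) = [:1, - (\<Sum>l\<in>UNIV. g (X k l) * v (Some l)):]" for k
      by (rule poly_eqI) (simp add: coeff_sum coeff_pCons one_pCons sum.If_cases split: nat.splits)
    moreover have const_mult: "[:a:] * [:0, b:] = [:0, a * b:]" for a b :: "'x::comm_ring_1" by simp
    ultimately show ?thesis
      by (simp only: msubst_lin_prod[OF rhom_const[OF g]] const_mult)
  qed
  also have "hp2 (CARD('d) + 1) \<dots> 1 (v None) = (\<Prod>k\<in>UNIV. v None - (\<Sum>l\<in>UNIV. g (X k l) * v (Some l)))"
    using hp2_prod_linear[of "UNIV :: 'd option set" "\<lambda>_. 1" _ 1 "v None"] by (simp add: algebra_simps)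
  finally show ?thesis .
qed

section \<open>Naturality of Brill's form in the coefficient ring\<close>

lemma rhom_hform: "rhom h \<Longrightarrow> h (hform c v) = hform (\<lambda>I. h (c I)) (\<lambda>i. h (v i))"
  by (simp add: hform_def rhom_simps)

lemma rhom_newton_pow: "rhom h \<Longrightarrow> h (newton_pow e k) = newton_pow (\<lambda>i. h (e i)) k"
proof (induction e k rule: newton_pow.induct)
  case (2 e k)
  then show ?case by (simp add: rhom_simps del: of_nat_Suc)
qed (simp add: rhom_zero)

lemma coeff_map_poly_rhom: "rhom h \<Longrightarrow> coeff (map_poly h p) i = h (coeff p i)"
  by (simp add: coeff_map_poly rhom_zero)

lemma map_poly_pCons_rhom: "rhom h \<Longrightarrow> map_poly h (pCons a p) = pCons (h a) (map_poly h p)"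
  by (rule poly_eqI) (auto simp: coeff_map_poly_rhom coeff_pCons split: nat.splits)

lemma rhom_vertical_product:
  "rhom h \<Longrightarrow> h (vertical_product n G H) = vertical_product n (map_poly h G) (map_poly h H)"
  by (simp add: vertical_product_def rhom_simps coeff_map_poly_rhom del: of_nat_mult of_nat_fact)

lemma rhom_brill_form:
  assumes h: "rhom h"
  shows "h (brill_form c x y z) = brill_form (\<lambda>I. h (c I)) (\<lambda>i. h (x i)) (\<lambda>i. h (y i)) (\<lambda>i. h (z i))"
proof -
  note h1 = rhom_map_poly[OF h]
  note h2 = rhom_map_poly[OF h1]
  have "map_poly h (newton_pow (\<lambda>i. coeff E i) n) = newton_pow (\<lambda>i. coeff (map_poly (map_poly h) E) i) n"
    for E n by (simp add: rhom_newton_pow[OF h1] coeff_map_poly_rhom[OF h1])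
  then show ?thesis
    by (simp add: brill_form_def Let_def del: newton_pow.simps add: rhom_vertical_product[OF h] rhom_hform[OF h1] rhom_hform[OF h2]
      map_poly_pCons_rhom[OF h] map_poly_pCons_rhom[OF h1])
qed

text \<open>Both sides are the coefficient of degree k of the derivative of the product, on the left
  by the product rule.\<close>

lemma coeff_prod_linear_deriv:
  fixes p q :: "'i \<Rightarrow> 'r::comm_ring_1"
  assumes "finite A"
  shows "(\<Sum>j\<in>A. q j * coeff (\<Prod>i\<in>A - {j}. [:p i, q i:]) k) = of_nat (Suc k) * coeff (\<Prod>i\<in>A. [:p i, q i:]) (Suc k)"
  using assms
proof (induction A arbitrary: k)
  case (insert x A)
  let ?E = "\<Prod>i\<in>A. [:p i, q i:]"
  let ?E' = "\<lambda>j. \<Prod>i\<in>A - {j}. [:p i, q i:]"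
  have E: "(\<Prod>i\<in>insert x A. [:p i, q i:]) = ?E * [:p x, q x:]"
    using insert by (simp add: mult_ac)
  have Ej: "(\<Prod>i\<in>insert x A - {j}. [:p i, q i:]) = ?E' j * [:p x, q x:]" if "j \<in> A" for j
  proof -
    have "insert x A - {j} = insert x (A - {j})" using insert that by auto
    then show ?thesis using insert by (simp add: mult_ac)
  qed
  have Ex: "insert x A - {x} = A" using insert by auto
  have "(\<Sum>j\<in>insert x A. q j * coeff (\<Prod>i\<in>insert x A - {j}. [:p i, q i:]) k) =
    q x * coeff ?E k + (\<Sum>j\<in>A. q j * coeff (?E' j * [:p x, q x:]) k)"
    using insert by (simp add: Ex Ej)
  also have "(\<Sum>j\<in>A. q j * coeff (?E' j * [:p x, q x:]) k) =
     p x * (\<Sum>j\<in>A. q j * coeff (?E' j) k) +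
     (case k of 0 \<Rightarrow> 0 | Suc i \<Rightarrow> q x * (\<Sum>j\<in>A. q j * coeff (?E' j) i))"
    unfolding coeff_mult_linear distrib_left sum.distrib
    by (cases k) (simp_all add: sum_distrib_left mult_ac)
  also have "q x * coeff ?E k + \<dots> = of_nat (Suc k) * coeff (?E * [:p x, q x:]) (Suc k)"
    unfolding insert.IH coeff_mult_linear by (cases k) (simp_all add: algebra_simps)
  finally show ?case by (simp add: E)
qed simp

text \<open>Newton's identities hold for each root separately up to a remainder: the sum over i
  telescopes for fixed j and leaves a (k+1)-st power and a term in \<open>e' j k\<close>. By
  \<open>coeff_prod_linear_deriv\<close> these terms add up to what the last summand of the
  recursion cancels.\<close>

lemma newton_pow_prod_linear:
  fixes p q :: "'i \<Rightarrow> 'r::comm_ring_1"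
  assumes A: "finite A" and k: "k > 0"
  shows "newton_pow (\<lambda>i. coeff (\<Prod>j\<in>A. [:p j, q j:]) i) k = (\<Sum>j\<in>A. (q j * (\<Prod>i\<in>A - {j}. p i)) ^ k)"
  using k
proof (induction k rule: less_induct)
  case (less k0)
  then obtain k where k0: "k0 = Suc k" using gr0_implies_Suc by blast
  define e where "e i = coeff (\<Prod>j\<in>A. [:p j, q j:]) i" for i
  define e' where "e' j i = coeff (\<Prod>i\<in>A - {j}. [:p i, q i:]) i" for i j
  define a where "a j = q j * (\<Prod>i\<in>A - {j}. p i)" for j
  have c0: "coeff (\<Prod>j\<in>B. [:p j, q j:]) 0 = (\<Prod>j\<in>B. p j)" for B
    by (simp flip: poly_0_coeff_0 add: poly_prod)
  have ek: "e (Suc i) = p j * e' j (Suc i) + q j * e' j i" if "j \<in> A" for i j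
  proof -
    have "(\<Prod>j\<in>A. [:p j, q j:]) = (\<Prod>i\<in>A - {j}. [:p i, q i:]) * [:p j, q j:]"
      using A that by (subst prod.remove[of A j]) (auto simp: mult_ac)
    then show ?thesis unfolding e_def e'_def by (simp only: coeff_mult_linear) simp
  qed
  have pa: "p j * a j = q j * e 0" if "j \<in> A" for j
    unfolding a_def e_def c0 using A that by (simp add: prod.remove[of A j] mult_ac)
  have tel: "(\<Sum>i<k. (-1) ^ i * e (Suc i) * e 0 ^ i * a j ^ (k - i)) =
      a j ^ Suc k - (-1) ^ k * (q j * e' j k) * e 0 ^ k" if j: "j \<in> A" for j
  proof -
    \<comment> \<open>The summands are differences of consecutive signed \<open>T i\<close>:
      \<open>ek\<close> splits \<open>e (Suc i)\<close> into two terms, and \<open>pa\<close> trades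
      \<open>p j * a j\<close> for \<open>q j * e 0\<close>, which raises the index of T by
      one.\<close>
    define T where "T i = q j * e' j i * e 0 ^ i * a j ^ (k - i)" for i
    have "(-1) ^ i * e (Suc i) * e 0 ^ i * a j ^ (k - i) = (-1) ^ i * T i - (-1) ^ Suc i * T (Suc i)" if "i < k" for i
    proof -
      have ki: "k - i = Suc (k - Suc i)" using that by simp
      have "p j * e' j (Suc i) * e 0 ^ i * a j ^ (k - i) = (p j * a j) * e' j (Suc i) * e 0 ^ i * a j ^ (k - Suc i)"
        by (simp add: ki mult_ac)
      also have "\<dots> = T (Suc i)" unfolding pa[OF j] T_def by (simp add: mult_ac)
      finally have *: "p j * e' j (Suc i) * e 0 ^ i * a j ^ (k - i) = T (Suc i)" .
      have "(-1) ^ i * e (Suc i) * e 0 ^ i * a j ^ (k - i) =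
        (-1) ^ i * (p j * e' j (Suc i) * e 0 ^ i * a j ^ (k - i)) + (-1) ^ i * T i"
        by (simp add: ek[OF j] algebra_simps T_def)
      then show ?thesis unfolding * by simp
    qed
    then have "(\<Sum>i<k. (-1) ^ i * e (Suc i) * e 0 ^ i * a j ^ (k - i)) =
        (\<Sum>i<k. (-1) ^ i * T i - (-1) ^ Suc i * T (Suc i))" by simp
    also have "\<dots> = T 0 - (-1) ^ k * T k"
      by (subst sum_lessThan_telescope'[of "\<lambda>i. (-1) ^ i * T i"]) simp
    finally show ?thesis by (simp add: T_def a_def e'_def c0 mult_ac)
  qed
  have "newton_pow e k0 = (\<Sum>i<k. (-1) ^ i * e (Suc i) * e 0 ^ i * (\<Sum>j\<in>A. a j ^ (k - i)))
     + (-1) ^ k * of_nat (Suc k) * e (Suc k) * e 0 ^ k"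
    unfolding k0 newton_pow.simps
    by (intro arg_cong2[where f="(+)"] sum.cong refl arg_cong2[where f="(*)"])
       (use less.IH in \<open>auto simp: k0 a_def e_def[abs_def]\<close>)
  also have "(\<Sum>i<k. (-1) ^ i * e (Suc i) * e 0 ^ i * (\<Sum>j\<in>A. a j ^ (k - i))) =
     (\<Sum>j\<in>A. \<Sum>i<k. (-1) ^ i * e (Suc i) * e 0 ^ i * a j ^ (k - i))"
    by (simp add: sum_distrib_left sum.swap[of _ A])
  also have "\<dots> = (\<Sum>j\<in>A. a j ^ Suc k) - (-1) ^ k * (\<Sum>j\<in>A. q j * e' j k) * e 0 ^ k"
    by (simp add: tel sum_subtractf sum_distrib_left sum_distrib_right del: power_Suc)
  also have "(\<Sum>j\<in>A. q j * e' j k) = of_nat (Suc k) * e (Suc k)"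
    unfolding e'_def e_def by (rule coeff_prod_linear_deriv[OF A])
  finally show ?case by (simp add: k0 a_def e_def[abs_def] mult_ac)
qed

text \<open>Homogeneity of degree k in e: a summand of the recursion for k + 1 has degree 1 + i + (k
  - i).\<close>

lemma newton_pow_scale: "newton_pow (\<lambda>i. s * e i) k = s ^ k * newton_pow e k"
proof (induction e k rule: newton_pow.induct)
  case (2 e k)
  have *: "s * s ^ i * s ^ (k - i) = s * s ^ k" if "i < k" for i
    using that power_add[of s i "k - i"] by (simp add: mult_ac)
  then have "(-1) ^ i * (s * e (Suc i)) * (s * e 0) ^ i * newton_pow (\<lambda>i. s * e i) (k - i) =
     s ^ Suc k * ((-1) ^ i * e (Suc i) * e 0 ^ i * newton_pow e (k - i))" if "i < k" for i
  proof -
    have "(-1) ^ i * (s * e (Suc i)) * (s * e 0) ^ i * newton_pow (\<lambda>i. s * e i) (k - i) =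
      (s * s ^ i * s ^ (k - i)) * ((-1) ^ i * e (Suc i) * e 0 ^ i * newton_pow e (k - i))"
      using that 2[of i] by (simp add: power_mult_distrib mult_ac)
    then show ?thesis using * that by simp
  qed
  then show ?case by (simp add: sum_distrib_left distrib_left power_mult_distrib mult_ac)
qed simp

text \<open>Isobaric of weight k when \<open>e i\<close> has weight i: \<open>e 0\<close> has weight
  0 and a summand of the recursion has weight (i + 1) + (k - i). Together with the homogeneity this
  clears all powers of \<epsilon> when z tends to a zero along an arc.\<close>

lemma newton_pow_weight: "newton_pow (\<lambda>i. s ^ i * e i) k = s ^ k * newton_pow e k"
proof (induction e k rule: newton_pow.induct)
  case (2 e k)
  have *: "s ^ Suc i * s ^ (k - i) = s ^ Suc k" if "i < k" for i
    using that power_add[of s i "k - i"] by (simp add: mult_ac)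
  then have "(-1) ^ i * (s ^ Suc i * e (Suc i)) * e 0 ^ i * newton_pow (\<lambda>i. s ^ i * e i) (k - i) =
     s ^ Suc k * ((-1) ^ i * e (Suc i) * e 0 ^ i * newton_pow e (k - i))" if "i < k" for i
  proof -
    have "(-1) ^ i * (s ^ Suc i * e (Suc i)) * e 0 ^ i * newton_pow (\<lambda>i. s ^ i * e i) (k - i) =
      (s ^ Suc i * s ^ (k - i)) * ((-1) ^ i * e (Suc i) * e 0 ^ i * newton_pow e (k - i))"
      using that 2[of i] by (simp add: mult_ac del: power_Suc)
    then show ?thesis using * that by simp
  qed
  then show ?case by (simp add: sum_distrib_left distrib_left mult_ac)
qed simp

lemma vertical_product_sum: "vertical_product n G (sum f A) = (\<Sum>j\<in>A. vertical_product n G (f j))"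
  by (simp add: vertical_product_def coeff_sum sum_distrib_left sum.swap[of _ A])

lemma vertical_product_smult: "vertical_product n G ([:s:] * H) = s * vertical_product n G H"
  by (simp add: vertical_product_def sum_distrib_left mult_ac)

text \<open>Against the n-th power of the linear form b + a\<alpha>, the binomial coefficients
  cancel the factorials, and what remains is n! times G at the zero (b, -a) of that linear
  form.\<close>

lemma vertical_product_power:
  "vertical_product n G ([:b, a:] ^ n) = of_nat (fact n) * hp2 n G b (- a :: 'a::comm_ring_1)"
proof -
  have "vertical_product n G ([:b, a:] ^ n) = (\<Sum>k\<le>n. of_nat (fact n) * (coeff G (n - k) * b ^ (n - k) * (- a) ^ k))"
    unfolding vertical_product_def
  proof (intro sum.cong refl)
    fix k assume "k \<in> {..n}"
    then have kn: "k \<le> n" by simp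
    then have "fact k * fact (n - k) * (n choose k) = fact n"
      by (simp add: binomial_fact_lemma)
    then have "of_nat (fact k * fact (n - k)) * of_nat (n choose k) = (of_nat (fact n) :: 'a)"
      by (metis of_nat_mult)
    moreover have "(-1) ^ k * of_nat (fact k * fact (n - k)) * coeff G (n - k) * (of_nat (n choose k) * a ^ k * b ^ (n - k))
      = (of_nat (fact k * fact (n - k)) * of_nat (n choose k)) * (coeff G (n - k) * b ^ (n - k) * ((-1) ^ k * a ^ k))"
      by (simp only: mult_ac)
    ultimately have "(-1) ^ k * of_nat (fact k * fact (n - k)) * coeff G (n - k) * (of_nat (n choose k) * a ^ k * b ^ (n - k))
      = of_nat (fact n) * (coeff G (n - k) * b ^ (n - k) * ((-1) ^ k * a ^ k))"
      by simp
    then show "(-1) ^ k * of_nat (fact k * fact (n - k)) * coeff G (n - k) * coeff ([:b, a:] ^ n) k =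
         of_nat (fact n) * (coeff G (n - k) * b ^ (n - k) * (- a) ^ k)"
      by (simp only: coeff_linear_poly_power[OF kn] power_minus[of a k])
  qed
  also have "\<dots> = of_nat (fact n) * (\<Sum>k\<le>n. coeff G (n - k) * b ^ (n - k) * (- a) ^ k)"
    by (simp add: sum_distrib_left)
  also have "(\<Sum>k\<le>n. coeff G (n - k) * b ^ (n - k) * (- a) ^ k) = hp2 n G b (- a)"
    unfolding hp2_def by (subst sum.nat_diff_reindex[symmetric, of _ "Suc n", simplified lessThan_Suc_atMost]) simp
  finally show ?thesis .
qed

text \<open>The Newton sum is a combination of n-th powers of the factors \<open>l j\<close>, so the
  vertical product evaluates f at zeros of its own factors.\<close>

lemma brill_form_lin_prod:
  fixes X :: "'d option \<Rightarrow> 'd::finite \<Rightarrow> 'r::comm_ring_1"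
  assumes g: "rhom g"
  shows "brill_form (\<lambda>I. g (Poly_Mapping.lookup (lin_prod X) (exponent I))) x y z = 0"
proof -
  define l where "l k v = v None - (\<Sum>l\<in>UNIV. g (X k l) * v (Some l))" for k v
  let ?n = "CARD('d) + 1"
  note g1 = rhom_const[OF g] note g2 = rhom_const[OF g1]
  have G: "hform (\<lambda>I. [:g (Poly_Mapping.lookup (lin_prod X) (exponent I)):]) (\<lambda>i. [:y i, x i:]) =
      (\<Prod>k\<in>UNIV. [:l k y, l k x:])"
    unfolding hform_lin_prod[OF g1] l_def
    by (intro prod.cong refl poly_eqI) (auto simp: coeff_sum coeff_pCons mult_ac split: nat.splits)
  have E: "hform (\<lambda>I. [:[:g (Poly_Mapping.lookup (lin_prod X) (exponent I)):]:]) (\<lambda>i. [:[:z i:], [:y i, x i:]:]) =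
      (\<Prod>k\<in>UNIV. [:[:l k z:], [:l k y, l k x:]:])"
    unfolding hform_lin_prod[OF g2] l_def
    by (intro prod.cong refl poly_eqI) (auto simp: coeff_sum coeff_pCons mult_ac split: nat.splits)
  have cp: "(\<Prod>i\<in>A. [:f i:]) = [:\<Prod>i\<in>A. f i:]" for A :: "'d option set" and f :: "_ \<Rightarrow> 'x::comm_ring_1"
    by (simp add: rhom_prod[OF rhom_pCons])
  have "newton_pow (\<lambda>i. coeff (\<Prod>k\<in>UNIV. [:[:l k z:], [:l k y, l k x:]:]) i) ?n =
    (\<Sum>j\<in>UNIV. ([:l j y, l j x:] * (\<Prod>i\<in>UNIV - {j}. [:l i z:])) ^ ?n)"
    by (rule newton_pow_prod_linear) auto
  also have "\<dots> = (\<Sum>j\<in>UNIV. [:(\<Prod>i\<in>UNIV - {j}. l i z) ^ ?n:] * [:l j y, l j x:] ^ ?n)"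
    by (simp only: cp power_mult_distrib rhom_power[OF rhom_pCons] mult_ac)
  finally have P: "newton_pow (\<lambda>i. coeff (\<Prod>k\<in>UNIV. [:[:l k z:], [:l k y, l k x:]:]) i) ?n = \<dots>" .
  have "hp2 ?n (\<Prod>k\<in>UNIV. [:l k y, l k x:]) (l j y) (- l j x) = 0" for j
  proof -
    have "hp2 ?n (\<Prod>k\<in>UNIV. [:l k y, l k x:]) (l j y) (- l j x) =
      (\<Prod>k\<in>UNIV. l k y * - l j x + l k x * l j y)"
      using hp2_prod_linear[of "UNIV :: 'd option set" "\<lambda>k. l k y" "\<lambda>k. l k x"] by simp
    also have "\<dots> = 0" by (rule prod_zero) (auto intro!: exI[of _ j] simp: algebra_simps)
    finally show ?thesis .
  qed
  then show ?thesis
    by (simp only: brill_form_def Let_def G E P vertical_product_sum vertical_product_smult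
      vertical_product_power mult_zero_right sum.neutral_const)
qed

section \<open>The hypersurfaces that satisfy Brill's equations\<close>

text \<open>As a polynomial in a, the sum has its lowest order at a = - \<open>b j0\<close> in the
  summands whose root equals that of j0. Since D is constant on this block, the leading terms add up
  to a positive multiple of \<open>D j0\<close> instead of cancelling.\<close>

lemma isolate_repeated_factor:
  fixes b D :: "'i \<Rightarrow> complex"
  assumes A: "finite A" and j0: "j0 \<in> A" and n: "n > 0"
    and D: "\<And>j. j \<in> A \<Longrightarrow> b j = b j0 \<Longrightarrow> D j = D j0"
    and zero: "\<And>a. (\<Sum>j\<in>A. (\<Prod>i\<in>A - {j}. a + b i) ^ n * D j) = 0"
  shows "D j0 = 0"
proof -
  define J where "J = {j\<in>A. b j = b j0}"
  define L where "L = [:b j0, 1:]"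
  define R where "R = (\<Prod>i\<in>A - J. [:b i, 1:])"
  define R' where "R' j = (\<Prod>i\<in>A - J - {j}. [:b i, 1:])" for j
  have J: "finite J" "J \<subseteq> A" "j0 \<in> J" using A j0 by (auto simp: J_def)
  \<comment> \<open>A product over \<open>A - {j}\<close> contains L exactly k times for j in the
    block J and at least k + 1 times otherwise, so \<open>(L ^ k) ^ n\<close> can be cancelled and
    the terms outside J still vanish at - \<open>b j0\<close>.\<close>
  define k where "k = card J - 1"
  have k: "card J = Suc k" using J by (cases "card J") (auto simp: k_def)
  have PJ: "(\<Prod>i\<in>A - {j}. [:b i, 1:]) = L ^ k * R" if "j \<in> J" for j
  proof -
    have "A - {j} = (J - {j}) \<union> (A - J)" using J that by auto
    then have "(\<Prod>i\<in>A - {j}. [:b i, 1:]) = (\<Prod>i\<in>J - {j}. [:b i, 1:]) * R"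
      unfolding R_def using A J by (subst prod.union_disjoint[symmetric]) auto
    also have "(\<Prod>i\<in>J - {j}. [:b i, 1:]) = (\<Prod>i\<in>J - {j}. L)"
      by (intro prod.cong) (auto simp: J_def L_def)
    also have "\<dots> = L ^ k" using that k J by (simp add: card_Diff_singleton)
    finally show ?thesis .
  qed
  have PN: "(\<Prod>i\<in>A - {j}. [:b i, 1:]) = L ^ k * L * R' j" if "j \<in> A - J" for j
  proof -
    have "A - {j} = J \<union> (A - J - {j})" using J that by auto
    then have "(\<Prod>i\<in>A - {j}. [:b i, 1:]) = (\<Prod>i\<in>J. [:b i, 1:]) * R' j"
      unfolding R'_def using A J by (subst prod.union_disjoint[symmetric]) auto
    also have "(\<Prod>i\<in>J. [:b i, 1:]) = (\<Prod>i\<in>J. L)"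
      by (intro prod.cong) (auto simp: J_def L_def)
    also have "\<dots> = L ^ k * L" using k by simp
    finally show ?thesis .
  qed
  define Q where "Q = (\<Sum>j\<in>A. (\<Prod>i\<in>A - {j}. [:b i, 1:]) ^ n * [:D j:])"
  have "poly Q a = 0" for a
    using zero[of a] by (simp add: Q_def poly_sum poly_prod add.commute mult.commute)
  then have "Q = 0" using poly_all_0_iff_0 by blast
  have "A = J \<union> (A - J)" "J \<inter> (A - J) = {}" using J by auto
  then have "Q = (\<Sum>j\<in>J. (\<Prod>i\<in>A - {j}. [:b i, 1:]) ^ n * [:D j:]) +
      (\<Sum>j\<in>A - J. (\<Prod>i\<in>A - {j}. [:b i, 1:]) ^ n * [:D j:])"
    unfolding Q_def using A J by (metis (no_types, lifting) finite_Diff sum.union_disjoint)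
  also have "(\<Sum>j\<in>J. (\<Prod>i\<in>A - {j}. [:b i, 1:]) ^ n * [:D j:]) = (\<Sum>j\<in>J. (L ^ k) ^ n * (R ^ n * [:D j0:]))"
  proof (intro sum.cong refl)
    fix j assume "j \<in> J"
    then have "D j = D j0" using D by (simp add: J_def)
    with \<open>j \<in> J\<close> show "(\<Prod>i\<in>A - {j}. [:b i, 1:]) ^ n * [:D j:] = (L ^ k) ^ n * (R ^ n * [:D j0:])"
      by (simp add: PJ power_mult_distrib)
  qed
  also have "\<dots> = (L ^ k) ^ n * (of_nat (card J) * R ^ n * [:D j0:])"
    by (simp add: mult_ac)
  also have "(\<Sum>j\<in>A - J. (\<Prod>i\<in>A - {j}. [:b i, 1:]) ^ n * [:D j:]) =
     (L ^ k) ^ n * (L ^ n * (\<Sum>j\<in>A - J. R' j ^ n * [:D j:]))"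
    unfolding sum_distrib_left by (intro sum.cong refl) (simp add: PN power_mult_distrib mult_ac)
  finally have "(L ^ k) ^ n * (of_nat (card J) * R ^ n * [:D j0:] + L ^ n * (\<Sum>j\<in>A - J. R' j ^ n * [:D j:])) = 0"
    using \<open>Q = 0\<close> by (simp add: distrib_left)
  moreover have "L \<noteq> 0" by (simp add: L_def)
  ultimately have "of_nat (card J) * R ^ n * [:D j0:] + L ^ n * (\<Sum>j\<in>A - J. R' j ^ n * [:D j:]) = 0"
    by simp
  then have "poly (of_nat (card J) * R ^ n * [:D j0:] + L ^ n * (\<Sum>j\<in>A - J. R' j ^ n * [:D j:])) (- b j0) = 0"
    by simp
  then have "of_nat (card J) * poly R (- b j0) ^ n * D j0 = 0"
    using n by (auto simp add: L_def zero_power)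
  moreover have "poly R (- b j0) \<noteq> 0"
    using A by (auto simp: R_def poly_prod J_def)
  ultimately show ?thesis using k by (simp del: of_nat_Suc)
qed

text \<open>Brill's form is evaluated with z approaching p along a curve in the direction \<open>a q + v\<close>. To leading order,
  the form P in the definition of Brill's form becomes the one of the tangent cone at p, which is a
  product of linear forms because it depends only on the two directions q and v. As a function of a,
  the contributions of the different lines of the cone have different poles, so that Brill's form
  shows that each line of the cone lies on the hypersurface.\<close>

lemma tangent_line:
  fixes c :: "'d::finite exps \<Rightarrow> complex" and p u v :: "'d option \<Rightarrow> complex"
  assumes brill: "\<And>x y z. brill_form (\<lambda>I. [:c I:]) x y z = 0"
    and zero: "hform c p = 0"
    and nz: "hform c (\<lambda>i. \<alpha> * p i + \<beta> * u i + \<gamma> * v i) \<noteq> 0"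
  shows "\<exists>\<kappa> b. \<forall>\<tau>. hform c (\<lambda>i. p i + \<tau> * (v i - b * (u i + \<kappa> * v i))) = 0"
proof -
  let ?n = "CARD('d) + 1"
  \<comment> \<open>The restriction of the form to the span of p, u and v, as a form in three
    unknowns: \<open>None\<close> stands for p, \<open>Some True\<close> for u and
    \<open>Some False\<close> for v.\<close>
  define \<Phi> :: "(bool option, complex) mpol" where
    "\<Phi> = hform (\<lambda>I. mconst (c I)) (\<lambda>i. mconst (p i) * mvar None + mconst (u i) * mvar (Some True)
       + mconst (v i) * mvar (Some False))"
  have eval: "msubst g w \<Phi> = hform (\<lambda>I. g (c I)) (\<lambda>i. g (p i) * w None + g (u i) * w (Some True)
       + g (v i) * w (Some False))" if g: "rhom g" for g :: "complex \<Rightarrow> 's::comm_ring_1" and w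
    unfolding \<Phi>_def
    by (simp add: rhom_hform[OF rhom_msubst[OF g]] rhom_simps[OF rhom_msubst[OF g]] msubst_mconst[OF g]
      msubst_mvar[OF g])
  have hdeg: "hdeg ?n \<Phi>"
    unfolding \<Phi>_def hform_def
  proof (intro hdeg_sum)
    fix I :: "'d exps"
    let ?v = "\<lambda>i. mconst (p i) * mvar None + mconst (u i) * mvar (Some True)
       + mconst (v i) * mvar (Some False) :: (bool option, complex) mpol"
    have 1: "hdeg 1 (?v i)" for i
      using hdeg_mult[OF hdeg_mconst hdeg_mvar] by (intro hdeg_add) auto
    let ?k = "CARD('d) + 1 - mdeg (exponent I)"
    have "hdeg (0 + ?k * 1 + (\<Sum>l\<in>UNIV. Poly_Mapping.lookup (exponent I) l * 1))
       (mconst (c I) * ?v None ^ ?k * (\<Prod>l\<in>UNIV. ?v (Some l) ^ Poly_Mapping.lookup (exponent I) l))"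
      by (intro hdeg_mult hdeg_prod hdeg_power 1 hdeg_mconst)
    moreover have "0 + ?k * 1 + (\<Sum>l\<in>UNIV. Poly_Mapping.lookup (exponent I) l * 1) = ?n"
      using mdeg_exponent[of I] by (simp add: mdeg_UNIV[symmetric])
    ultimately show "hdeg ?n (mconst (c I) * ?v None ^ ?k * (\<Prod>l\<in>UNIV. ?v (Some l) ^ Poly_Mapping.lookup (exponent I) l))"
      by simp
  qed
  define k0 where "k0 k = Poly_Mapping.lookup k None" for k :: "bool option \<Rightarrow>\<^sub>0 nat"
  define kT where "kT k = Poly_Mapping.lookup k (Some True)" for k :: "bool option \<Rightarrow>\<^sub>0 nat"
  define kF where "kF k = Poly_Mapping.lookup k (Some False)" for k :: "bool option \<Rightarrow>\<^sub>0 nat"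
  define wt where "wt k = kT k + kF k" for k
  have UN: "(UNIV :: bool option set) = {None, Some True, Some False}"
    by (auto simp: UNIV_option_conv UNIV_bool)
  have mmon3: "mmon a k = a None ^ k0 k * a (Some True) ^ kT k * a (Some False) ^ kF k" for k and a :: "_ \<Rightarrow> 's::comm_ring_1"
    by (simp add: mmon_UNIV UN k0_def kT_def kF_def mult_ac)
  define K where "K = Poly_Mapping.keys \<Phi>"
  have finK: "finite K" by (simp add: K_def)
  have k0w: "k0 k = ?n - wt k" "wt k \<le> ?n" if "k \<in> K" for k
  proof -
    have "mdeg k = k0 k + wt k" by (simp add: mdeg_UNIV UN k0_def kT_def kF_def wt_def)
    with hdeg that show "k0 k = ?n - wt k" "wt k \<le> ?n" by (auto simp: hdeg_def K_def)
  qed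
  have keq: "k = k'" if "k \<in> K" "k' \<in> K" "wt k = wt k'" "kF k = kF k'" for k k'
  proof (rule poly_mapping_eqI)
    fix x
    have "k0 k = k0 k'" "kT k = kT k'" "kF k = kF k'"
      using that k0w[of k] k0w[of k'] by (simp_all add: wt_def)
    moreover have "x \<in> {None, Some True, Some False}" using UN by blast
    ultimately show "Poly_Mapping.lookup k x = Poly_Mapping.lookup k' x"
      by (auto simp: k0_def kT_def kF_def)
  qed
  have "meval (\<lambda>i. case i of None \<Rightarrow> \<alpha> | Some True \<Rightarrow> \<beta> | Some False \<Rightarrow> \<gamma>) \<Phi> \<noteq> 0"
    using nz by (simp add: eval[OF rhom_id] mult_ac)
  then have "K \<noteq> {}" by (auto simp: K_def msubst_def)
  \<comment> \<open>m is the multiplicity of \<Phi> at the point corresponding to p, and T indexes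
    the terms of its tangent cone.\<close>
  define m where "m = Min (wt ` K)"
  define T where "T = {k\<in>K. wt k = m}"
  have m: "m \<le> wt k" if "k \<in> K" for k unfolding m_def using that finK by auto
  have "m \<in> wt ` K" unfolding m_def using finK \<open>K \<noteq> {}\<close> by (intro Min_in) auto
  then obtain k1 where k1: "k1 \<in> T" by (auto simp: T_def)
  have finT: "finite T" using finK by (simp add: T_def)
  define \<phi> where "\<phi> k = Poly_Mapping.lookup \<Phi> k" for k
  have "m > 0"
  proof (rule ccontr)
    assume "\<not> m > 0"
    then have "wt k1 = 0" "k1 \<in> K" using k1 by (auto simp: T_def)
    have "meval (\<lambda>i. case i of None \<Rightarrow> 1 | _ \<Rightarrow> 0) \<Phi> = (\<Sum>k\<in>K. \<phi> k * 0 ^ wt k)"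
      unfolding msubst_mmon K_def \<phi>_def by (intro sum.cong refl) (simp add: mmon3 wt_def power_add)
    also have "\<dots> = (\<Sum>k\<in>K. if k = k1 then \<phi> k1 else 0)"
    proof (intro sum.cong refl)
      fix k assume "k \<in> K"
      show "\<phi> k * 0 ^ wt k = (if k = k1 then \<phi> k1 else 0)"
      proof (cases "wt k = 0")
        case True
        then have "wt k = wt k1" "kF k = kF k1" using \<open>wt k1 = 0\<close> by (simp_all add: wt_def)
        then have "k = k1" by (rule keq[OF \<open>k \<in> K\<close> \<open>k1 \<in> K\<close>])
        with True show ?thesis by simp
      next
        case False
        then have "k \<noteq> k1" using \<open>wt k1 = 0\<close> by auto
        with False show ?thesis by (simp add: zero_power)
      qed
    qed
    also have "\<dots> = \<phi> k1" using finK \<open>k1 \<in> K\<close> by simp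
    also have "\<dots> \<noteq> 0" using \<open>k1 \<in> K\<close> by (auto simp: K_def \<phi>_def in_keys_iff)
    finally show False using zero by (simp add: eval[OF rhom_id])
  qed
  \<comment> \<open>R(\<kappa>) is the tangent cone at the direction u + \<kappa> v. Choosing it
    nonzero keeps q = u + \<kappa> v off the cone, so that the dehomogenized cone \<open>gp\<close>
    has degree exactly m and its m roots describe all the lines of the cone.\<close>
  define R where "R = (\<Sum>k\<in>T. monom (\<phi> k) (kF k))"
  have "coeff R (kF k1) = (\<Sum>k\<in>T. if k = k1 then \<phi> k1 else 0)"
    unfolding R_def coeff_sum
  proof (intro sum.cong refl)
    fix k assume "k \<in> T"
    then show "coeff (monom (\<phi> k) (kF k)) (kF k1) = (if k = k1 then \<phi> k1 else 0)"
      using keq[of k k1] k1 by (auto simp: T_def)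
  qed
  also have "\<dots> = \<phi> k1" using finT k1 by simp
  also have "\<dots> \<noteq> 0" using k1 by (auto simp: K_def \<phi>_def T_def in_keys_iff)
  finally have "R \<noteq> 0" by auto
  then obtain \<kappa> where \<kappa>: "poly R \<kappa> \<noteq> 0" using poly_all_0_iff_0 by blast
  define gp where "gp = (\<Sum>k\<in>T. [:\<phi> k:] * [:0, 1:] ^ kT k * [:1, \<kappa>:] ^ kF k)"
  have hp2_gp: "hp2 m (map_poly g gp) s t = (\<Sum>k\<in>T. g (\<phi> k) * s ^ kT k * (t + g \<kappa> * s) ^ kF k)"
    if g: "rhom g" for g :: "complex \<Rightarrow> 's::comm_ring_1" and s t
    unfolding gp_def rhom_sum[OF rhom_map_poly[OF g]] hp2_sum
  proof (intro sum.cong refl)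
    fix k assume "k \<in> T"
    then have mk: "m = 0 + kT k + kF k" by (simp add: T_def wt_def)
    have d: "degree ([:g (\<phi> k):] * [:0, 1:] ^ kT k) \<le> 0 + kT k"
      by (rule degree_mult_linear_power) simp
    have e: "map_poly g ([:\<phi> k:] * [:0, 1:] ^ kT k * [:1, \<kappa>:] ^ kF k) =
        [:g (\<phi> k):] * [:0, 1:] ^ kT k * [:1, g \<kappa>:] ^ kF k"
      by (simp only: rhom_simps[OF rhom_map_poly[OF g]] map_poly_pCons_rhom[OF g] rhom_zero[OF g] rhom_one[OF g])
    show "hp2 m (map_poly g ([:\<phi> k:] * [:0, 1:] ^ kT k * [:1, \<kappa>:] ^ kF k)) s t =
       g (\<phi> k) * s ^ kT k * (t + g \<kappa> * s) ^ kF k"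
      unfolding e mk
      by (subst hp2_mult_linear_power[OF d], subst hp2_mult_linear_power) (auto simp: hp2_def)
  qed
  have "degree ([:\<phi> k:] * [:0, 1:] ^ kT k * [:1, \<kappa>:] ^ kF k) \<le> m" if "k \<in> T" for k
    using degree_mult_linear_power[OF degree_mult_linear_power[of "[:\<phi> k:]" 0], of 0 1 "kT k" 1 \<kappa> "kF k"] that
    by (simp add: T_def wt_def)
  then have "degree gp \<le> m" unfolding gp_def by (intro degree_sum_le finT)
  have "coeff gp m = hp2 m (map_poly (\<lambda>x. x) gp) 1 0"
    by (simp add: hp2_def map_poly_id' sum.delta zero_power power_0_left if_distrib cong: if_cong)
  also have "\<dots> = poly R \<kappa>"
    unfolding hp2_gp[OF rhom_id] R_def by (simp add: poly_sum poly_monom)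
  finally have gm: "coeff gp m \<noteq> 0" using \<kappa> by simp
  with \<open>degree gp \<le> m\<close> have deg_gp: "degree gp = m" using le_degree by force
  obtain b' where "smult (lead_coeff gp) (\<Prod>j<degree gp. [:- b' j, 1:]) = gp"
    using complex_poly_decompose' .
  then obtain b where b: "gp = [:lead_coeff gp:] * (\<Prod>j<m. [:b j, 1:])"
    using deg_gp that[of "\<lambda>j. - b' j"] by simp
  define C where "C = lead_coeff gp"
  have "C \<noteq> 0" using gm deg_gp by (simp add: C_def)
  have hp2_gp': "hp2 m (map_poly g gp) s t = g C * (\<Prod>j<m. s + g (b j) * t)"
    if g: "rhom g" for g :: "complex \<Rightarrow> 's::comm_ring_1" and s t
  proof -
    have e: "map_poly g gp = [:g C:] * (\<Prod>j<m. [:g (b j), 1:] ^ 1)"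
      unfolding C_def
      by (subst b) (simp only: rhom_simps[OF rhom_map_poly[OF g]] map_poly_pCons_rhom[OF g] rhom_zero[OF g]
        rhom_one[OF g] power_one_right map_poly_0)
    have "hp2 (0 + (\<Sum>j<m. 1)) ([:g C:] * (\<Prod>j<m. [:g (b j), 1:] ^ 1)) s t =
      hp2 0 [:g C:] s t * (\<Prod>j<m. (g (b j) * t + 1 * s) ^ 1)"
      by (rule hp2_mult_prod_linear_power[THEN conjunct2]) auto
    then show ?thesis unfolding e by (simp add: hp2_def add.commute)
  qed
  define q where "q i = u i + \<kappa> * v i" for i
  define D where "D \<tau> j = hform c (\<lambda>i. p i + \<tau> * (v i - b j * q i))" for \<tau> j
  have key: "(\<Sum>j<m. (\<Prod>i\<in>{..<m} - {j}. a + b i) ^ ?n * D \<tau> j) = 0" for a \<tau>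
  proof -
    \<comment> \<open>The arc z = p + \<epsilon>(a q + v), with x = p + \<tau> v and y = q. From
      here on the nested polynomial variables are, from the outside in, \<lambda>, \<alpha> and
      \<epsilon>.\<close>
    define z where "z i = [:p i, a * q i + v i:]" for i
    define y where "y i = [:q i:]" for i
    define x where "x i = [:p i + \<tau> * v i:]" for i
    define G where "G = hform (\<lambda>I. [:[:c I:]:]) (\<lambda>i. [:y i, x i:])"
    define E where "E = hform (\<lambda>I. [:[:[:c I:]:]:]) (\<lambda>i. [:[:z i:], [:y i, x i:]:])"
    have br: "vertical_product ?n G (newton_pow (\<lambda>i. coeff E i) ?n) = 0"
      using brill[of x y z] by (simp only: brill_form_def Let_def G_def E_def)
    define \<epsilon> :: "complex poly" where "\<epsilon> = [:0, 1:]"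
    define g :: "complex \<Rightarrow> complex poly poly poly" where "g c = [:[:[:c:]:]:]" for c
    have g: "rhom g" unfolding g_def by (intro rhom_const rhom_pCons)
    \<comment> \<open>After \<lambda> is replaced by \<epsilon>\<lambda>, the point z +
      \<lambda>(\<alpha>x + y) becomes U p + \<epsilon>(A q + B v). Every term of \<Phi> has weight
      at least m in the last two directions, so \<epsilon>^m can be taken out, leaving
      \<open>Kp\<close>.\<close>
    define U :: "complex poly poly poly" where "U = [:1, [:0, \<epsilon>:]:]"
    define A :: "complex poly poly poly" where "A = [:[:[:a:]:], 1:]"
    define B :: "complex poly poly poly" where "B = [:1, [:0, [:\<tau>:]:]:]"
    define Kp where "Kp = (\<Sum>k\<in>K. g (\<phi> k) * U ^ k0 k * [:[:\<epsilon>:]:] ^ (wt k - m) * A ^ kT k * (B + g \<kappa> * A) ^ kF k)"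
    have "pcompose E [:0, [:\<epsilon>:]:] = hform (\<lambda>I. g (c I)) (\<lambda>i. pcompose [:[:z i:], [:y i, x i:]:] [:0, [:\<epsilon>:]:])"
      unfolding E_def rhom_hform[OF rhom_pcompose] g_def by (simp add: pcompose_pCons)
    also have "\<dots> = hform (\<lambda>I. g (c I)) (\<lambda>i. g (p i) * U + g (u i) * ([:[:\<epsilon>:]:] * A) +
        g (v i) * ([:[:\<epsilon>:]:] * (B + g \<kappa> * A)))"
      by (rule arg_cong[where f = "hform _"], rule ext)
         (simp add: pcompose_pCons z_def y_def x_def g_def U_def A_def B_def \<epsilon>_def q_def algebra_simps one_pCons)
    also have "\<dots> = msubst g (\<lambda>i. case i of None \<Rightarrow> U | Some True \<Rightarrow> [:[:\<epsilon>:]:] * A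
        | Some False \<Rightarrow> [:[:\<epsilon>:]:] * (B + g \<kappa> * A)) \<Phi>"
      by (simp add: eval[OF g])
    also have "\<dots> = (\<Sum>k\<in>K. g (\<phi> k) * (U ^ k0 k * ([:[:\<epsilon>:]:] * A) ^ kT k * ([:[:\<epsilon>:]:] * (B + g \<kappa> * A)) ^ kF k))"
      by (simp add: msubst_mmon K_def \<phi>_def mmon3)
    also have "\<dots> = [:[:\<epsilon>:]:] ^ m * Kp"
      unfolding Kp_def sum_distrib_left
    proof (intro sum.cong refl)
      fix k assume "k \<in> K"
      then have "m + (wt k - m) = kT k + kF k" using m[of k] by (simp add: wt_def)
      then have e: "([:[:\<epsilon>:]:] :: complex poly poly poly) ^ m * [:[:\<epsilon>:]:] ^ (wt k - m) = [:[:\<epsilon>:]:] ^ kT k * [:[:\<epsilon>:]:] ^ kF k"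
        by (metis power_add)
      show "g (\<phi> k) * (U ^ k0 k * ([:[:\<epsilon>:]:] * A) ^ kT k * ([:[:\<epsilon>:]:] * (B + g \<kappa> * A)) ^ kF k) =
        [:[:\<epsilon>:]:] ^ m * (g (\<phi> k) * U ^ k0 k * [:[:\<epsilon>:]:] ^ (wt k - m) * A ^ kT k * (B + g \<kappa> * A) ^ kF k)"
        using arg_cong[OF e, of "\<lambda>e. e * (g (\<phi> k) * U ^ k0 k * A ^ kT k * (B + g \<kappa> * A) ^ kF k)"]
        by (simp only: power_mult_distrib mult_ac)
    qed
    finally have EK: "pcompose E [:0, [:\<epsilon>:]:] = [:[:\<epsilon>:] ^ m:] * Kp"
      by (simp only: rhom_power[OF rhom_pCons])
    have cEK: "[:\<epsilon>:] ^ i * coeff E i = [:\<epsilon>:] ^ m * coeff Kp i" for i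
      using arg_cong[OF EK, of "\<lambda>P. coeff P i"] by (simp add: coeff_pcompose_linear)
    \<comment> \<open>The substitution contributes \<epsilon>^i to the i-th coefficient and the
      multiplicity a common \<epsilon>^m. As the Newton sum is isobaric and homogeneous, both come
      out as plain powers, which are nonzero and cancel before \<epsilon> is set to 0.\<close>
    have "[:\<epsilon>:] ^ ?n * newton_pow (\<lambda>i. coeff E i) ?n = ([:\<epsilon>:] ^ m) ^ ?n * newton_pow (\<lambda>i. coeff Kp i) ?n"
      unfolding newton_pow_weight[symmetric] cEK newton_pow_scale ..
    then have "[:\<epsilon> ^ ?n:] * newton_pow (\<lambda>i. coeff E i) ?n = [:(\<epsilon> ^ m) ^ ?n:] * newton_pow (\<lambda>i. coeff Kp i) ?n"
      by (simp only: rhom_power[OF rhom_pCons])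
    then have "\<epsilon> ^ ?n * vertical_product ?n G (newton_pow (\<lambda>i. coeff E i) ?n) =
        (\<epsilon> ^ m) ^ ?n * vertical_product ?n G (newton_pow (\<lambda>i. coeff Kp i) ?n)"
      by (simp only: vertical_product_smult[symmetric])
    moreover have "\<epsilon> \<noteq> 0" by (simp add: \<epsilon>_def)
    ultimately have vK: "vertical_product ?n G (newton_pow (\<lambda>i. coeff Kp i) ?n) = 0"
      using br by simp
    define h :: "complex poly \<Rightarrow> complex" where "h P = poly P 0" for P
    have h: "rhom h" unfolding h_def by (rule rhom_poly)
    note h1 = rhom_map_poly[OF h] note h2 = rhom_map_poly[OF h1]
    define G0 where "G0 = hform (\<lambda>I. [:c I:]) (\<lambda>i. [:q i, p i + \<tau> * v i:])"
    have hG: "map_poly h G = G0"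
      unfolding G_def G0_def rhom_hform[OF h1] x_def y_def
      by (simp only: map_poly_pCons_rhom[OF h] map_poly_0) (simp add: h_def)
    define g0 :: "complex \<Rightarrow> complex poly poly" where "g0 c = [:[:c:]:]" for c
    have g0: "rhom g0" unfolding g0_def by (intro rhom_const rhom_pCons)
    define A0 :: "complex poly poly" where "A0 = [:[:a:], 1:]"
    define B0 :: "complex poly poly" where "B0 = [:1, [:0, \<tau>:]:]"
    note hs = map_poly_pCons_rhom[OF h] map_poly_pCons_rhom[OF h1] map_poly_0
    have hg: "map_poly (map_poly h) (g e) = g0 e" for e
      unfolding g_def g0_def hs by (simp add: h_def)
    have hU: "map_poly (map_poly h) U = 1"
      unfolding U_def hs one_pCons rhom_one[OF h1] \<epsilon>_def by (simp add: h_def)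
    have hA: "map_poly (map_poly h) A = A0"
      unfolding A_def A0_def hs one_pCons by (simp add: h_def)
    have hB: "map_poly (map_poly h) B = B0"
      unfolding B_def B0_def hs one_pCons by (simp add: h_def)
    have he: "map_poly (map_poly h) [:[:\<epsilon>:]:] = 0"
      unfolding \<epsilon>_def hs by (simp add: h_def)
    have "map_poly (map_poly h) Kp = (\<Sum>k\<in>K. g0 (\<phi> k) * 0 ^ (wt k - m) * A0 ^ kT k * (B0 + g0 \<kappa> * A0) ^ kF k)"
      unfolding Kp_def by (simp only: rhom_simps[OF h2] hg hU hA hB he power_one mult_1_right)
    \<comment> \<open>At \<epsilon> = 0 only the terms of weight m survive, that is the tangent
      cone, which is then split into its m linear factors.\<close>
    also have "\<dots> = (\<Sum>k\<in>T. g0 (\<phi> k) * A0 ^ kT k * (B0 + g0 \<kappa> * A0) ^ kF k)"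
      using finK m by (intro sum.mono_neutral_cong_right) (auto simp: T_def zero_power le_less)
    also have "\<dots> = g0 C * (\<Prod>j<m. A0 + g0 (b j) * B0)"
      unfolding hp2_gp[OF g0, symmetric] hp2_gp'[OF g0] ..
    also have "\<dots> = [:[:C:]:] * (\<Prod>j<m. [:[:a + b j:], [:1, b j * \<tau>:]:])"
      by (simp add: g0_def A0_def B0_def one_pCons)
    finally have hK: "coeff (map_poly (map_poly h) Kp) i = [:C:] * coeff (\<Prod>j<m. [:[:a + b j:], [:1, b j * \<tau>:]:]) i" for i
      by simp
    have "map_poly h (newton_pow (\<lambda>i. coeff Kp i) ?n) = newton_pow (\<lambda>i. coeff (map_poly (map_poly h) Kp) i) ?n"
      by (simp only: rhom_newton_pow[OF h1] coeff_map_poly_rhom[OF h1])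
    also have "\<dots> = [:C:] ^ ?n * (\<Sum>j<m. ([:1, b j * \<tau>:] * (\<Prod>i\<in>{..<m} - {j}. [:a + b i:])) ^ ?n)"
      unfolding hK newton_pow_scale by (subst newton_pow_prod_linear) simp_all
    also have "\<dots> = [:C ^ ?n:] * (\<Sum>j<m. [:(\<Prod>i\<in>{..<m} - {j}. a + b i) ^ ?n:] * [:1, b j * \<tau>:] ^ ?n)"
      by (simp only: rhom_power[OF rhom_pCons] rhom_prod[OF rhom_pCons] power_mult_distrib mult_ac)
    finally have N: "map_poly h (newton_pow (\<lambda>i. coeff Kp i) ?n) = \<dots>" .
    \<comment> \<open>The zero of the linear form 1 + b\<tau>\<alpha> selects the point p + \<tau>(v
      - b q), which runs through the j-th line of the cone.\<close>
    have hD: "hp2 ?n G0 1 (- (b j * \<tau>)) = D \<tau> j" for j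
      unfolding G0_def hform_line[symmetric] D_def
      by (rule arg_cong[where f = "hform c"]) (auto simp: algebra_simps)
    have "0 = h (vertical_product ?n G (newton_pow (\<lambda>i. coeff Kp i) ?n))"
      unfolding vK by (simp add: h_def)
    also have "\<dots> = C ^ ?n * (\<Sum>j<m. (\<Prod>i\<in>{..<m} - {j}. a + b i) ^ ?n * (of_nat (fact ?n) * hp2 ?n G0 1 (- (b j * \<tau>))))"
      by (simp only: rhom_vertical_product[OF h] hG N vertical_product_smult vertical_product_sum vertical_product_power)
    also have "(\<Sum>j<m. (\<Prod>i\<in>{..<m} - {j}. a + b i) ^ ?n * (of_nat (fact ?n) * hp2 ?n G0 1 (- (b j * \<tau>)))) =
       of_nat (fact ?n) * (\<Sum>j<m. (\<Prod>i\<in>{..<m} - {j}. a + b i) ^ ?n * D \<tau> j)"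
      unfolding hD sum_distrib_left by (simp only: mult_ac)
    finally have "C ^ ?n * (of_nat (fact ?n) * (\<Sum>j<m. (\<Prod>i\<in>{..<m} - {j}. a + b i) ^ ?n * D \<tau> j)) = 0"
      by (rule sym)
    moreover have "C ^ ?n \<noteq> 0" using \<open>C \<noteq> 0\<close> by (rule power_not_zero)
    moreover have "of_nat (fact ?n) \<noteq> (0 :: complex)"
      by (simp only: of_nat_eq_0_iff fact_nonzero not_False_eq_True)
    ultimately show ?thesis by (simp only: mult_eq_0_iff simp_thms)
  qed
  \<comment> \<open>\<open>D \<tau> j\<close> depends on j only through \<open>b j\<close>, as the
    isolation of repeated roots requires. Index 0 exists because m > 0.\<close>
  have "D \<tau> 0 = 0" for \<tau>
    by (rule isolate_repeated_factor[of "{..<m}" 0 ?n b "D \<tau>"]) (use \<open>m > 0\<close> key in \<open>auto simp: D_def\<close>)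
  then show ?thesis unfolding D_def q_def by blast
qed

section \<open>Assembling linear factors from lines through the origin\<close>

lemma poly_eq_if_infinite_agree:
  fixes p q :: "'a::idom poly"
  assumes "infinite A" "\<And>x. x \<in> A \<Longrightarrow> poly p x = poly q x"
  shows "p = q"
proof (rule ccontr)
  assume "p \<noteq> q"
  then have "finite {x. poly (p - q) x = 0}" by (intro poly_roots_finite) simp
  moreover have "A \<subseteq> {x. poly (p - q) x = 0}" using assms(2) by auto
  ultimately show False using assms(1) finite_subset by blast
qed

lemma finite_affine_roots:
  fixes \<alpha> \<beta> :: complex
  assumes "\<alpha> \<noteq> 0" shows "finite {\<epsilon>. \<alpha> + \<epsilon> * \<beta> = 0}"
  using poly_roots_finite[of "[:\<alpha>, \<beta>:]"] assms by simp

lemma poly_lin_prod_normalized: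
  fixes p :: "complex poly"
  assumes "poly p 0 = 1"
  shows "poly p x = (\<Prod>z | poly p z = 0. (1 - x / z) ^ order z p)"
proof -
  have "p \<noteq> 0" using assms by auto
  have z: "z \<noteq> 0" if "poly p z = 0" for z using that assms by auto
  have v: "poly p x = lead_coeff p * (\<Prod>z | poly p z = 0. (x - z) ^ order z p)" for x
    by (subst complex_poly_decompose[of p, symmetric]) (simp add: poly_prod)
  have "poly p x = lead_coeff p * (\<Prod>z | poly p z = 0. (0 - z) ^ order z p * (1 - x / z) ^ order z p)"
    unfolding v[of x] power_mult_distrib[symmetric]
    by (intro arg_cong2[where f="(*)"] prod.cong refl arg_cong2[where f="(^)"]) (use z in \<open>auto simp: field_simps\<close>)
  also have "\<dots> = poly p 0 * (\<Prod>z | poly p z = 0. (1 - x / z) ^ order z p)"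
    unfolding v[of 0] prod.distrib by (simp only: mult.assoc)
  finally show ?thesis using assms by simp
qed

text \<open>The coefficient of degree 1 is the derivative of a monomial at y in direction v. What
  matters is that it is linear in v.\<close>

lemma coeff_1_prod_linear_power:
  fixes y v :: "'l::finite \<Rightarrow> complex"
  shows "coeff (\<Prod>l\<in>UNIV. [:y l, v l:] ^ k l) 1 =
    (\<Sum>l\<in>UNIV. v l * (of_nat (k l) * y l ^ (k l - 1) * (\<Prod>i\<in>UNIV - {l}. y i ^ k i)))"
proof -
  have c: "coeff p 1 = poly (pderiv p) 0" for p :: "complex poly"
    by (simp add: poly_0_coeff_0 coeff_pderiv)
  show ?thesis
    unfolding c pderiv_prod poly_sum
    by (intro sum.cong refl) (simp add: pderiv_power pderiv_pCons poly_prod)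
qed

text \<open>Lines through the origin are compared with a line for which the number of distinct zeros is maximal.
  The line through each of its zeros given by the tangent cone meets the nearby lines
  in a zero, and by maximality these are all the zeros.\<close>

theorem lin_prod_if_brill:
  fixes c :: "'d::finite exps \<Rightarrow> complex"
  assumes brill: "\<And>x y z. brill_form (\<lambda>I. [:c I:]) x y z = 0"
    and c0: "c zero_exps = 1"
  shows "\<exists>X :: 'd option \<Rightarrow> 'd \<Rightarrow> complex. \<forall>I. c I = Poly_Mapping.lookup (lin_prod X) (exponent I)"
proof -
  let ?n = "CARD('d) + 1"
  define F where "F t = hform c (\<lambda>i. case i of None \<Rightarrow> 1 | Some l \<Rightarrow> t l)" for t :: "'d \<Rightarrow> complex"
  define Lp where "Lp y w = hform (\<lambda>I. [:c I:]) (\<lambda>i. case i of None \<Rightarrow> 1 | Some l \<Rightarrow> [:y l, w l:])"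
    for y w :: "'d \<Rightarrow> complex"
  have Lp: "poly (Lp y w) s = F (\<lambda>l. y l + s * w l)" for y w s
    unfolding Lp_def F_def rhom_hform[OF rhom_poly]
    by (rule arg_cong2[where f = hform]) (auto split: option.splits)
  have Lp_sum: "Lp y w = (\<Sum>I\<in>UNIV. [:c I:] * (\<Prod>l\<in>UNIV. [:y l, w l:] ^ Poly_Mapping.lookup (exponent I) l))" for y w
    by (simp add: Lp_def hform_def)
  have degLp: "degree (Lp y w) \<le> ?n" for y w
    unfolding Lp_sum
  proof (intro degree_sum_le)
    fix I :: "'d exps"
    have "degree ([:c I:] * (\<Prod>l\<in>UNIV. [:y l, w l:] ^ Poly_Mapping.lookup (exponent I) l)) \<le> 0 + mdeg (exponent I)"
      unfolding mdeg_UNIV by (rule hp2_mult_prod_linear_power[THEN conjunct1]) auto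
    then show "degree ([:c I:] * (\<Prod>l\<in>UNIV. [:y l, w l:] ^ Poly_Mapping.lookup (exponent I) l)) \<le> ?n"
      using mdeg_exponent[of I] by linarith
  qed simp
  have e0: "exponent zero_exps = (0 :: 'd \<Rightarrow>\<^sub>0 nat)"
    by (simp add: zero_exps_def exps_of_inverse)
  have F0: "F (\<lambda>_. 0) = 1"
  proof -
    have "F (\<lambda>_. 0) = (\<Sum>I\<in>UNIV. if I = zero_exps then c I else 0)"
      unfolding F_def hform_def
    proof (intro sum.cong refl)
      fix I :: "'d exps"
      have "(\<Prod>l\<in>UNIV. (0::complex) ^ Poly_Mapping.lookup (exponent I) l) = 0" if "I \<noteq> zero_exps"
      proof -
        have "exponent I \<noteq> 0" using that e0 by (metis exponent_inject)
        then obtain l where "Poly_Mapping.lookup (exponent I) l \<noteq> 0" by (metis poly_mapping_eqI lookup_zero)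
        then show ?thesis by (intro prod_zero) (auto simp: zero_power)
      qed
      then show "c I * (case None of None \<Rightarrow> 1 | Some l \<Rightarrow> 0) ^ (CARD('d) + 1 - mdeg (exponent I)) *
         (\<Prod>l\<in>UNIV. (case Some l of None \<Rightarrow> 1 | Some l \<Rightarrow> 0) ^ Poly_Mapping.lookup (exponent I) l) =
         (if I = zero_exps then c I else 0)"
        by (auto simp: e0)
    qed
    then show ?thesis using c0 by simp
  qed
  have Lp0: "poly (Lp (\<lambda>_. 0) u) 0 = 1" for u using F0 by (simp add: Lp)
  then have Lpnz: "Lp (\<lambda>_. 0) u \<noteq> 0" for u by (metis poly_0 zero_neq_one)
  define Z where "Z u = {s. poly (Lp (\<lambda>_. 0) u) s = 0}" for u
  have finZ: "finite (Z u)" for u unfolding Z_def by (rule poly_roots_finite[OF Lpnz])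
  have cardZ: "card (Z u) \<le> ?n" for u
    unfolding Z_def using card_poly_roots_bound[OF Lpnz[of u]] degLp[of "\<lambda>_. 0" u] by linarith
  \<comment> \<open>The zeros are counted without multiplicity; their number is bounded by the
    degree.\<close>
  obtain u0 where max: "\<And>u. card (Z u) \<le> card (Z u0)"
    using ex_has_greatest_nat[of "\<lambda>_. True" "undefined" "\<lambda>u. card (Z u)" "Suc ?n"] cardZ
    by (meson le_imp_less_Suc)
  define S where "S = Z u0"
  have finS: "finite S" by (simp add: S_def finZ)
  have S0: "s \<noteq> 0" if "s \<in> S" for s using that Lp0[of u0] by (auto simp: S_def Z_def)
  define M where "M s = order s (Lp (\<lambda>_. 0) u0)" for s
  define A where "A = Sigma S (\<lambda>s. {..<M s})"
  have finA: "finite A" by (simp add: A_def finS)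
  have prodA: "(\<Prod>j\<in>A. g (fst j)) = (\<Prod>s\<in>S. g s ^ M s)" for g :: "complex \<Rightarrow> complex"
  proof -
    have "(\<Prod>j\<in>A. g (fst j)) = (\<Prod>(s, i)\<in>Sigma S (\<lambda>s. {..<M s}). g s)"
      by (simp add: A_def split_beta)
    also have "\<dots> = (\<Prod>s\<in>S. \<Prod>i<M s. g s)"
      by (rule prod.Sigma[symmetric]) (auto simp: finS)
    finally show ?thesis by simp
  qed
  have line: "\<exists>b. \<forall>\<tau>. F (\<lambda>l. s * u0 l + \<tau> * (v l - b * u0 l)) = 0" if s: "s \<in> S" for s v
  proof -
    \<comment> \<open>The zero, the radial direction and v are embedded with homogenizing coordinate
      1, 0 and 0. The origin p - s u, where F is 1, witnesses that the form is not zero on their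
      span.\<close>
    let ?p = "\<lambda>i. case i of None \<Rightarrow> 1 | Some l \<Rightarrow> s * u0 l"
    let ?u = "\<lambda>i. case i of None \<Rightarrow> 0 | Some l \<Rightarrow> u0 l"
    let ?v = "\<lambda>i. case i of None \<Rightarrow> 0 | Some l \<Rightarrow> v l"
    have "hform c ?p = 0" using s Lp[of "\<lambda>_. 0" u0 s] by (simp add: F_def S_def Z_def)
    moreover have "(\<lambda>i. 1 * ?p i + (- s) * ?u i + 0 * ?v i) = (\<lambda>i. case i of None \<Rightarrow> 1 | Some l \<Rightarrow> 0)"
      by (auto split: option.splits)
    then have "hform c (\<lambda>i. 1 * ?p i + (- s) * ?u i + 0 * ?v i) \<noteq> 0" using F0 by (simp add: F_def)
    ultimately obtain \<kappa> b where
      "\<forall>\<tau>. hform c (\<lambda>i. ?p i + \<tau> * (?v i - b * (?u i + \<kappa> * ?v i))) = 0"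
      using tangent_line[OF brill, where p = ?p and u = ?u and v = ?v and \<alpha> = 1 and \<beta> = "- s" and \<gamma> = 0] by blast
    moreover have "(\<lambda>i. ?p i + \<tau> * (?v i - b * (?u i + \<kappa> * ?v i))) =
      (\<lambda>i. case i of None \<Rightarrow> 1 | Some l \<Rightarrow> s * u0 l + \<tau> * ((1 - b * \<kappa>) * v l - b * u0 l))" for \<tau>
      by (auto split: option.splits simp: algebra_simps)
    ultimately have z: "F (\<lambda>l. s * u0 l + \<tau> * ((1 - b * \<kappa>) * v l - b * u0 l)) = 0" for \<tau>
      by (simp add: F_def)
    \<comment> \<open>Otherwise the line would be radial and reach the origin at \<tau> = s / b,
      where F is 1. Dividing by this number normalizes the coefficient of v to 1.\<close>
    have k: "1 - b * \<kappa> \<noteq> 0"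
    proof
      assume k: "1 - b * \<kappa> = 0"
      then have "b \<noteq> 0" by auto
      then have "F (\<lambda>l. 0) = 0" using z[of "s / b"] k by simp
      with F0 show False by simp
    qed
    have "F (\<lambda>l. s * u0 l + \<tau> * (v l - b / (1 - b * \<kappa>) * u0 l)) = 0" for \<tau>
    proof -
      have "\<tau> / (1 - b * \<kappa>) * ((1 - b * \<kappa>) * v l - b * u0 l) = \<tau> * (v l - b / (1 - b * \<kappa>) * u0 l)" for l
        using k by (simp add: right_diff_distrib)
      with z[of "\<tau> / (1 - b * \<kappa>)"] show ?thesis by simp
    qed
    then show ?thesis by blast
  qed
  have split: "\<exists>\<beta>. \<forall>X t. F (\<lambda>l. X * u0 l + t * v l) = (\<Prod>j\<in>A. 1 - X / fst j - t * \<beta> (fst j))" for v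
  proof -
    obtain b where b: "\<And>s \<tau>. s \<in> S \<Longrightarrow> F (\<lambda>l. s * u0 l + \<tau> * (v l - b s * u0 l)) = 0"
      using line[of _ v] by metis
    \<comment> \<open>Excluded are the \<epsilon> for which the direction u0 + \<epsilon>v is
      parallel to one of the lines, or for which two of its intersections with them
      coincide.\<close>
    define bad where "bad = (\<Union>s\<in>S. {\<epsilon>. 1 + \<epsilon> * b s = 0}) \<union>
      (\<Union>s\<in>S. \<Union>s'\<in>S - {s}. {\<epsilon>. (s - s') + \<epsilon> * (s * b s' - s' * b s) = 0})"
    have "finite bad" unfolding bad_def
      by (intro finite_UnI finite_UN_I finS finite_affine_roots finite_Diff) auto
    then have inf: "infinite (- bad)" by (simp add: Compl_eq_Diff_UNIV infinite_UNIV_char_0)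
    define P where "P \<epsilon> = Lp (\<lambda>_. 0) (\<lambda>l. u0 l + \<epsilon> * v l)" for \<epsilon>
    \<comment> \<open>The parameter at which the radial line in direction u0 + \<epsilon>v meets the
      line through s u0.\<close>
    define \<sigma> where "\<sigma> \<epsilon> s = s / (1 + \<epsilon> * b s)" for \<epsilon> s
    define N where "N \<epsilon> = restrict (\<lambda>s. order (\<sigma> \<epsilon> s) (P \<epsilon>)) S" for \<epsilon>
    have good: "F (\<lambda>l. X * (u0 l + \<epsilon> * v l)) = (\<Prod>s\<in>S. (1 - X * (1 + \<epsilon> * b s) / s) ^ N \<epsilon> s)" if "\<epsilon> \<notin> bad" for \<epsilon> X
    proof -
      have nz: "1 + \<epsilon> * b s \<noteq> 0" if "s \<in> S" for s using that \<open>\<epsilon> \<notin> bad\<close> by (auto simp: bad_def)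
      have inj: "inj_on (\<sigma> \<epsilon>) S"
      proof (rule inj_onI, rule ccontr)
        fix s s' assume s: "s \<in> S" "s' \<in> S" "\<sigma> \<epsilon> s = \<sigma> \<epsilon> s'" "s \<noteq> s'"
        then have "(s - s') + \<epsilon> * (s * b s' - s' * b s) = 0"
          using nz[of s] nz[of s'] by (simp add: \<sigma>_def field_simps)
        with s \<open>\<epsilon> \<notin> bad\<close> show False by (auto simp: bad_def)
      qed
      have "\<sigma> \<epsilon> ` S \<subseteq> Z (\<lambda>l. u0 l + \<epsilon> * v l)"
      proof clarify
        fix s assume s: "s \<in> S"
        have "s * u0 l + (\<sigma> \<epsilon> s * \<epsilon>) * (v l - b s * u0 l) = \<sigma> \<epsilon> s * (u0 l + \<epsilon> * v l)" for l
          using nz[OF s] by (simp add: \<sigma>_def field_simps)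
        with b[OF s, of "\<sigma> \<epsilon> s * \<epsilon>"] show "\<sigma> \<epsilon> s \<in> Z (\<lambda>l. u0 l + \<epsilon> * v l)"
          by (simp add: Z_def Lp)
      qed
      moreover have "card (\<sigma> \<epsilon> ` S) = card S" by (rule card_image[OF inj])
      ultimately have Zim: "Z (\<lambda>l. u0 l + \<epsilon> * v l) = \<sigma> \<epsilon> ` S"
        using max[of "\<lambda>l. u0 l + \<epsilon> * v l"] finZ unfolding S_def by (metis card_seteq)
      have "F (\<lambda>l. X * (u0 l + \<epsilon> * v l)) = poly (P \<epsilon>) X" by (simp add: P_def Lp)
      also have "\<dots> = (\<Prod>z\<in>\<sigma> \<epsilon> ` S. (1 - X / z) ^ order z (P \<epsilon>))"
        unfolding Zim[symmetric] Z_def P_def[symmetric]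
        by (rule poly_lin_prod_normalized) (simp add: P_def Lp0)
      also have "\<dots> = (\<Prod>s\<in>S. (1 - X / \<sigma> \<epsilon> s) ^ order (\<sigma> \<epsilon> s) (P \<epsilon>))"
        by (simp add: prod.reindex[OF inj])
      also have "\<dots> = (\<Prod>s\<in>S. (1 - X * (1 + \<epsilon> * b s) / s) ^ N \<epsilon> s)"
        by (intro prod.cong refl) (simp add: \<sigma>_def N_def)
      finally show ?thesis .
    qed
    \<comment> \<open>Multiplicities might vary with \<epsilon>, but only finitely many patterns on
      S are possible; \<open>restrict\<close> makes them elements of a finite product. One pattern
      recurs for infinitely many \<epsilon>, enough to extend the factorization to all \<epsilon> as
      a polynomial identity.\<close>
    have "N ` (- bad) \<subseteq> PiE S (\<lambda>_. {..?n})"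
    proof clarify
      fix \<epsilon> show "N \<epsilon> \<in> PiE S (\<lambda>_. {..?n})"
        unfolding N_def
      proof (intro restrict_PiE_iff[THEN iffD2] ballI)
        fix s have "P \<epsilon> \<noteq> 0" by (simp add: P_def Lpnz)
        then show "order (\<sigma> \<epsilon> s) (P \<epsilon>) \<in> {..?n}"
          using order_degree[of "P \<epsilon>" "\<sigma> \<epsilon> s"] degLp[of "\<lambda>_. 0"] by (simp add: P_def le_trans)
      qed
    qed
    then have "finite (N ` (- bad))" by (rule finite_subset) (auto intro!: finite_PiE finS)
    then obtain \<epsilon>0 where "infinite {\<epsilon> \<in> - bad. N \<epsilon> = N \<epsilon>0}"
      using pigeonhole_infinite[OF inf] by blast
    then obtain m where m: "infinite {\<epsilon> \<in> - bad. N \<epsilon> = m}" by blast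
    define \<beta> where "\<beta> s = b s / s" for s
    have 1: "F (\<lambda>l. X * (u0 l + \<epsilon> * v l)) = (\<Prod>s\<in>S. (1 - X * (1 + \<epsilon> * b s) / s) ^ m s)" for X \<epsilon>
    proof -
      have "Lp (\<lambda>l. X * u0 l) (\<lambda>l. X * v l) = (\<Prod>s\<in>S. [:1 - X / s, - (X * \<beta> s):] ^ m s)"
      proof (rule poly_eq_if_infinite_agree[OF m])
        fix \<epsilon> assume \<epsilon>: "\<epsilon> \<in> {\<epsilon> \<in> - bad. N \<epsilon> = m}"
        have "poly (Lp (\<lambda>l. X * u0 l) (\<lambda>l. X * v l)) \<epsilon> = F (\<lambda>l. X * (u0 l + \<epsilon> * v l))"
          by (simp add: Lp algebra_simps)
        also have "\<dots> = (\<Prod>s\<in>S. (1 - X * (1 + \<epsilon> * b s) / s) ^ m s)" using \<epsilon> by (simp add: good)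
        finally show "poly (Lp (\<lambda>l. X * u0 l) (\<lambda>l. X * v l)) \<epsilon> = poly (\<Prod>s\<in>S. [:1 - X / s, - (X * \<beta> s):] ^ m s) \<epsilon>"
          by (simp add: poly_prod \<beta>_def algebra_simps add_divide_distrib)
      qed
      from arg_cong[OF this, of "\<lambda>p. poly p \<epsilon>"] show ?thesis
        by (simp add: Lp poly_prod \<beta>_def algebra_simps add_divide_distrib)
    qed
    have 2: "F (\<lambda>l. X * u0 l + t * v l) = (\<Prod>s\<in>S. (1 - X / s - t * \<beta> s) ^ m s)" for X t
    proof -
      \<comment> \<open>The substitution \<epsilon> = t / X reaches every point with X nonzero, and
        both sides are polynomials in X.\<close>
      have "Lp (\<lambda>l. t * v l) u0 = (\<Prod>s\<in>S. [:1 - t * \<beta> s, - 1 / s:] ^ m s)"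
      proof (rule poly_eq_if_infinite_agree[of "- {0}"])
        show "infinite (- {0 :: complex})" by (simp add: Compl_eq_Diff_UNIV infinite_UNIV_char_0)
        fix X :: complex assume "X \<in> - {0}"
        then have X: "X \<noteq> 0" by simp
        have "poly (Lp (\<lambda>l. t * v l) u0) X = F (\<lambda>l. X * (u0 l + t / X * v l))"
          using X by (simp add: Lp algebra_simps)
        also have "\<dots> = (\<Prod>s\<in>S. (1 - X * (1 + t / X * b s) / s) ^ m s)" by (rule 1)
        also have "\<dots> = poly (\<Prod>s\<in>S. [:1 - t * \<beta> s, - 1 / s:] ^ m s) X"
          unfolding poly_prod poly_power
          by (intro prod.cong refl arg_cong2[where f="(^)"])
             (use X S0 in \<open>auto simp: \<beta>_def field_simps\<close>)
        finally show "poly (Lp (\<lambda>l. t * v l) u0) X = poly (\<Prod>s\<in>S. [:1 - t * \<beta> s, - 1 / s:] ^ m s) X" .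
      qed
      from arg_cong[OF this, of "\<lambda>p. poly p X"] show ?thesis
        by (simp add: Lp poly_prod algebra_simps)
    qed
    \<comment> \<open>At t = 0 the factorization is the one of the original line, so the pattern m
      does not depend on v.\<close>
    have mM: "m s = M s" if s: "s \<in> S" for s
    proof -
      have lin: "[:1, - 1 / z:] = smult (- 1 / z) [:- z, 1:]" if "z \<in> S" for z
        using S0[OF that] by simp
      have "poly (Lp (\<lambda>_. 0) u0) X = poly (\<Prod>z\<in>S. [:1, - 1 / z:] ^ m z) X" for X
        using 2[of X 0] by (simp add: Lp poly_prod)
      then have "Lp (\<lambda>_. 0) u0 = (\<Prod>z\<in>S. [:1, - 1 / z:] ^ m z)" using poly_eq_poly_eq_iff by blast
      also have "\<dots> = [:1, - 1 / s:] ^ m s * (\<Prod>z\<in>S - {s}. [:1, - 1 / z:] ^ m z)"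
        using s finS by (rule prod.remove[rotated])
      also have "\<dots> = smult ((- 1 / s) ^ m s) ([:- s, 1:] ^ m s) * (\<Prod>z\<in>S - {s}. [:1, - 1 / z:] ^ m z)"
        by (simp only: lin[OF s] smult_power)
      finally have e: "Lp (\<lambda>_. 0) u0 = smult ((- 1 / s) ^ m s) ([:- s, 1:] ^ m s) * (\<Prod>z\<in>S - {s}. [:1, - 1 / z:] ^ m z)" .
      have "poly (\<Prod>z\<in>S - {s}. [:1, - 1 / z:] ^ m z) s \<noteq> 0"
        using finS S0 by (auto simp: poly_prod field_simps)
      then have "order s (\<Prod>z\<in>S - {s}. [:1, - 1 / z:] ^ m z) = 0" by (rule order_0I)
      then show ?thesis
        using Lpnz[of u0] S0[OF s] unfolding M_def e
        by (subst order_mult) (auto simp: order_smult order_power_n_n)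
    qed
    have "F (\<lambda>l. X * u0 l + t * v l) = (\<Prod>j\<in>A. 1 - X / fst j - t * \<beta> (fst j))" for X t
      unfolding 2 prodA[of "\<lambda>s. 1 - X / s - t * \<beta> s"] by (intro prod.cong refl) (simp add: mM)
    then show ?thesis by blast
  qed
  then obtain \<beta> where \<beta>: "\<And>v X t. F (\<lambda>l. X * u0 l + t * v l) = (\<Prod>j\<in>A. 1 - X / fst j - t * \<beta> v (fst j))"
    by metis
  \<comment> \<open>The first-order coefficient along v is a directional derivative, hence linear in
    v with the gradient as g. Linearity of \<beta> in v has to be extracted from it.\<close>
  have "\<exists>g. \<forall>v. coeff (Lp y v) 1 = (\<Sum>l\<in>UNIV. v l * g l)" for y
  proof -
    have "coeff (Lp y v) 1 = (\<Sum>l\<in>UNIV. v l * (\<Sum>I\<in>UNIV. c I *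
       (of_nat (Poly_Mapping.lookup (exponent I) l) * y l ^ (Poly_Mapping.lookup (exponent I) l - 1) *
         (\<Prod>i\<in>UNIV - {l}. y i ^ Poly_Mapping.lookup (exponent I) i))))" for v
    proof -
      have "coeff (Lp y v) 1 = (\<Sum>I\<in>UNIV. c I * coeff (\<Prod>l\<in>UNIV. [:y l, v l:] ^ Poly_Mapping.lookup (exponent I) l) 1)"
        by (simp add: Lp_sum coeff_sum)
      then show ?thesis
        unfolding coeff_1_prod_linear_power sum_distrib_left
        by (subst (asm) sum.swap) (simp only: mult_ac)
    qed
    then show ?thesis by (intro exI allI)
  qed
  then obtain g where g: "\<And>y v. coeff (Lp y v) 1 = (\<Sum>l\<in>UNIV. v l * g y l)" by metis
  have der: "(\<Sum>l\<in>UNIV. v l * g (\<lambda>l. X * u0 l) l) =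
     (\<Sum>j\<in>A. - \<beta> v (fst j) * (\<Prod>i\<in>A - {j}. 1 - X / fst i))" for v X
  proof -
    have "Lp (\<lambda>l. X * u0 l) v = (\<Prod>j\<in>A. [:1 - X / fst j, - \<beta> v (fst j):])"
      by (rule poly_eq_poly_eq_iff[THEN iffD1], rule ext) (simp add: Lp \<beta> poly_prod)
    then have "(\<Sum>l\<in>UNIV. v l * g (\<lambda>l. X * u0 l) l) = coeff (\<Prod>j\<in>A. [:1 - X / fst j, - \<beta> v (fst j):]) (Suc 0)"
      using g[of "\<lambda>l. X * u0 l" v] by simp
    also have "\<dots> = (\<Sum>j\<in>A. - \<beta> v (fst j) * coeff (\<Prod>i\<in>A - {j}. [:1 - X / fst i, - \<beta> v (fst i):]) 0)"
      using coeff_prod_linear_deriv[OF finA, of "\<lambda>j. - \<beta> v (fst j)" "\<lambda>j. 1 - X / fst j" 0] by simp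
    finally show ?thesis by (simp flip: poly_0_coeff_0 add: poly_prod)
  qed
  define \<delta> where "\<delta> l = \<beta> (\<lambda>k. if k = l then 1 else 0)" for l
  have lin: "\<beta> v (fst j) = (\<Sum>l\<in>UNIV. v l * \<delta> l (fst j))" if j: "j \<in> A" for v j
  proof -
    \<comment> \<open>The defect of linearity. The gradient along X u0 is known for all X and
      combines the products that omit one root; isolating each root kills \<gamma>. Its dependence
      on the root alone makes this work for repeated roots.\<close>
    define \<gamma> where "\<gamma> s = \<beta> v s - (\<Sum>l\<in>UNIV. v l * \<delta> l s)" for s
    have "(\<Sum>j\<in>A. (\<Prod>i\<in>A - {j}. X + - fst i) ^ 1 * (fst j * \<gamma> (fst j))) = 0" for X
    proof -
      have gl: "g (\<lambda>l. X * u0 l) l = (\<Sum>j\<in>A. - \<delta> l (fst j) * (\<Prod>i\<in>A - {j}. 1 - X / fst i))" for l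
        using der[of "\<lambda>k. if k = l then 1 else 0" X]
        by (simp add: \<delta>_def if_distrib[of "\<lambda>x. x * _"] cong: if_cong)
      have "(\<Sum>j\<in>A. - \<beta> v (fst j) * (\<Prod>i\<in>A - {j}. 1 - X / fst i)) =
         (\<Sum>l\<in>UNIV. v l * (\<Sum>j\<in>A. - \<delta> l (fst j) * (\<Prod>i\<in>A - {j}. 1 - X / fst i)))"
        unfolding der[symmetric] gl ..
      also have "\<dots> = (\<Sum>j\<in>A. - (\<Sum>l\<in>UNIV. v l * \<delta> l (fst j)) * (\<Prod>i\<in>A - {j}. 1 - X / fst i))"
        unfolding sum_distrib_left
        by (subst sum.swap) (simp add: sum_distrib_right sum_negf mult_ac)
      finally have "(\<Sum>j\<in>A. \<gamma> (fst j) * (\<Prod>i\<in>A - {j}. 1 - X / fst i)) = 0"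
        by (simp add: \<gamma>_def left_diff_distrib sum_subtractf sum_negf)
      moreover have "(\<Prod>i\<in>A. - fst i) * (\<gamma> (fst j) * (\<Prod>i\<in>A - {j}. 1 - X / fst i)) =
          - ((\<Prod>i\<in>A - {j}. X + - fst i) ^ 1 * (fst j * \<gamma> (fst j)))" if "j \<in> A" for j
      proof -
        have "(\<Prod>i\<in>A - {j}. X + - fst i) = (\<Prod>i\<in>A - {j}. - fst i * (1 - X / fst i))"
          using S0 by (intro prod.cong refl) (auto simp: A_def field_simps)
        then have e: "(\<Prod>i\<in>A - {j}. X + - fst i) =
            (\<Prod>i\<in>A - {j}. - fst i) * (\<Prod>i\<in>A - {j}. 1 - X / fst i)"
          by (simp only: prod.distrib)
        show ?thesis
          unfolding power_one_right e using that finA by (simp add: prod.remove[of A j])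
      qed
      then have "(\<Prod>i\<in>A. - fst i) * (\<Sum>j\<in>A. \<gamma> (fst j) * (\<Prod>i\<in>A - {j}. 1 - X / fst i)) =
         - (\<Sum>j\<in>A. (\<Prod>i\<in>A - {j}. X + - fst i) ^ 1 * (fst j * \<gamma> (fst j)))"
        unfolding sum_distrib_left sum_negf[symmetric] by (intro sum.cong refl)
      ultimately show ?thesis by simp
    qed
    then have "fst j * \<gamma> (fst j) = 0"
      by (intro isolate_repeated_factor[of A j 1 "\<lambda>i. - fst i" "\<lambda>j. fst j * \<gamma> (fst j)"] finA j) auto
    then show ?thesis using S0 j by (auto simp: \<gamma>_def A_def)
  qed
  have "card A \<le> CARD('d option)"
  proof -
    have "Lp (\<lambda>_. 0) u0 = (\<Prod>j\<in>A. [:1, - 1 / fst j:])"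
      using \<beta>[of _ 0] by (intro poly_eq_poly_eq_iff[THEN iffD1] ext) (simp add: Lp poly_prod)
    moreover have "degree (\<Prod>j\<in>A. [:1, - 1 / fst j:]) = (\<Sum>j\<in>A. degree [:1, - 1 / fst j:])"
      by (rule degree_prod_sum_eq) auto
    moreover have "\<dots> = (\<Sum>j\<in>A. 1)" using S0 by (intro sum.cong) (auto simp: A_def)
    ultimately show ?thesis using degLp[of "\<lambda>_. 0" u0] by simp
  qed
  then obtain f :: "complex \<times> nat \<Rightarrow> 'd option" where f: "inj_on f A"
    using card_le_inj[of A "UNIV :: 'd option set"] finA by auto
  \<comment> \<open>If there are fewer than d + 1 roots, the rows left over are 0 and contribute the
    factor 1.\<close>
  define X where "X k l = (if k \<in> f ` A then \<delta> l (fst (the_inv_into A f k)) else 0)" for k l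
  have Ft: "F v = (\<Prod>k\<in>UNIV. 1 - (\<Sum>l\<in>UNIV. X k l * v l))" for v
  proof -
    have "F v = (\<Prod>j\<in>A. 1 - \<beta> v (fst j))" using \<beta>[of 0 1 v] by simp
    also have "\<dots> = (\<Prod>j\<in>A. 1 - (\<Sum>l\<in>UNIV. X (f j) l * v l))"
      by (intro prod.cong refl) (simp add: lin X_def the_inv_into_f_f[OF f] mult.commute)
    also have "\<dots> = (\<Prod>k\<in>f ` A. 1 - (\<Sum>l\<in>UNIV. X k l * v l))"
      by (simp add: prod.reindex[OF f])
    also have "\<dots> = (\<Prod>k\<in>UNIV. 1 - (\<Sum>l\<in>UNIV. X k l * v l))"
      by (intro prod.mono_neutral_left) (auto simp: X_def)
    finally show ?thesis .
  qed
  define P where "P = (\<Sum>I\<in>UNIV. Poly_Mapping.single (exponent I) (c I))"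
  have "meval v P = F v" for v
    by (simp add: P_def msubst_sum[OF rhom_id] msubst_single[OF rhom_id] F_def hform_def mmon_UNIV)
  then have "P = lin_prod X"
    by (intro mpol_eq_if_meval_eq) (simp add: Ft msubst_lin_prod[OF rhom_id])
  moreover have "Poly_Mapping.lookup P (exponent I) = c I" for I
    by (simp add: P_def lookup_sum lookup_single when_def exponent_inject)
  ultimately show ?thesis by metis
qed

section \<open>The Dirichlet integral\<close>

theorem multinomial_theorem:
  fixes x :: "'k \<Rightarrow> 'r::field_char_0"
  assumes "finite A"
  shows "(\<Sum>i\<in>A. x i) ^ N = (\<Sum>a | a \<in> PiE A (\<lambda>_. {..N}) \<and> sum a A = N.
    fact N / (\<Prod>i\<in>A. fact (a i)) * (\<Prod>i\<in>A. x i ^ a i))"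
  using assms
proof (induction A arbitrary: N)
  case empty
  then show ?case by (cases N) (auto simp: if_distrib cong: conj_cong)
next
  case (insert b A)
  define C where "C N = {a. a \<in> PiE A (\<lambda>_. {..N}) \<and> sum a A = N}" for N :: nat
  have finC: "finite (C N)" for N
    by (rule finite_subset[of _ "PiE A (\<lambda>_. {..N})"]) (auto simp: C_def intro: finite_PiE insert(1))
  have "(\<Sum>i\<in>insert b A. x i) ^ N = (\<Sum>k\<le>N. of_nat (N choose k) * x b ^ k * (\<Sum>i\<in>A. x i) ^ (N - k))"
    using insert by (simp add: binomial_ring)
  also have "\<dots> = (\<Sum>k\<le>N. \<Sum>a\<in>C (N - k). of_nat (N choose k) * x b ^ k *
      (fact (N - k) / (\<Prod>i\<in>A. fact (a i)) * (\<Prod>i\<in>A. x i ^ a i)))"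
    unfolding insert.IH C_def sum_distrib_left ..
  also have "\<dots> = (\<Sum>(k, a)\<in>Sigma {..N} (\<lambda>k. C (N - k)). of_nat (N choose k) * x b ^ k *
      (fact (N - k) / (\<Prod>i\<in>A. fact (a i)) * (\<Prod>i\<in>A. x i ^ a i)))"
    by (rule sum.Sigma) (auto simp: finC)
  also have "\<dots> = (\<Sum>a | a \<in> PiE (insert b A) (\<lambda>_. {..N}) \<and> sum a (insert b A) = N.
    fact N / (\<Prod>i\<in>insert b A. fact (a i)) * (\<Prod>i\<in>insert b A. x i ^ a i))"
  proof (rule sum.reindex_bij_witness[of _ "\<lambda>a. (a b, a(b := undefined))" "\<lambda>(k, a). a(b := k)"])
    fix p assume "p \<in> Sigma {..N} (\<lambda>k. C (N - k))"
    then obtain k a where p: "p = (k, a)" "k \<le> N" "a \<in> PiE A (\<lambda>_. {..N - k})" "sum a A = N - k"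
      by (auto simp: C_def)
    have ab: "a b = undefined" using p(3) insert(2) by (auto simp: PiE_def extensional_def)
    have cong: "(\<Prod>i\<in>A. g i ((a(b := k)) i)) = (\<Prod>i\<in>A. g i (a i))" for g :: "'k \<Rightarrow> nat \<Rightarrow> 'r"
      using insert(2) by (intro prod.cong) auto
    have sumc: "sum (a(b := k)) A = N - k" using p(4) insert(2) by (subst p(4)[symmetric], intro sum.cong) auto
    show "(case p of (k, a) \<Rightarrow> a(b := k)) \<in> {a. a \<in> PiE (insert b A) (\<lambda>_. {..N}) \<and> sum a (insert b A) = N}"
      using p insert(1,2) sumc by (auto simp: PiE_def Pi_def extensional_def)
    show "((case p of (k, a) \<Rightarrow> a(b := k)) b, (case p of (k, a) \<Rightarrow> a(b := k))(b := undefined)) = p"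
      using ab by (simp add: p(1) fun_upd_idem)
    have "(fact N :: 'r) = fact k * fact (N - k) * of_nat (N choose k)"
      using binomial_fact_lemma[OF p(2)] by (metis of_nat_fact of_nat_mult)
    then show "fact N / (\<Prod>i\<in>insert b A. fact ((case p of (k, a) \<Rightarrow> a(b := k)) i)) *
       (\<Prod>i\<in>insert b A. x i ^ (case p of (k, a) \<Rightarrow> a(b := k)) i) =
       (case p of (k, a) \<Rightarrow> of_nat (N choose k) * x b ^ k * (fact (N - k) / (\<Prod>i\<in>A. fact (a i)) * (\<Prod>i\<in>A. x i ^ a i)))"
      using insert(1,2) cong[of "\<lambda>_. fact"] cong[of "\<lambda>i e. x i ^ e"] by (simp add: p(1) field_simps del: fun_upd_apply add: fun_upd_same)
  next
    fix a assume "a \<in> {a. a \<in> PiE (insert b A) (\<lambda>_. {..N}) \<and> sum a (insert b A) = N}"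
    then have a: "a \<in> PiE (insert b A) (\<lambda>_. {..N})" "a b + sum a A = N" using insert by auto
    have s: "sum (a(b := undefined)) A = sum a A" using insert(2) by (intro sum.cong) auto
    have "a i \<le> N - a b" if "i \<in> A" for i
      using member_le_sum[of i A a] a(2) insert(1) that by auto
    then have "a(b := undefined) \<in> PiE A (\<lambda>_. {..N - a b})"
      using a(1) insert(2) by (auto simp: PiE_def Pi_def extensional_def)
    then show "(a b, a(b := undefined)) \<in> Sigma {..N} (\<lambda>k. C (N - k))"
      using a s by (auto simp: C_def)
    show "(case (a b, a(b := undefined)) of (k, a) \<Rightarrow> a(b := k)) = a" by simp
  qed
  finally show ?case .
qed

lemma finite_compositions: "finite {a :: 'k::finite \<Rightarrow> nat. sum a UNIV = N}"
proof (rule finite_subset)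
  show "{a :: 'k \<Rightarrow> nat. sum a UNIV = N} \<subseteq> PiE UNIV (\<lambda>_. {..N})"
    using member_le_sum[of _ "UNIV :: 'k set"] by auto
qed (simp add: finite_PiE)

corollary multinomial_theorem_UNIV:
  fixes x :: "'k::finite \<Rightarrow> 'r::field_char_0"
  shows "(\<Sum>i\<in>UNIV. x i) ^ N = (\<Sum>a | sum a UNIV = N.
    fact N / (\<Prod>i\<in>UNIV. fact (a i)) * (\<Prod>i\<in>UNIV. x i ^ a i))"
proof -
  have "{a :: 'k \<Rightarrow> nat. a \<in> PiE UNIV (\<lambda>_. {..N}) \<and> sum a UNIV = N} = {a. sum a UNIV = N}"
    using member_le_sum[of _ "UNIV :: 'k set"] by auto
  then show ?thesis by (simp add: multinomial_theorem)
qed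

text \<open>Integration by parts in k: the derivative of y^(k+1) (t - y)^(m+1) integrates to 0,
  since both boundary values vanish.\<close>

lemma has_integral_beta_nat:
  fixes t :: real
  assumes t: "t \<ge> 0"
  shows "((\<lambda>y. y ^ k * (t - y) ^ m) has_integral (fact k * fact m / fact (k + m + 1) * t ^ (k + m + 1))) {0..t}"
proof (induction k arbitrary: m)
  case 0
  have "((\<lambda>y. (t - y) ^ m) has_integral (- ((t - t) ^ Suc m / Suc m) - (- ((t - 0) ^ Suc m / Suc m)))) {0..t}"
    by (rule fundamental_theorem_of_calculus[OF t])
       (auto intro!: derivative_eq_intros simp flip: has_real_derivative_iff_has_vector_derivative
         simp del: of_nat_Suc power_Suc)
  moreover have "- ((t - t) ^ Suc m / Suc m) - (- ((t - 0) ^ Suc m / Suc m)) =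
      fact 0 * fact m / fact (0 + m + 1) * t ^ (0 + m + 1)"
    by (simp add: divide_simps del: of_nat_Suc)
  ultimately show ?case by simp
next
  case (Suc k)
  have "((\<lambda>y. (Suc k * y ^ k) * (t - y) ^ Suc m - y ^ Suc k * (Suc m * (t - y) ^ m)) has_integral
      (t ^ Suc k * (t - t) ^ Suc m - 0 ^ Suc k * (t - 0) ^ Suc m)) {0..t}"
    by (rule fundamental_theorem_of_calculus[OF t])
       (auto intro!: derivative_eq_intros simp flip: has_real_derivative_iff_has_vector_derivative
         simp del: of_nat_Suc power_Suc)
  then have d: "((\<lambda>y. (Suc k * y ^ k) * (t - y) ^ Suc m - y ^ Suc k * (Suc m * (t - y) ^ m)) has_integral 0) {0..t}"
    by simp
  have "((\<lambda>y. Suc k * (y ^ k * (t - y) ^ Suc m)) has_integral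
     Suc k * (fact k * fact (Suc m) / fact (k + Suc m + 1) * t ^ (k + Suc m + 1))) {0..t}"
    by (rule has_integral_mult_right[OF Suc.IH])
  from has_integral_mult_right[OF has_integral_diff[OF this d], of "1 / Suc m"]
  have "((\<lambda>y. y ^ Suc k * (t - y) ^ m) has_integral
     1 / Suc m * (Suc k * (fact k * fact (Suc m) / fact (k + Suc m + 1) * t ^ (k + Suc m + 1)) - 0)) {0..t}"
    by (rule has_integral_eq[rotated]) (simp add: field_simps del: of_nat_Suc)
  also have "1 / Suc m * (Suc k * (fact k * fact (Suc m) / fact (k + Suc m + 1) * t ^ (k + Suc m + 1)) - 0) =
      fact (Suc k) * fact m / fact (Suc k + m + 1) * t ^ (Suc k + m + 1)"
    by (simp add: field_simps del: of_nat_Suc)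
  finally show ?case .
qed

context
  fixes S :: "'a set \<Rightarrow> real \<Rightarrow> ('a \<Rightarrow> real) set"
  defines "S \<equiv> (\<lambda>A t. {x. (\<forall>i\<in>A. 0 \<le> x i) \<and> sum x A \<le> t})"
begin

text \<open>The size t stays free in the induction: fixing the new coordinate at y leaves the
  simplex of size t - y. The inner integral is then a power of t - y and the outer one a beta
  integral. The exponent b belongs to the slack coordinate.\<close>

lemma nn_integral_dirichlet_aux:
  fixes t :: real
  assumes "finite A" "t \<ge> 0"
  shows "(\<integral>\<^sup>+x. ennreal ((\<Prod>i\<in>A. x i ^ k i) * (t - sum x A) ^ b) * indicator (S A t \<inter> space (PiM A (\<lambda>_. lborel))) x
      \<partial>PiM A (\<lambda>_. lborel)) =
    ennreal ((\<Prod>i\<in>A. fact (k i)) * fact b / fact (b + card A + sum k A) * t ^ (b + card A + sum k A))"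
  using assms
proof (induction arbitrary: t rule: finite_induct)
  case (empty t)
  then show ?case by (simp add: PiM_empty S_def nn_integral_count_space_finite)
next
  case (insert j A t)
  let ?M = "\<lambda>A. PiM A (\<lambda>_. lborel) :: ('a \<Rightarrow> real) measure"
  have meas: "S A t \<inter> space (?M A) \<in> sets (?M A)" if "finite A" for A t
  proof -
    have "S A t \<inter> space (?M A) = PiE A (\<lambda>_. {0..}) \<inter> (\<lambda>x. sum x A) -` {..t} \<inter> space (?M A)"
      by (auto simp: S_def space_PiM)
    also have "\<dots> \<in> sets (?M A)" using that by measurable
    finally show ?thesis .
  qed
  have step: "x(j := y) \<in> S (insert j A) t \<longleftrightarrow> y \<in> {0..t} \<and> x \<in> S A (t - y)" for x y
    using insert.hyps sum_nonneg[of A x] unfolding S_def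
    by (force simp: sum_delta_notmem algebra_simps)
  have measf: "(\<lambda>x. ennreal ((\<Prod>i\<in>A. x i ^ k i) * (t - sum x A) ^ b) * indicator (S A t \<inter> space (?M A)) x)
      \<in> borel_measurable (?M A)" if "finite A" for A and t :: real
    using meas[OF that, measurable] that by measurable
  define m where "m = b + card A + sum k A"
  define c where "c = (\<Prod>i\<in>A. fact (k i)) * fact b / (fact m :: real)"
  have c: "c \<ge> 0" unfolding c_def by (intro divide_nonneg_nonneg mult_nonneg_nonneg prod_nonneg) auto
  interpret product_sigma_finite "\<lambda>_. lborel" by standard
  let ?f = "\<lambda>A t x. ennreal ((\<Prod>i\<in>A. x i ^ k i) * (t - sum x A) ^ b) * indicator (S A t \<inter> space (?M A)) x"
  have "(\<integral>\<^sup>+x. ?f (insert j A) t x \<partial>?M (insert j A)) =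
      (\<integral>\<^sup>+y. \<integral>\<^sup>+x. ?f (insert j A) t (x(j := y)) \<partial>?M A \<partial>lborel)"
    using insert.hyps measf[of "insert j A"] by (intro product_nn_integral_insert_rev) auto
  also have "\<dots> = (\<integral>\<^sup>+y. \<integral>\<^sup>+x. (ennreal (y ^ k j) * indicator {0..t} y) * ?f A (t - y) x \<partial>?M A \<partial>lborel)"
  proof (intro nn_integral_cong)
    fix y :: real and x assume "x \<in> space (?M A)"
    then have sp: "x(j := y) \<in> space (?M (insert j A))"
      by (auto simp: space_PiM PiE_def extensional_def)
    have p: "(\<Prod>i\<in>insert j A. (x(j := y)) i ^ k i) = y ^ k j * (\<Prod>i\<in>A. x i ^ k i)"
      using insert.hyps by (simp, intro disjI2 prod.cong) auto
    have s: "sum (x(j := y)) (insert j A) = y + sum x A"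
      using insert.hyps by (simp, intro sum.cong) auto
    show "?f (insert j A) t (x(j := y)) = (ennreal (y ^ k j) * indicator {0..t} y) * ?f A (t - y) x"
    proof (cases "y \<in> {0..t} \<and> x \<in> S A (t - y)")
      case True
      then have "0 \<le> (\<Prod>i\<in>A. x i ^ k i) * (t - y - sum x A) ^ b"
        by (auto simp: S_def intro!: mult_nonneg_nonneg prod_nonneg)
      with True show ?thesis
        using step[of x y] sp \<open>x \<in> space _\<close>
        by (simp only: p s) (simp add: ennreal_mult[symmetric] mult_ac diff_diff_eq)
    next
      case False
      then show ?thesis using step[of x y] by auto
    qed
  qed
  also have "\<dots> = (\<integral>\<^sup>+y. ennreal (y ^ k j) * indicator {0..t} y * (\<integral>\<^sup>+x. ?f A (t - y) x \<partial>?M A) \<partial>lborel)"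
    using measf[OF insert.hyps(1)] by (intro nn_integral_cong nn_integral_cmult)
  also have "\<dots> = (\<integral>\<^sup>+y. ennreal c * (ennreal (y ^ k j * (t - y) ^ m) * indicator {0..t} y) \<partial>lborel)"
  proof (intro nn_integral_cong)
    fix y :: real
    show "ennreal (y ^ k j) * indicator {0..t} y * (\<integral>\<^sup>+x. ?f A (t - y) x \<partial>?M A) =
       ennreal c * (ennreal (y ^ k j * (t - y) ^ m) * indicator {0..t} y)"
    proof (cases "y \<in> {0..t}")
      case True
      then have "(\<integral>\<^sup>+x. ?f A (t - y) x \<partial>?M A) = ennreal (c * (t - y) ^ m)"
        using insert.IH[of "t - y"] by (simp add: c_def m_def)
      then show ?thesis using True c by (simp add: ennreal_mult[symmetric] mult_ac)
    qed simp
  qed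
  also have "\<dots> = ennreal c * (\<integral>\<^sup>+y. ennreal (y ^ k j * (t - y) ^ m) * indicator {0..t} y \<partial>lborel)"
    by (intro nn_integral_cmult) auto
  also have "(\<integral>\<^sup>+y. ennreal (y ^ k j * (t - y) ^ m) * indicator {0..t} y \<partial>lborel) =
      ennreal (fact (k j) * fact m / fact (k j + m + 1) * t ^ (k j + m + 1))"
    by (intro nn_integral_has_integral_lebesgue' has_integral_beta_nat insert.prems) auto
  also have "ennreal c * \<dots> = ennreal (c * (fact (k j) * fact m / fact (k j + m + 1) * t ^ (k j + m + 1)))"
    using c insert.prems by (subst ennreal_mult) auto
  also have "c * (fact (k j) * fact m / fact (k j + m + 1) * t ^ (k j + m + 1)) =
    (\<Prod>i\<in>insert j A. fact (k i)) * fact b / fact (b + card (insert j A) + sum k (insert j A)) *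
      t ^ (b + card (insert j A) + sum k (insert j A))"
  proof -
    have e: "b + card (insert j A) + sum k (insert j A) = k j + m + 1" using insert.hyps by (simp add: m_def)
    show ?thesis unfolding e using insert.hyps by (simp add: c_def mult_ac)
  qed
  finally show ?case .
qed

end

lemma nn_integral_dirichlet:
  fixes k :: "'a::euclidean_space \<Rightarrow> nat"
  shows "(\<integral>\<^sup>+x. ennreal ((\<Prod>i\<in>Basis. (x \<bullet> i) ^ k i) * (1 - (\<Sum>i\<in>Basis. x \<bullet> i)) ^ b) *
      indicator (convex hull (insert 0 Basis)) (x :: 'a) \<partial>lborel) =
    ennreal ((\<Prod>i\<in>Basis. fact (k i)) * fact b / fact (b + DIM('a) + sum k Basis))"
proof -
  let ?M = "PiM Basis (\<lambda>_. lborel) :: ('a \<Rightarrow> real) measure"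
  let ?S = "{x :: 'a. (\<forall>i\<in>Basis. 0 \<le> x \<bullet> i) \<and> sum ((\<bullet>) x) Basis \<le> 1}"
  have "closed ?S" using compact_imp_closed[OF finite_imp_compact_convex_hull[of "insert (0::'a) Basis"]] by (simp add: std_simplex)
  then have [measurable]: "?S \<in> sets borel" by (rule borel_closed)
  have "(\<integral>\<^sup>+x. ennreal ((\<Prod>i\<in>Basis. (x \<bullet> i) ^ k i) * (1 - (\<Sum>i\<in>Basis. x \<bullet> i)) ^ b) *
      indicator ?S (x :: 'a) \<partial>lborel) =
    (\<integral>\<^sup>+w. ennreal ((\<Prod>i\<in>Basis. ((\<Sum>b\<in>Basis. w b *\<^sub>R b) \<bullet> i) ^ k i) * (1 - (\<Sum>i\<in>Basis. (\<Sum>b\<in>Basis. w b *\<^sub>R b) \<bullet> i)) ^ b) *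
      indicator ?S (\<Sum>b\<in>Basis. w b *\<^sub>R b :: 'a) \<partial>?M)"
    by (subst lborel_eq, subst nn_integral_distr) auto
  also have "\<dots> = (\<integral>\<^sup>+x. ennreal ((\<Prod>i\<in>Basis. x i ^ k i) * (1 - sum x Basis) ^ b) *
      indicator ({x. (\<forall>i\<in>Basis. 0 \<le> x i) \<and> sum x Basis \<le> 1} \<inter> space ?M) x \<partial>?M)"
    by (intro nn_integral_cong) (simp add: indicator_def)
  also have "\<dots> = ennreal ((\<Prod>i\<in>Basis. fact (k i)) * fact b / fact (b + DIM('a) + sum k Basis) * 1 ^ (b + DIM('a) + sum k Basis))"
    by (rule nn_integral_dirichlet_aux) auto
  finally show ?thesis by (simp add: std_simplex)
qed

section \<open>Linear change of variables\<close>

lemma Basis_cart: "Basis = range (\<lambda>i. axis i (1::real))" "inj (\<lambda>i. axis i (1::real))"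
  by (auto simp: Basis_vec_def inj_def axis_eq_axis)

lemma prod_Basis_cart: "(\<Prod>b\<in>Basis. h b) = (\<Prod>i\<in>UNIV. h (axis i (1::real)))"
  unfolding Basis_cart(1) by (subst prod.reindex[OF Basis_cart(2)]) simp

lemma sum_Basis_cart: "(\<Sum>b\<in>Basis. h b) = (\<Sum>i\<in>UNIV. h (axis i (1::real)))"
  unfolding Basis_cart(1) by (subst sum.reindex[OF Basis_cart(2)]) simp

text \<open>Induction over elementary linear maps: a zero coordinate contradicts injectivity,
  diagonal maps rescale, swaps and shears preserve volume. The factor may remain anonymous because
  it cancels in a uniform measure.\<close>

lemma lborel_linear_scaling:
  fixes f :: "real^'n \<Rightarrow> real^'n"
  assumes "linear f" "inj f"
  shows "\<exists>c>0. \<forall>g\<in>borel_measurable borel. (\<integral>\<^sup>+x. g x \<partial>lborel) = ennreal c * (\<integral>\<^sup>+x. g (f x) \<partial>lborel)"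
proof -
  let ?P = "\<lambda>f :: real^'n \<Rightarrow> real^'n. \<exists>c>0. \<forall>g\<in>borel_measurable borel. (\<integral>\<^sup>+x. g x \<partial>lborel) = ennreal c * (\<integral>\<^sup>+x. g (f x) \<partial>lborel)"
  have "inj f \<longrightarrow> ?P f"
    using assms(1)
  proof (rule induct_linear_elementary)
    fix f g :: "real^'n \<Rightarrow> real^'n"
    assume f: "linear f" and g: "linear g" and Pf: "inj f \<longrightarrow> ?P f" and Pg: "inj g \<longrightarrow> ?P g"
    show "inj (f \<circ> g) \<longrightarrow> ?P (f \<circ> g)"
    proof
      assume i: "inj (f \<circ> g)"
      then have "inj g" by (rule inj_on_imageI2)
      then have "surj g" using linear_injective_imp_surjective[OF g] by blast
      then have "inj f" using i by (metis (no_types, lifting) comp_apply inj_def surjD)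
      obtain c where c: "c > 0" "\<And>h. h \<in> borel_measurable borel \<Longrightarrow> (\<integral>\<^sup>+x. h x \<partial>lborel) = ennreal c * (\<integral>\<^sup>+x. h (f x) \<partial>lborel)"
        using Pf \<open>inj f\<close> by blast
      obtain c' where c': "c' > 0" "\<And>h. h \<in> borel_measurable borel \<Longrightarrow> (\<integral>\<^sup>+x. h x \<partial>lborel) = ennreal c' * (\<integral>\<^sup>+x. h (g x) \<partial>lborel)"
        using Pg \<open>inj g\<close> by blast
      have mf: "f \<in> borel_measurable borel"
        using f by (intro borel_measurable_continuous_onI linear_continuous_on linear_conv_bounded_linear[THEN iffD1])
      have "(\<integral>\<^sup>+x. h x \<partial>lborel) = ennreal (c * c') * (\<integral>\<^sup>+x. h ((f \<circ> g) x) \<partial>lborel)"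
        if h: "h \<in> borel_measurable borel" for h
        using c(2)[OF h] c'(2)[of "\<lambda>x. h (f x)"] measurable_compose[OF mf h] c(1) c'(1)
        by (simp add: ennreal_mult mult.assoc)
      moreover have "c * c' > 0" using c c' by simp
      ultimately show "?P (f \<circ> g)" by blast
    qed
  next
    fix f :: "real^'n \<Rightarrow> real^'n" and i
    assume f: "linear f" and z: "\<And>x. f x $ i = 0"
    have "\<not> inj f"
    proof
      assume "inj f"
      then have "surj f" using linear_injective_imp_surjective[OF f] by blast
      then obtain x where "axis i 1 = f x" by (metis surjD)
      then have "f x $ i = 1" by (metis axis_nth)
      with z show False by simp
    qed
    then show "inj f \<longrightarrow> ?P f" by blast
  next
    fix c :: "'n \<Rightarrow> real"
    let ?f = "\<lambda>x :: real^'n. \<chi> i. c i * x $ i"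
    show "inj ?f \<longrightarrow> ?P ?f"
    proof
      assume inj: "inj ?f"
      have c: "c i \<noteq> 0" for i
      proof
        assume "c i = 0"
        then have "?f (axis i 1) = ?f 0" by (auto simp: vec_eq_iff axis_def)
        with inj have "axis i (1::real) = 0" by (rule injD)
        then show False by (simp add: axis_eq_0_iff)
      qed
      define c' where "c' b = c (SOME i. b = axis i 1)" for b :: "real^'n"
      have c'a: "c' (axis i 1) = c i" for i by (simp add: c'_def axis_eq_axis)
      have T: "(\<Sum>j\<in>Basis. (c' j * (x \<bullet> j)) *\<^sub>R j) = ?f x" for x :: "real^'n"
        unfolding sum_Basis_cart c'a
        by (simp add: vec_eq_iff inner_axis) (simp add: axis_def if_distrib[of "\<lambda>x. _ * x"] cong: if_cong)
      have nz: "c' j \<noteq> 0" if "j \<in> Basis" for j using that c by (auto simp: Basis_vec_def c'a)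
      have lb: "lborel = density (distr lborel borel (\<lambda>x. 0 + (\<Sum>j\<in>Basis. (c' j * (x \<bullet> j)) *\<^sub>R j))) (\<lambda>_. (\<Prod>j\<in>Basis. \<bar>c' j\<bar>))"
        by (rule lborel_affine_euclidean[OF nz])
      have m: "?f \<in> borel_measurable borel"
        unfolding T[symmetric] by measurable
      have "(\<integral>\<^sup>+x. g x \<partial>lborel) = ennreal (\<Prod>j\<in>Basis. \<bar>c' j\<bar>) * (\<integral>\<^sup>+x. g (?f x) \<partial>lborel)"
        if g: "g \<in> borel_measurable borel" for g
      proof -
        have "(\<integral>\<^sup>+x. g x \<partial>lborel) = (\<integral>\<^sup>+x. g x \<partial>density (distr lborel borel ?f) (\<lambda>_. (\<Prod>j\<in>Basis. \<bar>c' j\<bar>)))"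
          by (subst lb) (simp add: T)
        also have "\<dots> = (\<integral>\<^sup>+x. ennreal (\<Prod>j\<in>Basis. \<bar>c' j\<bar>) * g x \<partial>distr lborel borel ?f)"
          using g by (subst nn_integral_density) auto
        also have "\<dots> = (\<integral>\<^sup>+x. ennreal (\<Prod>j\<in>Basis. \<bar>c' j\<bar>) * g (?f x) \<partial>lborel)"
          using g m by (subst nn_integral_distr) auto
        also have "\<dots> = ennreal (\<Prod>j\<in>Basis. \<bar>c' j\<bar>) * (\<integral>\<^sup>+x. g (?f x) \<partial>lborel)"
          using measurable_compose[OF m g] by (intro nn_integral_cmult) auto
        finally show ?thesis .
      qed
      moreover have "(\<Prod>j\<in>Basis. \<bar>c' j\<bar>) > 0" using nz by (intro prod_pos) auto
      ultimately show "?P ?f" by blast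
    qed
  next
    fix m n :: 'n
    let ?\<tau> = "Transposition.transpose m n"
    let ?f = "\<lambda>x :: real^'n. \<chi> i. x $ ?\<tau> i"
    have lin: "linear ?f" by (rule linearI) (auto simp: vec_eq_iff)
    have mf: "?f \<in> borel_measurable borel"
      using lin by (intro borel_measurable_continuous_onI linear_continuous_on linear_conv_bounded_linear[THEN iffD1])
    have "lborel = distr lborel borel ?f"
    proof (rule lborel_eqI)
      fix l u :: "real^'n" assume lu: "\<And>b. b \<in> Basis \<Longrightarrow> l \<bullet> b \<le> u \<bullet> b"
      have lu': "l $ i \<le> u $ i" for i using lu[of "axis i 1"] by (simp add: inner_axis)
      have "?f -` box l u = box (?f l) (?f u)"
      proof -
        have "(\<forall>i. l $ i < x $ ?\<tau> i \<and> x $ ?\<tau> i < u $ i) \<longleftrightarrow> (\<forall>i. l $ ?\<tau> i < x $ i \<and> x $ i < u $ ?\<tau> i)" for x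
          by (metis transpose_involutory)
        then show ?thesis by (auto simp: mem_box_cart)
      qed
      then have "emeasure (distr lborel borel ?f) (box l u) = emeasure lborel (box (?f l) (?f u))"
        using mf by (subst emeasure_distr) auto
      also have "\<dots> = ennreal (\<Prod>b\<in>Basis. (?f u - ?f l) \<bullet> b)"
        using lu' by (subst emeasure_lborel_box) (auto simp: Basis_vec_def inner_axis)
      also have "(\<Prod>b\<in>Basis. (?f u - ?f l) \<bullet> b) = (\<Prod>i\<in>UNIV. u $ ?\<tau> i - l $ ?\<tau> i)"
        by (simp add: prod_Basis_cart inner_axis)
      also have "\<dots> = (\<Prod>i\<in>UNIV. u $ i - l $ i)"
        by (rule prod.reindex_bij_betw[of ?\<tau> UNIV UNIV "\<lambda>i. u $ i - l $ i"]) simp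
      also have "\<dots> = (\<Prod>b\<in>Basis. (u - l) \<bullet> b)"
        by (simp add: prod_Basis_cart inner_axis)
      finally show "emeasure (distr lborel borel ?f) (box l u) = ennreal (\<Prod>b\<in>Basis. (u - l) \<bullet> b)" .
    qed simp
    then have "(\<integral>\<^sup>+x. g x \<partial>lborel) = ennreal 1 * (\<integral>\<^sup>+x. g (?f x) \<partial>lborel)" if "g \<in> borel_measurable borel" for g
      using nn_integral_distr[of ?f lborel borel g] mf that by simp
    then show "inj ?f \<longrightarrow> ?P ?f" using zero_less_one by blast
  next
    fix m n :: 'n assume mn: "m \<noteq> n"
    let ?f = "\<lambda>x :: real^'n. \<chi> i. if i = m then x $ m + x $ n else x $ i"
    let ?e = "\<lambda>i. axis i 1 :: real^'n"
    let ?A = "Basis - {?e m}"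
    let ?\<Sigma> = "\<lambda>w :: real^'n \<Rightarrow> real. \<Sum>b\<in>Basis. w b *\<^sub>R b"
    have B: "Basis = insert (?e m) ?A" by (auto simp: Basis_vec_def)
    have en: "?e n \<in> ?A" using mn by (auto simp: Basis_vec_def axis_eq_axis)
    have lin: "linear ?f" by (rule linearI) (auto simp: vec_eq_iff algebra_simps)
    have mf: "?f \<in> borel_measurable borel"
      using lin by (intro borel_measurable_continuous_onI linear_continuous_on linear_conv_bounded_linear[THEN iffD1])
    have nth: "?\<Sigma> w $ i = w (?e i)" for w i
    proof -
      have "?\<Sigma> w $ i = ?\<Sigma> w \<bullet> ?e i" by (simp add: inner_axis)
      also have "\<dots> = w (?e i)" by (rule inner_sum_left_Basis) auto
      finally show ?thesis .
    qed
    have f\<Sigma>: "?f (?\<Sigma> (w(?e m := y))) = ?\<Sigma> (w(?e m := y + w (?e n)))" for w y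
      by (rule vec_eq_iff[THEN iffD2]) (use mn in \<open>simp only: vec_lambda_beta nth fun_upd_apply axis_eq_axis, auto\<close>)
    interpret product_sigma_finite "\<lambda>_ :: real^'n. lborel :: real measure" by standard
    have "(\<integral>\<^sup>+x. g (?f x) \<partial>lborel) = (\<integral>\<^sup>+x. g x \<partial>lborel)" if g[measurable]: "g \<in> borel_measurable borel" for g
    proof -
      let ?M = "\<lambda>A. PiM A (\<lambda>_. lborel) :: ((real^'n) \<Rightarrow> real) measure"
      \<comment> \<open>Fubini with the coordinate m innermost, where the shear is a translation by
        the coordinate n.\<close>
      have split: "(\<integral>\<^sup>+x. h x \<partial>lborel) = (\<integral>\<^sup>+w. \<integral>\<^sup>+y. h (?\<Sigma> (w(?e m := y))) \<partial>lborel \<partial>?M ?A)"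
        if h[measurable]: "h \<in> borel_measurable borel" for h :: "real^'n \<Rightarrow> ennreal"
      proof -
        have "(\<integral>\<^sup>+x. h x \<partial>lborel) = (\<integral>\<^sup>+w. h (?\<Sigma> w) \<partial>?M Basis)"
          by (subst lborel_eq, subst nn_integral_distr) auto
        also have "\<dots> = (\<integral>\<^sup>+w. h (?\<Sigma> w) \<partial>?M (insert (?e m) ?A))"
          by (subst B) (rule refl)
        also have "\<dots> = (\<integral>\<^sup>+w. \<integral>\<^sup>+y. h (?\<Sigma> (w(?e m := y))) \<partial>lborel \<partial>?M ?A)"
          by (rule product_nn_integral_insert) (auto simp flip: B)
        finally show ?thesis .
      qed
      have "(\<integral>\<^sup>+x. g (?f x) \<partial>lborel) = (\<integral>\<^sup>+w. \<integral>\<^sup>+y. g (?\<Sigma> (w(?e m := y + w (?e n)))) \<partial>lborel \<partial>?M ?A)"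
        using measurable_compose[OF mf g] by (subst split) (auto simp: f\<Sigma>)
      also have "\<dots> = (\<integral>\<^sup>+w. \<integral>\<^sup>+y. g (?\<Sigma> (w(?e m := y))) \<partial>lborel \<partial>?M ?A)"
      proof (rule nn_integral_cong)
        fix w :: "real^'n \<Rightarrow> real"
        have [measurable]: "(\<lambda>y. g (?\<Sigma> (w(?e m := y)))) \<in> borel_measurable borel"
        proof -
          have "(\<lambda>y. ?\<Sigma> (w(?e m := y))) = (\<lambda>y. \<Sum>b\<in>Basis. (if b = ?e m then y else w b) *\<^sub>R b)"
            by (intro ext sum.cong) auto
          also have "\<dots> \<in> borel_measurable borel" by measurable
          finally show ?thesis by measurable
        qed
        show "(\<integral>\<^sup>+y. g (?\<Sigma> (w(?e m := y + w (?e n)))) \<partial>lborel) = (\<integral>\<^sup>+y. g (?\<Sigma> (w(?e m := y))) \<partial>lborel)"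
          using nn_integral_real_affine[of "\<lambda>y. g (?\<Sigma> (w(?e m := y)))" 1 "w (?e n)"] by (simp add: add.commute)
      qed
      also have "\<dots> = (\<integral>\<^sup>+x. g x \<partial>lborel)" by (rule split[OF g, symmetric])
      finally show ?thesis .
    qed
    then have "(\<integral>\<^sup>+x. g x \<partial>lborel) = ennreal 1 * (\<integral>\<^sup>+x. g (?f x) \<partial>lborel)" if "g \<in> borel_measurable borel" for g
      using that by simp
    then show "inj ?f \<longrightarrow> ?P ?f" using zero_less_one by blast
  qed
  with assms(2) show ?thesis by blast
qed

section \<open>Moments of simplices\<close>

lemma prod_UNIV_option: "(\<Prod>k\<in>UNIV. f k) = f None * (\<Prod>l\<in>(UNIV :: 'd::finite set). f (Some l))"
  by (simp add: UNIV_option_conv prod.reindex)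

lemma sum_UNIV_option: "(\<Sum>k\<in>UNIV. f k) = f None + (\<Sum>l\<in>(UNIV :: 'd::finite set). f (Some l))"
  by (simp add: UNIV_option_conv sum.reindex)

section \<open>The uniform distribution on the standard simplex\<close>

definition std_uniform :: "(real^'d::finite) measure"
  where "std_uniform = uniform_measure lborel (convex hull (insert 0 Basis))"

definition bary :: "real^'d::finite \<Rightarrow> 'd option \<Rightarrow> real"
  where "bary w k = (case k of None \<Rightarrow> 1 - (\<Sum>l\<in>UNIV. w $ l) | Some l \<Rightarrow> w $ l)"

lemma compact_std: "compact (convex hull (insert 0 Basis) :: (real^'d::finite) set)"
  by (intro finite_imp_compact_convex_hull) simp

lemma sets_std [measurable]: "(convex hull (insert 0 Basis) :: (real^'d::finite) set) \<in> sets borel"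
  by (intro borel_closed compact_imp_closed compact_std)

lemma in_std_iff: "w \<in> convex hull (insert 0 Basis) \<longleftrightarrow> (\<forall>k. bary w k \<ge> 0)" for w :: "real^'d::finite"
  by (simp add: std_simplex sum_Basis_cart bary_def split: option.splits)
     (auto simp: Basis_vec_def inner_axis)

lemma emeasure_std: "emeasure lborel (convex hull (insert 0 Basis) :: (real^'d::finite) set) = ennreal (1 / fact CARD('d))"
  using emeasure_std_simplex[where 'a = "real^'d"] by simp

lemma sets_std_uniform [measurable_cong]: "sets std_uniform = sets borel"
  by (simp add: std_uniform_def)

lemma space_std_uniform [simp]: "space std_uniform = UNIV"
  by (simp add: std_uniform_def)

lemma borel_measurable_bary [measurable]: "(\<lambda>w. bary w k) \<in> borel_measurable borel"
  by (cases k) (simp_all add: bary_def)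

lemma AE_std_uniform: "(\<And>w. w \<in> convex hull (insert 0 Basis) \<Longrightarrow> P w) \<Longrightarrow> AE w in std_uniform. P w"
  unfolding std_uniform_def
  by (rule AE_uniform_measureI) (auto simp: emeasure_std)

text \<open>The moments of the flat Dirichlet distribution; the factor d! is the reciprocal of the
  volume of the standard simplex.\<close>

lemma dirichlet_expectation:
  fixes a :: "'d::finite option \<Rightarrow> nat"
  shows "has_bochner_integral std_uniform (\<lambda>w. \<Prod>k\<in>UNIV. bary w k ^ a k)
    (fact CARD('d) * (\<Prod>k\<in>UNIV. fact (a k)) / fact (CARD('d) + sum a UNIV))"
proof (rule has_bochner_integral_nn_integral)
  let ?D = "convex hull (insert 0 Basis) :: (real^'d) set"
  define k where "k b = a (Some (SOME i. b = axis i 1))" for b :: "real^'d"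
  have ka: "k (axis i 1) = a (Some i)" for i by (simp add: k_def axis_eq_axis)
  have "(\<integral>\<^sup>+w. ennreal (\<Prod>k\<in>UNIV. bary w k ^ a k) \<partial>std_uniform) =
    (\<integral>\<^sup>+w. ennreal (\<Prod>k\<in>UNIV. bary w k ^ a k) * indicator ?D w \<partial>lborel) / emeasure lborel ?D"
    unfolding std_uniform_def by (rule nn_integral_uniform_measure) auto
  also have "(\<integral>\<^sup>+w. ennreal (\<Prod>k\<in>UNIV. bary w k ^ a k) * indicator ?D w \<partial>lborel) =
    (\<integral>\<^sup>+x. ennreal ((\<Prod>i\<in>Basis. (x \<bullet> i) ^ k i) * (1 - (\<Sum>i\<in>Basis. x \<bullet> i)) ^ a None) * indicator ?D x \<partial>lborel)"
    by (simp add: prod_UNIV_option bary_def prod_Basis_cart sum_Basis_cart inner_axis ka mult_ac)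
  also have "\<dots> = ennreal ((\<Prod>i\<in>Basis. fact (k i)) * fact (a None) / fact (a None + DIM(real^'d) + sum k Basis))"
    by (rule nn_integral_dirichlet)
  also have "(\<Prod>i\<in>Basis. fact (k i)) * fact (a None) / fact (a None + DIM(real^'d) + sum k Basis) =
     (\<Prod>k\<in>UNIV. fact (a k)) / (fact (CARD('d) + sum a UNIV) :: real)"
    by (simp add: prod_UNIV_option sum_UNIV_option prod_Basis_cart sum_Basis_cart ka ac_simps)
  also have "ennreal \<dots> / emeasure lborel ?D =
    ennreal (fact CARD('d) * (\<Prod>k\<in>UNIV. fact (a k)) / fact (CARD('d) + sum a UNIV))"
    unfolding emeasure_std
    by (subst divide_ennreal) (auto intro!: divide_nonneg_nonneg prod_nonneg simp: mult_ac)
  finally show "(\<integral>\<^sup>+w. ennreal (\<Prod>k\<in>UNIV. bary w k ^ a k) \<partial>std_uniform) = \<dots>" .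
  show "AE w in std_uniform. 0 \<le> (\<Prod>k\<in>UNIV. bary w k ^ a k)"
    by (rule AE_std_uniform) (auto simp: in_std_iff intro!: prod_nonneg)
qed (auto intro!: divide_nonneg_nonneg mult_nonneg_nonneg prod_nonneg)

lemma finite_measure_std_uniform: "finite_measure (std_uniform :: (real^'d::finite) measure)"
proof (rule finite_measureI)
  have "emeasure std_uniform (UNIV :: (real^'d) set) = ennreal (1 / fact CARD('d)) / ennreal (1 / fact CARD('d))"
    unfolding std_uniform_def by (subst emeasure_uniform_measure) (auto simp: emeasure_std)
  then show "emeasure std_uniform (space (std_uniform :: (real^'d) measure)) \<noteq> \<infinity>"
    by (simp add: divide_ennreal)
qed

lemma integrable_std_uniform:
  fixes f :: "real^'d::finite \<Rightarrow> real"
  assumes "continuous_on UNIV f"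
  shows "integrable std_uniform f"
proof -
  interpret finite_measure "std_uniform :: (real^'d) measure" by (rule finite_measure_std_uniform)
  have "compact (f ` (convex hull (insert 0 Basis)))"
    using assms by (intro compact_continuous_image compact_std) (auto intro: continuous_on_subset)
  then obtain B where "\<And>w. w \<in> convex hull (insert 0 Basis) \<Longrightarrow> norm (f w) \<le> B"
    using compact_imp_bounded bounded_iff by (metis imageI)
  then have "AE w in std_uniform. norm (f w) \<le> B" by (intro AE_std_uniform)
  moreover have "f \<in> borel_measurable std_uniform"
    using borel_measurable_continuous_onI[OF assms] by measurable
  ultimately show ?thesis by (rule integrable_const_bound)
qed

section \<open>Arbitrary simplices as affine images of the standard one\<close>

definition bary_map :: "real^'d^('d option) \<Rightarrow> real^'d \<Rightarrow> real^'d::finite"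
  where "bary_map X w = (\<Sum>k\<in>UNIV. bary w k *\<^sub>R X $ k)"

text \<open>The linear part of \<open>bary_map\<close>, kept apart from the translation because the
  scaling of volumes is stated for linear maps.\<close>

definition edge_map :: "real^'d^('d option) \<Rightarrow> real^'d \<Rightarrow> real^'d::finite"
  where "edge_map X w = (\<Sum>l\<in>UNIV. w $ l *\<^sub>R (X $ Some l - X $ None))"

lemma bary_map_eq: "bary_map X w = X $ None + edge_map X w"
  by (simp add: bary_map_def edge_map_def bary_def sum_UNIV_option scaleR_diff_right sum_subtractf
    scaleR_left_diff_distrib scaleR_sum_left)

lemma linear_edge_map: "linear (edge_map X)"
  unfolding edge_map_def
  by (rule linearI) (auto simp: scaleR_left_distrib sum.distrib scaleR_sum_right)

lemma bary_map_nth: "bary_map X w $ l = (\<Sum>k\<in>UNIV. bary w k * X $ k $ l)"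
  by (simp add: bary_map_def)

lemma image_bary_map: "bary_map X ` (convex hull (insert 0 Basis)) = simplex_of X"
proof -
  have e: "bary_map X = (\<lambda>w. X $ None + w) \<circ> edge_map X" by (auto simp: bary_map_eq)
  have ax: "edge_map X (axis l 1) = X $ Some l - X $ None" for l
  proof -
    have "edge_map X (axis l 1) = (\<Sum>i\<in>UNIV. if i = l then X $ Some i - X $ None else 0)"
      unfolding edge_map_def by (intro sum.cong refl) (simp add: axis_def)
    then show ?thesis by simp
  qed
  have "bary_map X ` insert 0 Basis = insert (X $ None) (range (\<lambda>l. X $ Some l))"
    unfolding Basis_cart(1) image_insert image_image bary_map_eq ax
    by (simp add: linear_0[OF linear_edge_map])
  also have "\<dots> = range (\<lambda>k. X $ k)"
    by (auto simp: UNIV_option_conv)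
  finally have v: "bary_map X ` insert 0 Basis = range (\<lambda>k. X $ k)" .
  have "bary_map X ` (convex hull (insert 0 Basis)) = (\<lambda>w. X $ None + w) ` (convex hull (edge_map X ` insert 0 Basis))"
    unfolding e image_comp[symmetric] convex_hull_linear_image[OF linear_edge_map] ..
  also have "\<dots> = convex hull ((\<lambda>w. X $ None + w) ` edge_map X ` insert 0 Basis)"
    by (rule convex_hull_translation[symmetric])
  finally show ?thesis using v by (simp add: e image_comp simplex_of_def)
qed

text \<open>The hypothesis only provides some d + 1 affinely independent points with the same hull.
  They are extreme, hence rows of X, and by counting they are all the rows. A kernel vector of the
  edge map, completed to sum 0, would be an affine dependence between them.\<close>

lemma inj_edge_map:
  fixes X :: "real^'d::finite^('d option)"
  assumes "int CARD('d) simplex simplex_of X"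
  shows "inj (edge_map X)"
proof -
  obtain C where C: "\<not> affine_dependent C" "int (card C) = int CARD('d) + 1" "simplex_of X = convex hull C"
    using assms unfolding simplex_def by auto
  have "C \<subseteq> range (\<lambda>k. X $ k)"
  proof
    fix x assume "x \<in> C"
    then have "x extreme_point_of (convex hull C)"
      using extreme_point_of_convex_hull_affine_independent[OF C(1)] by blast
    then have "x extreme_point_of (convex hull (range (\<lambda>k. X $ k)))" using C(3) by (simp add: simplex_of_def)
    then show "x \<in> range (\<lambda>k. X $ k)" by (rule extreme_point_of_convex_hull)
  qed
  moreover have le: "card (range (\<lambda>k. X $ k)) \<le> CARD('d option)" by (rule card_image_le) simp
  ultimately have CX: "C = range (\<lambda>k. X $ k)"
    using C(2) by (intro card_seteq) auto
  then have injX: "inj (\<lambda>k. X $ k)"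
    using C(2) by (intro eq_card_imp_inj_on) auto
  have "w = 0" if w: "edge_map X w = 0" for w
  proof (rule ccontr)
    assume "w \<noteq> 0"
    define b where "b k = (case k of None \<Rightarrow> - (\<Sum>l\<in>UNIV. w $ l) | Some l \<Rightarrow> w $ l)" for k
    define U where "U v = b (the_inv (\<lambda>k. X $ k) v)" for v
    have U: "U (X $ k) = b k" for k using the_inv_f_f[OF injX, of k] by (simp add: U_def)
    obtain l where "w $ l \<noteq> 0" using \<open>w \<noteq> 0\<close> by (auto simp: vec_eq_iff)
    then have "U (X $ Some l) \<noteq> 0" "X $ Some l \<in> C" by (auto simp: U b_def CX)
    moreover have "sum U C = 0"
      unfolding CX by (simp add: sum.reindex[OF injX] U sum_UNIV_option b_def)
    moreover have "(\<Sum>v\<in>C. U v *\<^sub>R v) = edge_map X w"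
      unfolding CX
      by (simp add: sum.reindex[OF injX] U sum_UNIV_option b_def edge_map_def scaleR_diff_right sum_subtractf
        scaleR_sum_left)
    ultimately have "affine_dependent C"
      using w by (subst affine_dependent_explicit_finite) (auto simp: CX)
    with C(1) show False by blast
  qed
  then show ?thesis using linear_injective_0[OF linear_edge_map] by blast
qed

lemma uniform_measure_simplex:
  fixes X :: "real^'d::finite^('d option)"
  assumes X: "int CARD('d) simplex simplex_of X"
  shows "uniform_measure lborel (simplex_of X) = distr std_uniform borel (bary_map X)"
proof -
  let ?D = "convex hull (insert 0 Basis) :: (real^'d) set"
  have inj: "inj (bary_map X)" using inj_edge_map[OF X] by (auto simp: bary_map_eq inj_def)
  obtain c where c: "c > 0" "\<And>g. g \<in> borel_measurable borel \<Longrightarrow> (\<integral>\<^sup>+x. g x \<partial>lborel) = ennreal c * (\<integral>\<^sup>+x. g (edge_map X x) \<partial>lborel)"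
    using lborel_linear_scaling[OF linear_edge_map inj_edge_map[OF X]] by blast
  have me [measurable]: "edge_map X \<in> borel_measurable borel"
    using linear_edge_map[of X]
    by (intro borel_measurable_continuous_onI linear_continuous_on linear_conv_bounded_linear[THEN iffD1])
  have mb [measurable]: "bary_map X \<in> borel_measurable borel"
    unfolding bary_map_eq[abs_def] by measurable
  have scale: "emeasure lborel B = ennreal c * emeasure lborel (bary_map X -` B)" if B[measurable]: "B \<in> sets borel" for B
  proof -
    have "emeasure lborel B = (\<integral>\<^sup>+x. indicator B x \<partial>distr lborel borel ((+) (X $ None)))"
      by (simp add: lborel_distr_plus)
    also have "\<dots> = (\<integral>\<^sup>+x. indicator B (X $ None + x) \<partial>lborel)"
      by (subst nn_integral_distr) auto
    also have "\<dots> = ennreal c * (\<integral>\<^sup>+x. indicator B (X $ None + edge_map X x) \<partial>lborel)"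
      by (rule c(2)) measurable
    also have "(\<integral>\<^sup>+x. indicator B (X $ None + edge_map X x) \<partial>lborel) = (\<integral>\<^sup>+x. indicator (bary_map X -` B) x \<partial>lborel)"
      by (intro nn_integral_cong) (auto simp: indicator_def bary_map_eq)
    also have "\<dots> = emeasure lborel (bary_map X -` B)"
      using measurable_sets[OF mb B] by (subst nn_integral_indicator) auto
    finally show ?thesis .
  qed
  have S: "simplex_of X \<in> sets borel"
    unfolding simplex_of_def by (intro borel_closed compact_imp_closed finite_imp_compact_convex_hull) simp
  have vS: "bary_map X -` simplex_of X = ?D"
    using image_bary_map[of X] inj by (metis inj_vimage_image_eq)
  show ?thesis
  proof (rule measure_eqI)
    fix A assume "A \<in> sets (uniform_measure lborel (simplex_of X))"
    then have A[measurable]: "A \<in> sets borel" by simp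
    have mA: "bary_map X -` A \<in> sets borel" using measurable_sets[OF mb A] by simp
    have "emeasure (uniform_measure lborel (simplex_of X)) A =
       emeasure lborel (simplex_of X \<inter> A) / emeasure lborel (simplex_of X)"
      using S A by (intro emeasure_uniform_measure) auto
    also have "\<dots> = (ennreal c * emeasure lborel (?D \<inter> bary_map X -` A)) / (ennreal c * emeasure lborel ?D)"
      using S A by (subst (1 2) scale) (auto simp: vS)
    \<comment> \<open>The anonymous scaling factor cancels: it is positive and finite, and so is the
      volume of the standard simplex.\<close>
    also have "\<dots> = emeasure lborel (?D \<inter> bary_map X -` A) / emeasure lborel ?D"
    proof -
      have "emeasure lborel (?D \<inter> bary_map X -` A) \<le> emeasure lborel ?D"
        by (intro emeasure_mono) auto
      then have "emeasure lborel (?D \<inter> bary_map X -` A) < \<infinity>"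
        unfolding emeasure_std by (metis ennreal_less_top infinity_ennreal_def order_le_less_trans)
      then obtain r where "emeasure lborel (?D \<inter> bary_map X -` A) = ennreal r" "r \<ge> 0"
        by (cases "emeasure lborel (?D \<inter> bary_map X -` A)") auto
      then show ?thesis
        using c(1) unfolding emeasure_std
        by (simp add: ennreal_mult[symmetric] divide_ennreal)
    qed
    also have "\<dots> = emeasure std_uniform (bary_map X -` A)"
      unfolding std_uniform_def using mA by (intro emeasure_uniform_measure[symmetric]) auto
    also have "\<dots> = emeasure (distr std_uniform borel (bary_map X)) A"
      by (subst emeasure_distr) auto
    finally show "emeasure (uniform_measure lborel (simplex_of X)) A = \<dots>" .
  qed simp
qed

lemma continuous_bary_map_nth: "continuous_on UNIV (\<lambda>w. bary_map X w $ l)"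
proof -
  have "continuous_on UNIV (\<lambda>w :: real^'d. bary w k)" for k :: "'d::finite option"
    unfolding bary_def by (cases k) (auto intro!: continuous_intros)
  then show ?thesis unfolding bary_map_nth by (intro continuous_intros)
qed

lemma moment_eq:
  fixes X :: "real^'d::finite^('d option)"
  assumes "int CARD('d) simplex simplex_of X"
  shows "moment I X = (\<integral>w. (\<Prod>l\<in>UNIV. (bary_map X w $ l) ^ Poly_Mapping.lookup I l) \<partial>std_uniform)"
proof -
  have m: "bary_map X \<in> borel_measurable borel"
    by (intro borel_measurable_continuous_onI continuous_on_componentwise[THEN iffD2])
       (auto simp: Basis_vec_def inner_axis continuous_bary_map_nth)
  show ?thesis
    unfolding moment_def uniform_measure_simplex[OF assms] using m
    by (subst integral_distr) (auto simp: measurable_cong_sets[OF sets_std_uniform])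
qed

section \<open>The generating function of the moments\<close>

lemma bij_lookup: "bij (Poly_Mapping.lookup :: ('d::finite \<Rightarrow>\<^sub>0 nat) \<Rightarrow> 'd \<Rightarrow> nat)"
proof (rule bijI)
  show "inj (Poly_Mapping.lookup :: ('d \<Rightarrow>\<^sub>0 nat) \<Rightarrow> 'd \<Rightarrow> nat)" by (simp add: inj_def Poly_Mapping.lookup_inject)
  show "surj (Poly_Mapping.lookup :: ('d \<Rightarrow>\<^sub>0 nat) \<Rightarrow> 'd \<Rightarrow> nat)"
    by (rule surjI[of _ Abs_poly_mapping]) (simp add: lookup_Abs_poly_mapping)
qed

lemma sum_exponents: "(\<Sum>a | sum a UNIV = N. f a) = (\<Sum>I | mdeg I = N. f (Poly_Mapping.lookup (I :: 'd::finite \<Rightarrow>\<^sub>0 nat)))"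
proof (rule sum.reindex_bij_betw[symmetric])
  show "bij_betw Poly_Mapping.lookup {I :: 'd \<Rightarrow>\<^sub>0 nat. mdeg I = N} {a. sum a UNIV = N}"
  proof (rule bij_betw_subset[OF bij_lookup])
    show "Poly_Mapping.lookup ` {I :: 'd \<Rightarrow>\<^sub>0 nat. mdeg I = N} = {a. sum a UNIV = N}"
    proof (intro equalityI subsetI)
      fix a :: "'d \<Rightarrow> nat" assume "a \<in> {a. sum a UNIV = N}"
      moreover obtain I where "a = Poly_Mapping.lookup I" using bij_is_surj[OF bij_lookup] by (metis surjD)
      ultimately show "a \<in> Poly_Mapping.lookup ` {I. mdeg I = N}" by (auto simp: mdeg_UNIV)
    qed (auto simp: mdeg_UNIV)
  qed simp
qed

lemma finite_mdeg: "finite {I :: 'd::finite \<Rightarrow>\<^sub>0 nat. mdeg I = N}"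
proof -
  have "{I :: 'd \<Rightarrow>\<^sub>0 nat. mdeg I = N} = Poly_Mapping.lookup -` {a. sum a UNIV = N}"
    by (auto simp: mdeg_UNIV)
  then show ?thesis
    using finite_vimageI[OF finite_compositions bij_is_inj[OF bij_lookup]] by simp
qed

definition moment_factor :: "('d::finite \<Rightarrow>\<^sub>0 nat) \<Rightarrow> 'r::field_char_0"
  where "moment_factor I = of_nat (fact (mdeg I + CARD('d))) /
     of_nat ((\<Prod>l\<in>UNIV. fact (Poly_Mapping.lookup I l)) * fact CARD('d))"

text \<open>The complete homogeneous symmetric polynomial of degree N in the linear forms with coefficients
  \<^term>\<open>X k\<close>.\<close>

definition hsym :: "nat \<Rightarrow> ('k::finite \<Rightarrow> 'd::finite \<Rightarrow> 'r::comm_ring_1) \<Rightarrow> ('d, 'r) mpol"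
  where "hsym N X = (\<Sum>a | sum a UNIV = N. \<Prod>k\<in>UNIV. (\<Sum>l\<in>UNIV. mconst (X k l) * mvar l) ^ a k)"

lemma msubst_hsym:
  "rhom g \<Longrightarrow> msubst g t (hsym N X) = (\<Sum>a | sum a UNIV = N. \<Prod>k\<in>UNIV. (\<Sum>l\<in>UNIV. g (X k l) * t l) ^ a k)"
  by (simp add: hsym_def rhom_simps[OF rhom_msubst] msubst_mconst msubst_mvar)

text \<open>The expectation of (t . w)^N is expanded twice. In barycentric coordinates the Dirichlet
  expectations cancel the multinomial coefficients and leave the complete symmetric polynomial in
  the x_k . t, up to N! d! / (N + d)!. In the coordinates of w the moments appear.\<close>

lemma moment_generating_function:
  fixes X :: "real^'d::finite^('d option)"
  assumes X: "int CARD('d) simplex simplex_of X"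
  shows "(\<Sum>I | mdeg I = N. moment_factor I * moment I X * (\<Prod>l\<in>UNIV. t l ^ Poly_Mapping.lookup I l)) =
    meval t (hsym N (\<lambda>k l. X $ k $ l))"
proof -
  let ?d = "CARD('d)"
  define y where "y k = (\<Sum>l\<in>UNIV. X $ k $ l * t l)" for k
  define g where "g w = (\<Sum>l\<in>UNIV. t l * bary_map X w $ l) ^ N" for w
  have "g w = (\<Sum>k\<in>UNIV. bary w k * y k) ^ N" for w
    unfolding g_def bary_map_nth y_def sum_distrib_left
    by (subst sum.swap) (simp add: mult_ac)
  then have g1: "g w = (\<Sum>a | sum a UNIV = N. (fact N / (\<Prod>k\<in>UNIV. fact (a k)) * (\<Prod>k\<in>UNIV. y k ^ a k)) * (\<Prod>k\<in>UNIV. bary w k ^ a k))" for w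
    by (simp add: multinomial_theorem_UNIV power_mult_distrib prod.distrib mult_ac)
  have "has_bochner_integral std_uniform g (\<Sum>a | sum a UNIV = N. (fact N / (\<Prod>k\<in>UNIV. fact (a k)) * (\<Prod>k\<in>UNIV. y k ^ a k)) *
     (fact ?d * (\<Prod>k\<in>UNIV. fact (a k)) / fact (?d + sum a UNIV)))"
    unfolding g1[abs_def]
    by (intro has_bochner_integral_sum has_bochner_integral_mult_right dirichlet_expectation)
  then have "integral\<^sup>L std_uniform g = (\<Sum>a | sum a UNIV = N. (fact N / (\<Prod>k\<in>UNIV. fact (a k)) * (\<Prod>k\<in>UNIV. y k ^ a k)) *
     (fact ?d * (\<Prod>k\<in>UNIV. fact (a k)) / fact (?d + sum a UNIV)))"
    by (rule has_bochner_integral_integral_eq)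
  also have "\<dots> = (\<Sum>a | sum a UNIV = N. fact N * fact ?d / fact (?d + N) * (\<Prod>k\<in>UNIV. y k ^ a k))"
  proof (intro sum.cong refl)
    fix a :: "'d option \<Rightarrow> nat" assume "a \<in> {a. sum a UNIV = N}"
    moreover have "(\<Prod>k\<in>UNIV. fact (a k)) \<noteq> (0 :: real)" by simp
    ultimately show "(fact N / (\<Prod>k\<in>UNIV. fact (a k)) * (\<Prod>k\<in>UNIV. y k ^ a k)) *
     (fact ?d * (\<Prod>k\<in>UNIV. fact (a k)) / fact (?d + sum a UNIV)) = fact N * fact ?d / fact (?d + N) * (\<Prod>k\<in>UNIV. y k ^ a k)"
      by (simp add: field_simps)
  qed
  also have "\<dots> = fact N * fact ?d / fact (?d + N) * meval t (hsym N (\<lambda>k l. X $ k $ l))"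
    by (simp add: msubst_hsym[OF rhom_id] y_def sum_distrib_left)
  finally have 1: "integral\<^sup>L std_uniform g = \<dots>" .
  have g2: "g w = (\<Sum>I | mdeg I = N. (fact N / (\<Prod>l\<in>UNIV. fact (Poly_Mapping.lookup I l)) * (\<Prod>l\<in>UNIV. t l ^ Poly_Mapping.lookup I l)) *
      (\<Prod>l\<in>UNIV. (bary_map X w $ l) ^ Poly_Mapping.lookup I l))" for w
    unfolding g_def multinomial_theorem_UNIV sum_exponents
    by (simp add: power_mult_distrib prod.distrib mult_ac)
  have int: "integrable std_uniform (\<lambda>w. c * (\<Prod>l\<in>UNIV. (bary_map X w $ l) ^ Poly_Mapping.lookup I l))" for I c
    by (intro integrable_std_uniform continuous_intros continuous_bary_map_nth)
  have 2: "integral\<^sup>L std_uniform g = (\<Sum>I | mdeg I = N. (fact N / (\<Prod>l\<in>UNIV. fact (Poly_Mapping.lookup I l)) * (\<Prod>l\<in>UNIV. t l ^ Poly_Mapping.lookup I l)) * moment I X)"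
    unfolding g2[abs_def] moment_eq[OF X]
    by (subst Bochner_Integration.integral_sum, rule int) simp
  have "(\<Sum>I | mdeg I = N. moment_factor I * moment I X * (\<Prod>l\<in>UNIV. t l ^ Poly_Mapping.lookup I l)) =
     fact (?d + N) / (fact N * fact ?d) * integral\<^sup>L std_uniform g"
    unfolding 2 sum_distrib_left
  proof (intro sum.cong refl)
    fix I :: "'d \<Rightarrow>\<^sub>0 nat" assume "I \<in> {I. mdeg I = N}"
    then show "moment_factor I * moment I X * (\<Prod>l\<in>UNIV. t l ^ Poly_Mapping.lookup I l) =
      fact (?d + N) / (fact N * fact ?d) * (fact N / (\<Prod>l\<in>UNIV. fact (Poly_Mapping.lookup I l)) * (\<Prod>l\<in>UNIV. t l ^ Poly_Mapping.lookup I l) * moment I X)"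
      by (simp add: moment_factor_def add.commute mult_ac)
  qed
  also have "\<dots> = meval t (hsym N (\<lambda>k l. X $ k $ l))" unfolding 1 by simp
  finally show ?thesis .
qed

lemma moment_lookup_hsym:
  fixes X :: "real^'d::finite^('d option)"
  assumes X: "int CARD('d) simplex simplex_of X"
  shows "moment_factor I * moment I X = Poly_Mapping.lookup (hsym (mdeg I) (\<lambda>k l. X $ k $ l)) I"
proof -
  define P where "P = (\<Sum>J | mdeg J = mdeg I. Poly_Mapping.single J (moment_factor J * moment J X))"
  have "meval t P = meval t (hsym (mdeg I) (\<lambda>k l. X $ k $ l))" for t
    unfolding moment_generating_function[OF X, symmetric] P_def
    by (simp add: msubst_sum[OF rhom_id] msubst_single[OF rhom_id] mmon_UNIV)
  then have "P = hsym (mdeg I) (\<lambda>k l. X $ k $ l)" by (rule mpol_eq_if_meval_eq)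
  moreover have "Poly_Mapping.lookup P I = moment_factor I * moment I X"
    by (simp add: P_def lookup_sum lookup_single when_def finite_mdeg)
  ultimately show ?thesis by simp
qed

section \<open>Hilbert's Nullstellensatz\<close>

lemma module_times: "module ((*) :: 'a::comm_ring_1 \<Rightarrow> 'a \<Rightarrow> 'a)"
  by unfold_locales (auto simp: algebra_simps)

definition ideal_set :: "'a::comm_ring_1 set \<Rightarrow> bool"
  where "ideal_set J \<longleftrightarrow> 0 \<in> J \<and> (\<forall>x\<in>J. \<forall>y\<in>J. x + y \<in> J) \<and> (\<forall>r. \<forall>x\<in>J. r * x \<in> J)"

lemma ideal_set_mideal: "ideal_set (mideal S)"
  unfolding ideal_set_def
  by (auto intro: module.span_zero[OF module_times] module.span_add[OF module_times]
    module.span_scale[OF module_times])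

lemma ideal_set_sum: "ideal_set J \<Longrightarrow> (\<And>x. x \<in> A \<Longrightarrow> f x \<in> J) \<Longrightarrow> sum f A \<in> J"
  by (induction A rule: infinite_finite_induct) (auto simp: ideal_set_def)

lemma ideal_set_diff: "ideal_set J \<Longrightarrow> x \<in> J \<Longrightarrow> y \<in> J \<Longrightarrow> x - y \<in> J"
  unfolding ideal_set_def by (metis diff_conv_add_uminus mult_minus1)

lemma mideal_vanish:
  assumes "F \<in> mideal S" "\<And>F. F \<in> S \<Longrightarrow> meval a F = 0"
  shows "meval a F = 0"
proof -
  have "mideal S \<subseteq> {F. meval a F = 0}"
    using assms(2)
    by (intro module.span_minimal[OF module_times] module.subspaceI[OF module_times])
       (auto simp: msubst_0 msubst_add[OF rhom_id] msubst_mult[OF rhom_id])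
  with assms(1) show ?thesis by auto
qed

text \<open>Gaussian elimination with more unknowns \<open>a t\<close> than equations: the pivot
  \<open>t0\<close> removes the equation b, and its own unknown is recovered as - s.\<close>

lemma underdetermined_system:
  fixes M :: "'t \<Rightarrow> 'b \<Rightarrow> 'a::field"
  assumes "finite B" "finite T" "card B < card T"
  shows "\<exists>a. (\<exists>t\<in>T. a t \<noteq> 0) \<and> (\<forall>b\<in>B. (\<Sum>t\<in>T. a t * M t b) = 0)"
  using assms
proof (induction B arbitrary: T M)
  case empty
  then obtain t where "t \<in> T" by fastforce
  then show ?case by (intro exI[of _ "\<lambda>_. 1"]) auto
next
  case (insert b B)
  show ?case
  proof (cases "\<forall>t\<in>T. M t b = 0")
    case True
    with insert.IH[of T M] insert.prems insert.hyps show ?thesis by auto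
  next
    case False
    then obtain t0 where t0: "t0 \<in> T" "M t0 b \<noteq> 0" by auto
    let ?M = "\<lambda>t c. M t c - M t b / M t0 b * M t0 c"
    have "card B < card (T - {t0})" using insert t0 by (simp add: card_Diff_singleton)
    then obtain a t1 where a: "t1 \<in> T - {t0}" "a t1 \<noteq> 0"
        "\<And>c. c \<in> B \<Longrightarrow> (\<Sum>t\<in>T - {t0}. a t * ?M t c) = 0"
      using insert.IH[of "T - {t0}" ?M] insert.prems by auto
    define s where "s = (\<Sum>t\<in>T - {t0}. a t * M t b) / M t0 b"
    define a' where "a' = a(t0 := - s)"
    have split: "(\<Sum>t\<in>T. a' t * M t c) = - s * M t0 c + (\<Sum>t\<in>T - {t0}. a t * M t c)" for c
      using insert.prems t0 by (subst sum.remove[of T t0]) (auto simp: a'_def intro!: sum.cong)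
    have "(\<Sum>t\<in>T. a' t * M t c) = 0" if "c \<in> insert b B" for c
    proof (cases "c = b")
      case True
      then show ?thesis using t0 by (simp add: split s_def)
    next
      case False
      with that a(3)[of c] show ?thesis
        by (simp add: split s_def sum_subtractf right_diff_distrib sum_divide_distrib sum_distrib_right
          sum_distrib_left mult_ac)
    qed
    moreover have "a' t1 \<noteq> 0" "t1 \<in> T" using a by (auto simp: a'_def)
    ultimately show ?thesis by blast
  qed
qed

lemma uncountable_fibre:
  fixes f :: "complex \<Rightarrow> 'b::countable"
  shows "\<exists>y. infinite {x. f x = y}"
proof (rule ccontr)
  assume "\<not> ?thesis"
  then have "countable (\<Union>y. {x. f x = y})"
    by (intro countable_UN) (auto intro: countable_finite)
  moreover have "(\<Union>y. {x. f x = y}) = UNIV" by auto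
  ultimately show False using uncountable_UNIV_complex by simp
qed

text \<open>The ideal is enlarged to an ideal P maximal among those without a power of h. Such a P is prime,
  and the uncountability of the field forces it to contain \<open>x\<^sub>i - c\<^sub>i\<close> for every i: otherwise each
  \<open>x\<^sub>i - c\<close> divides a power of h modulo P, uncountably many of the cofactors live in a space of finite
  dimension, and a linear dependence between them puts a nonzero polynomial in \<open>x\<^sub>i\<close> into P.\<close>

theorem nullstellensatz:
  fixes S :: "('v::finite, complex) mpol set"
  assumes van: "\<And>a. (\<And>F. F \<in> S \<Longrightarrow> meval a F = 0) \<Longrightarrow> meval a h = 0"
  shows "\<exists>N. h ^ N \<in> mideal S"
proof (rule ccontr)
  assume no: "\<not> ?thesis"
  define \<A> where "\<A> = {J. ideal_set J \<and> mideal S \<subseteq> J \<and> (\<forall>N. h ^ N \<notin> J)}"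
  have "mideal S \<in> \<A>" using no ideal_set_mideal by (auto simp: \<A>_def)
  moreover have "\<Union>C \<in> \<A>" if ne: "C \<noteq> {}" and "subset.chain \<A> C" for C
  proof -
    have C: "C \<subseteq> \<A>" "\<And>X Y. X \<in> C \<Longrightarrow> Y \<in> C \<Longrightarrow> X \<subseteq> Y \<or> Y \<subseteq> X"
      using that(2) by (auto simp: subset.chain_def)
    have "x + y \<in> \<Union>C" if "x \<in> \<Union>C" "y \<in> \<Union>C" for x y
    proof -
      from that obtain X Y where "X \<in> C" "Y \<in> C" "x \<in> X" "y \<in> Y" by auto
      with C(2)[of X Y] C(1) show ?thesis unfolding \<A>_def ideal_set_def by blast
    qed
    moreover obtain X where "X \<in> C" using ne by auto
    moreover have J: "ideal_set Y" "mideal S \<subseteq> Y" "\<And>N. h ^ N \<notin> Y" if "Y \<in> C" for Y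
      using C(1) that by (auto simp: \<A>_def)
    moreover have "r * x \<in> \<Union>C" if x: "x \<in> \<Union>C" for r x
    proof -
      obtain Y where "Y \<in> C" "x \<in> Y" using x by auto
      with J(1)[of Y] have "r * x \<in> Y" unfolding ideal_set_def by blast
      with \<open>Y \<in> C\<close> show ?thesis by blast
    qed
    moreover have "0 \<in> \<Union>C" using J(1) \<open>X \<in> C\<close> by (auto simp: ideal_set_def)
    ultimately have "ideal_set (\<Union>C)" by (simp add: ideal_set_def)
    then show ?thesis using J(2,3) \<open>X \<in> C\<close> by (auto simp: \<A>_def)
  qed
  ultimately obtain P where P: "P \<in> \<A>" and max: "\<And>X. X \<in> \<A> \<Longrightarrow> P \<subseteq> X \<Longrightarrow> X = P"
    using subset_Zorn_nonempty[of \<A>] by (metis empty_iff)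
  have iP: "ideal_set P" and SP: "mideal S \<subseteq> P" and hP: "\<And>N. h ^ N \<notin> P"
    using P by (auto simp: \<A>_def)
  have mulP: "r * x \<in> P" if "x \<in> P" for r x using iP that by (auto simp: ideal_set_def)
  have addP: "x + y \<in> P" if "x \<in> P" "y \<in> P" for x y using iP that by (auto simp: ideal_set_def)
  have diffP: "x - y \<in> P" if "x \<in> P" "y \<in> P" for x y using ideal_set_diff[OF iP that] .
  \<comment> \<open>By maximality the ideal P + (f) contains a power of h, so f divides a power of h
    modulo P.\<close>
  have cof: "\<exists>N g. h ^ N - g * f \<in> P" if f: "f \<notin> P" for f
  proof (rule ccontr)
    assume n: "\<not> ?thesis"
    define Q where "Q = {p + g * f | p g. p \<in> P}"
    have "0 = 0 + 0 * f" by simp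
    moreover have "0 \<in> P" using iP by (auto simp: ideal_set_def)
    ultimately have "0 \<in> Q" unfolding Q_def by blast
    moreover have "x + y \<in> Q" if xy: "x \<in> Q" "y \<in> Q" for x y
    proof -
      obtain p g p' g' where "p \<in> P" "p' \<in> P" "x = p + g * f" "y = p' + g' * f"
        using xy by (auto simp: Q_def)
      then have "x + y = (p + p') + (g + g') * f" "p + p' \<in> P" by (simp_all add: algebra_simps addP)
      then show ?thesis unfolding Q_def by blast
    qed
    moreover have "r * x \<in> Q" if xy: "x \<in> Q" for x r
    proof -
      obtain p g where "p \<in> P" "x = p + g * f" using xy by (auto simp: Q_def)
      then have "r * x = r * p + (r * g) * f" by (simp add: algebra_simps)
      moreover have "r * p \<in> P" by (rule mulP) fact
      ultimately show ?thesis unfolding Q_def by blast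
    qed
    ultimately have "ideal_set Q" by (auto simp: ideal_set_def)
    moreover have PQ: "P \<subseteq> Q"
    proof
      fix p assume "p \<in> P"
      moreover have "p = p + 0 * f" by simp
      ultimately show "p \<in> Q" unfolding Q_def by blast
    qed
    moreover have "h ^ N \<notin> Q" for N
    proof
      assume "h ^ N \<in> Q"
      then obtain p g where "p \<in> P" "h ^ N = p + g * f" by (auto simp: Q_def)
      then have "h ^ N - g * f \<in> P" by simp
      with n show False by blast
    qed
    ultimately have "Q \<in> \<A>" using SP by (auto simp: \<A>_def)
    then have "Q = P" using max PQ by blast
    moreover have "f = 0 + 1 * f" by simp
    then have "f \<in> Q" unfolding Q_def using \<open>0 \<in> P\<close> by blast
    ultimately show False using f by simp
  qed
  have prime: "f \<in> P \<or> f' \<in> P" if ff: "f * f' \<in> P" for f f'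
  proof (rule ccontr)
    assume "\<not> ?thesis"
    then obtain N g N' g' where c: "h ^ N - g * f \<in> P" "h ^ N' - g' * f' \<in> P"
      using cof by meson
    have "h ^ (N + N') = h ^ N' * (h ^ N - g * f) + g * f * (h ^ N' - g' * f') + g * g' * (f * f')"
      by (simp add: algebra_simps power_add)
    then have "h ^ (N + N') \<in> P" using c ff by (simp add: addP mulP)
    with hP show False by blast
  qed
  have one: "1 \<notin> P" using hP[of 0] by simp
  have "\<exists>c. mvar i - mconst c \<in> P" for i
  proof (rule ccontr)
    assume n: "\<nexists>c. mvar i - mconst c \<in> P"
    \<comment> \<open>Univariate polynomials, evaluated at the i-th unknown. Only 0 is sent into P,
      because the others split into linear factors and P is prime.\<close>
    define ev :: "complex poly \<Rightarrow> ('v, complex) mpol"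
      where "ev p = poly (map_poly mconst p) (mvar i)" for p
    have ev: "rhom ev"
      unfolding ev_def by (intro rhom_comp[OF rhom_poly rhom_map_poly] rhom_mconst)
    have ev_const: "ev [:c:] = mconst c" for c by (simp add: ev_def map_poly_pCons rhom_zero[OF rhom_mconst])
    have ev_lin: "ev [:-c, 1:] = mvar i - mconst c" for c
      by (simp add: ev_def map_poly_pCons rhom_simps[OF rhom_mconst])
    have "ev p \<notin> P" if "p \<noteq> 0" for p
      using that
    proof (induction "degree p" arbitrary: p rule: less_induct)
      case less
      show ?case
      proof (cases "degree p = 0")
        case True
        then obtain c where c: "p = [:c:]" by (rule degree_eq_zeroE)
        with less.prems have "mconst (1 / c) * mconst c = (1 :: ('v, complex) mpol)"
          by (simp add: rhom_mult[OF rhom_mconst, symmetric] rhom_one[OF rhom_mconst])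
        with one mulP[of "mconst c" "mconst (1 / c)"] show ?thesis by (auto simp: c ev_const)
      next
        case False
        then obtain r where "poly p r = 0"
          using fundamental_theorem_of_algebra[of p] constant_degree[of p] by auto
        then obtain q where q: "p = [:-r, 1:] * q" by (auto simp: poly_eq_0_iff_dvd)
        with less.prems have "q \<noteq> 0" by auto
        then have "degree q < degree p" unfolding q by (subst degree_mult_eq) auto
        with less.hyps \<open>q \<noteq> 0\<close> have "ev q \<notin> P" by blast
        with n prime show ?thesis unfolding q rhom_mult[OF ev] ev_lin by blast
      qed
    qed note ev_notin = this
    have "\<forall>c. \<exists>N g. h ^ N - g * (mvar i - mconst c) \<in> P" using cof n by blast
    then obtain N g where Ng: "\<And>c. h ^ N c - g c * (mvar i - mconst c) \<in> P" by metis
    \<comment> \<open>A bound for all exponents in the cofactor of c. Some pair of h-exponent and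
      bound serves infinitely many c, whose cofactors then lie in the span of the finitely many
      monomials in \<open>B\<close>.\<close>
    define D where "D c = Max (insert 0 (\<Union>m\<in>Poly_Mapping.keys (g c). range (Poly_Mapping.lookup m)))" for c
    have D: "Poly_Mapping.lookup m v \<le> D c" if "m \<in> Poly_Mapping.keys (g c)" for m v c
      unfolding D_def by (rule Max_ge) (use that in auto)
    obtain N0 D0 where inf: "infinite {c. (N c, D c) = (N0, D0)}"
      using uncountable_fibre[of "\<lambda>c. (N c, D c)"] by auto
    define B where "B = {m :: 'v \<Rightarrow>\<^sub>0 nat. \<forall>v. Poly_Mapping.lookup m v \<le> D0}"
    have "Poly_Mapping.lookup ` B \<subseteq> PiE UNIV (\<lambda>_. {..D0})" by (auto simp: B_def)
    then have "finite (Poly_Mapping.lookup ` B)" by (rule finite_subset) (simp add: finite_PiE)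
    then have "finite B" by (rule finite_imageD) (simp add: inj_on_def Poly_Mapping.lookup_inject)
    obtain T where T: "finite T" "card T = Suc (card B)" "T \<subseteq> {c. (N c, D c) = (N0, D0)}"
      using infinite_arbitrarily_large[OF inf] by metis
    then obtain a c0 where a: "c0 \<in> T" "a c0 \<noteq> 0"
      "\<And>m. m \<in> B \<Longrightarrow> (\<Sum>c\<in>T. a c * Poly_Mapping.lookup (g c) m) = 0"
      using underdetermined_system[OF \<open>finite B\<close> T(1), of "\<lambda>c. Poly_Mapping.lookup (g c)"] by auto
    have lmul: "Poly_Mapping.lookup (mconst c * p) m = c * Poly_Mapping.lookup p m" for c m
        and p :: "('v, complex) mpol"
    proof -
      have "mconst c * p = Poly_Mapping.map ((*) c) p"
        by (simp add: mconst_def mult_map_scale_conv_mult)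
      then show ?thesis by (simp add: Poly_Mapping.map.rep_eq when_def)
    qed
    have dep: "(\<Sum>c\<in>T. mconst (a c) * g c) = 0"
    proof (rule poly_mapping_eqI)
      fix m
      have "(\<Sum>c\<in>T. a c * Poly_Mapping.lookup (g c) m) = 0"
      proof (cases "m \<in> B")
        case False
        have "Poly_Mapping.lookup (g c) m = 0" if "c \<in> T" for c
          using False D[of m c] that T(3) by (force simp: B_def in_keys_iff)
        then show ?thesis by simp
      qed (rule a)
      then show "Poly_Mapping.lookup (\<Sum>c\<in>T. mconst (a c) * g c) m = Poly_Mapping.lookup 0 m"
        by (simp add: lookup_sum lmul)
    qed
    \<comment> \<open>The numerator of the sum of a_c / (x - c). Modulo P the cofactor of c acts
      like h^N0 / (x_i - c), so the dependence puts \<open>h ^ N0 * ev q\<close> into P. At c0 only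
      its own summand survives, hence q is not 0.\<close>
    define q where "q = (\<Sum>c\<in>T. [:a c:] * (\<Prod>k\<in>T - {c}. [:-k, 1:]))"
    have "poly q c0 = (\<Sum>c\<in>T. if c = c0 then a c * (\<Prod>k\<in>T - {c}. c - k) else 0)"
      unfolding q_def poly_sum
      by (intro sum.cong refl) (use T(1) a(1) in \<open>auto simp: poly_prod\<close>)
    then have "poly q c0 \<noteq> 0" using T(1) a by (simp add: sum.delta)
    then have "q \<noteq> 0" by auto
    have "h ^ N0 * ev q = (\<Sum>c\<in>T. ev ([:a c:] * (\<Prod>k\<in>T - {c}. [:-k, 1:])) * (h ^ N0 - g c * (mvar i - mconst c)))
        + (\<Sum>c\<in>T. ev ([:a c:] * (\<Prod>k\<in>T - {c}. [:-k, 1:])) * (g c * (mvar i - mconst c)))"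
      by (simp add: q_def rhom_sum[OF ev] sum.distrib[symmetric] sum_distrib_left algebra_simps)
    also have "(\<Sum>c\<in>T. ev ([:a c:] * (\<Prod>k\<in>T - {c}. [:-k, 1:])) * (g c * (mvar i - mconst c)))
      = (\<Sum>c\<in>T. mconst (a c) * g c) * (\<Prod>k\<in>T. mvar i - mconst k)"
      unfolding sum_distrib_right
    proof (intro sum.cong refl)
      fix c assume "c \<in> T"
      then show "ev ([:a c:] * (\<Prod>k\<in>T - {c}. [:-k, 1:])) * (g c * (mvar i - mconst c))
          = mconst (a c) * g c * (\<Prod>k\<in>T. mvar i - mconst k)"
        using T(1)
        by (simp only: rhom_mult[OF ev] rhom_prod[OF ev] ev_const ev_lin prod.remove[of T c])
           (simp add: mult_ac)
    qed
    also have "\<dots> = 0" by (simp add: dep)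
    also have "(\<Sum>c\<in>T. ev ([:a c:] * (\<Prod>k\<in>T - {c}. [:-k, 1:])) * (h ^ N0 - g c * (mvar i - mconst c))) + 0 \<in> P"
      unfolding add_0_right
      by (intro ideal_set_sum[OF iP] mulP) (use T(3) Ng in force)
    finally show False using prime hP ev_notin[OF \<open>q \<noteq> 0\<close>] by blast
  qed
  then obtain c where c: "\<And>i. mvar i - mconst (c i) \<in> P" by metis
  \<comment> \<open>Modulo P every polynomial equals its value at c. So the members of P, in
    particular those of S, vanish at c, whereas h does not: otherwise h would lie in P.\<close>
  have eval: "f - mconst (meval c f) \<in> P" for f
  proof -
    have mm: "mmon mvar m - mconst (mmon c m) \<in> P" for m
    proof -
      have pow: "mvar i ^ k - mconst (c i ^ k) \<in> P" for i k
      proof (induction k)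
        case 0
        then show ?case using iP by (simp add: rhom_one[OF rhom_mconst] ideal_set_def)
      next
        case (Suc k)
        have "mvar i ^ Suc k - mconst (c i ^ Suc k) =
            mvar i * (mvar i ^ k - mconst (c i ^ k)) + mconst (c i ^ k) * (mvar i - mconst (c i))"
          by (simp add: rhom_mult[OF rhom_mconst] algebra_simps)
        with Suc c show ?case by (simp add: addP mulP)
      qed
      have "(\<Prod>v\<in>A. mvar v ^ Poly_Mapping.lookup m v) - mconst (\<Prod>v\<in>A. c v ^ Poly_Mapping.lookup m v) \<in> P" for A
      proof (induction A rule: infinite_finite_induct)
        case (insert x A)
        let ?X = "mvar x ^ Poly_Mapping.lookup m x :: ('v, complex) mpol"
        let ?Y = "\<Prod>v\<in>A. mvar v ^ Poly_Mapping.lookup m v :: ('v, complex) mpol"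
        have "?X * ?Y - mconst (c x ^ Poly_Mapping.lookup m x * (\<Prod>v\<in>A. c v ^ Poly_Mapping.lookup m v))
          = ?X * (?Y - mconst (\<Prod>v\<in>A. c v ^ Poly_Mapping.lookup m v)) +
            mconst (\<Prod>v\<in>A. c v ^ Poly_Mapping.lookup m v) * (?X - mconst (c x ^ Poly_Mapping.lookup m x))"
          by (simp add: rhom_mult[OF rhom_mconst] algebra_simps)
        with insert pow[of x] show ?case by (simp add: addP mulP)
      qed (use iP in \<open>auto simp: rhom_one[OF rhom_mconst] ideal_set_def\<close>)
      then show ?thesis by (simp add: mmon_def)
    qed
    have "f - mconst (meval c f) = msubst mconst mvar f - mconst (meval c f)"
      by (simp add: msubst_mvar_id)
    also have "\<dots> = (\<Sum>m\<in>Poly_Mapping.keys f. mconst (Poly_Mapping.lookup f m) * (mmon mvar m - mconst (mmon c m)))"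
      by (simp add: msubst_mmon rhom_simps[OF rhom_mconst] sum_subtractf right_diff_distrib)
    also have "\<dots> \<in> P" by (intro ideal_set_sum[OF iP] mulP mm)
    finally show ?thesis .
  qed
  have vanP: "meval c f = 0" if "f \<in> P" for f
  proof (rule ccontr)
    assume nz: "meval c f \<noteq> 0"
    have "mconst (meval c f) = f - (f - mconst (meval c f))" by simp
    then have "mconst (meval c f) \<in> P" using diffP that eval by metis
    from mulP[OF this, of "mconst (1 / meval c f)"] nz one show False
      by (simp add: rhom_mult[OF rhom_mconst, symmetric] rhom_one[OF rhom_mconst])
  qed
  have "meval c h = 0"
    using SP module.span_base[OF module_times, of _ S] by (intro van vanP) auto
  with eval[of h] hP[of 1] show False by (simp add: rhom_zero[OF rhom_mconst])
qed

section \<open>The moment polynomials\<close>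

lemma msubst_coeffs_hsym:
  assumes "rhom e"
  shows "msubst (\<lambda>c. mconst (e c)) mvar (hsym N X) = hsym N (\<lambda>k l. e (X k l))"
  unfolding msubst_hsym[OF rhom_comp[OF rhom_mconst assms]] by (simp add: hsym_def)

lemma rhom_lookup_hsym:
  assumes "rhom e"
  shows "e (Poly_Mapping.lookup (hsym N X) I) = Poly_Mapping.lookup (hsym N (\<lambda>k l. e (X k l))) I"
  using lookup_msubst_coeffs[OF assms, of "hsym N X" I] by (simp add: msubst_coeffs_hsym[OF assms])

text \<open>\<open>hsym\<close> is taken over the ring of polynomials in the vertex coordinates, so
  that its coefficient at I is itself a polynomial of the required kind.\<close>

definition explicit_moment_poly :: "('d::finite \<Rightarrow>\<^sub>0 nat) \<Rightarrow> ('d option \<times> 'd, complex) mpol"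
  where "explicit_moment_poly I =
    mconst (1 / moment_factor I) * Poly_Mapping.lookup (hsym (mdeg I) (\<lambda>k l. mvar (k, l))) I"

lemma moment_factor_nonzero: "moment_factor I \<noteq> 0"
  by (simp add: moment_factor_def)

lemma meval_explicit_moment_poly:
  "meval (\<lambda>(k, l). X k l) (explicit_moment_poly I) =
    Poly_Mapping.lookup (hsym (mdeg I) X) I / moment_factor I"
  unfolding explicit_moment_poly_def rhom_mult[OF rhom_msubst[OF rhom_id]]
    rhom_lookup_hsym[OF rhom_msubst[OF rhom_id]]
  by (simp add: msubst_mconst[OF rhom_id] msubst_mvar[OF rhom_id])

lemma meval_explicit_moment_poly_real:
  fixes X :: "real^'d::finite^('d option)"
  assumes X: "int CARD('d) simplex simplex_of X"
  shows "meval (\<lambda>(k, l). complex_of_real (X $ k $ l)) (explicit_moment_poly I) = complex_of_real (moment I X)"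
proof -
  have "complex_of_real (moment_factor I) = moment_factor I"
    by (simp add: moment_factor_def)
  then have "complex_of_real (moment_factor I * moment I X) = moment_factor I * complex_of_real (moment I X)"
    by simp
  then have "Poly_Mapping.lookup (hsym (mdeg I) (\<lambda>k l. complex_of_real (X $ k $ l))) I =
      moment_factor I * complex_of_real (moment I X)"
    unfolding moment_lookup_hsym[OF X] rhom_lookup_hsym[OF rhom_of_real] .
  then show ?thesis
    unfolding meval_explicit_moment_poly by (simp add: moment_factor_nonzero)
qed

text \<open>These matrices contain a product of infinite sets, which makes the moment polynomial unique.\<close>

lemma simplex_of_near_standard:
  fixes X :: "real^'d::finite^('d option)"
  assumes diag: "\<And>l. X $ Some l $ l \<ge> 1"
    and off: "\<And>k l. k \<noteq> Some l \<Longrightarrow> \<bar>X $ k $ l\<bar> \<le> 1 / (4 * real CARD('d))"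
  shows "int CARD('d) simplex simplex_of X"
proof -
  have indep: "b = (\<lambda>_. 0)" if b0: "sum b UNIV = 0" and bX: "(\<Sum>k\<in>UNIV. b k *\<^sub>R X $ k) = 0" for b :: "'d option \<Rightarrow> real"
  proof -
    \<comment> \<open>Diagonal dominance: M is the largest coefficient of a row
      \<open>Some l\<close> in modulus. The coefficient of \<open>None\<close> is at most d M
      because all of them sum to 0, so the off-diagonal part is at most 2 d M / (4 d) = M / 2,
      against at least M on the diagonal.\<close>
    define M where "M = Max (range (\<lambda>l. \<bar>b (Some l)\<bar>))"
    have M: "\<bar>b (Some l)\<bar> \<le> M" for l unfolding M_def by (rule Max_ge) auto
    have "M \<in> range (\<lambda>l. \<bar>b (Some l)\<bar>)" unfolding M_def by (rule Max_in) auto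
    then obtain l where l: "M = \<bar>b (Some l)\<bar>" by auto
    have "M \<ge> 0" using l by simp
    have "b None = - (\<Sum>l\<in>UNIV. b (Some l))" using b0 by (simp add: sum_UNIV_option)
    then have "\<bar>b None\<bar> \<le> (\<Sum>l\<in>UNIV. \<bar>b (Some l)\<bar>)" by (simp add: sum_abs)
    also have "\<dots> \<le> CARD('d) * M" using sum_bounded_above[of UNIV "\<lambda>l. \<bar>b (Some l)\<bar>" M] M by simp
    finally have N: "\<bar>b None\<bar> \<le> CARD('d) * M" .
    have "(\<Sum>k\<in>UNIV. b k * X $ k $ l) = 0"
      using arg_cong[OF bX, of "\<lambda>v. v $ l"] by simp
    then have "b (Some l) * X $ Some l $ l = - (\<Sum>k\<in>UNIV - {Some l}. b k * X $ k $ l)"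
      by (subst (asm) sum.remove[of _ "Some l"]) auto
    then have "\<bar>b (Some l) * X $ Some l $ l\<bar> = \<bar>\<Sum>k\<in>UNIV - {Some l}. b k * X $ k $ l\<bar>"
      by simp
    then have "M * \<bar>X $ Some l $ l\<bar> = \<bar>\<Sum>k\<in>UNIV - {Some l}. b k * X $ k $ l\<bar>"
      by (simp only: l abs_mult)
    also have "\<dots> \<le> (\<Sum>k\<in>UNIV - {Some l}. \<bar>b k\<bar> * (1 / (4 * real CARD('d))))"
      by (rule order.trans[OF sum_abs], intro sum_mono, unfold abs_mult, intro mult_left_mono off) auto
    also have "\<dots> \<le> (\<Sum>k\<in>UNIV. \<bar>b k\<bar> * (1 / (4 * real CARD('d))))"
      by (rule sum_mono2) auto
    also have "\<dots> = (\<bar>b None\<bar> + (\<Sum>l\<in>UNIV. \<bar>b (Some l)\<bar>)) * (1 / (4 * real CARD('d)))"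
      by (simp add: sum_UNIV_option sum_divide_distrib add_divide_distrib)
    also have "\<dots> \<le> (CARD('d) * M + CARD('d) * M) * (1 / (4 * real CARD('d)))"
      using N sum_bounded_above[of UNIV "\<lambda>l. \<bar>b (Some l)\<bar>" M] M by (intro mult_right_mono add_mono) auto
    also have "\<dots> = M / 2" by (simp add: field_simps)
    finally have "M * \<bar>X $ Some l $ l\<bar> \<le> M / 2" .
    moreover have "M * 1 \<le> M * \<bar>X $ Some l $ l\<bar>"
      using diag[of l] \<open>M \<ge> 0\<close> by (intro mult_left_mono) auto
    ultimately have "M = 0" using \<open>M \<ge> 0\<close> by simp
    show ?thesis
    proof
      fix k show "b k = 0" using M N \<open>M = 0\<close> by (cases k) auto
    qed
  qed
  have inj: "inj (\<lambda>k. X $ k)"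
  proof (rule injI, rule ccontr)
    fix k k' assume k: "X $ k = X $ k'" "k \<noteq> k'"
    let ?b = "\<lambda>i. (if i = k then 1 else 0) - (if i = k' then 1 else 0) :: real"
    have "sum ?b UNIV = 0" by (simp add: sum_subtractf)
    moreover have "(\<Sum>i\<in>UNIV. ?b i *\<^sub>R X $ i) = 0"
      using k by (simp add: scaleR_left_diff_distrib sum_subtractf if_distrib[of "\<lambda>x. x *\<^sub>R _"] cong: if_cong)
    ultimately have "?b = (\<lambda>_. 0)" by (rule indep)
    from fun_cong[OF this, of k] k(2) show False by simp
  qed
  have "\<not> affine_dependent (range (\<lambda>k. X $ k))"
  proof
    assume "affine_dependent (range (\<lambda>k. X $ k))"
    then obtain U v where U: "sum U (range (\<lambda>k. X $ k)) = 0" "v \<in> range (\<lambda>k. X $ k)" "U v \<noteq> 0"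
      "(\<Sum>v\<in>range (\<lambda>k. X $ k). U v *\<^sub>R v) = 0"
      by (subst (asm) affine_dependent_explicit_finite) auto
    then have "(\<lambda>k. U (X $ k)) = (\<lambda>_. 0)"
      by (intro indep) (simp_all add: sum.reindex[OF inj])
    with U(2,3) show False by (metis imageE)
  qed
  moreover have "card (range (\<lambda>k. X $ k)) = CARD('d) + 1"
    using card_image[OF inj] by simp
  ultimately show ?thesis
    unfolding simplex_def simplex_of_def by (intro exI[of _ "range (\<lambda>k. X $ k)"]) auto
qed

lemma moment_poly_eq: "moment_poly I = explicit_moment_poly I"
  unfolding moment_poly_def
proof (rule the_equality)
  show "\<forall>X. int CARD('a) simplex simplex_of X \<longrightarrow>
      meval (\<lambda>(k, l). complex_of_real (X $ k $ l)) (explicit_moment_poly I) = complex_of_real (moment I X)"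
    using meval_explicit_moment_poly_real by blast
next
  fix p assume p: "\<forall>X. int CARD('a) simplex simplex_of X \<longrightarrow>
      meval (\<lambda>(k, l). complex_of_real (X $ k $ l)) p = complex_of_real (moment I X)"
  let ?\<delta> = "1 / (4 * real CARD('a))"
  \<comment> \<open>The diagonal entries range over [1, 2] and the others over [0, 1 / (4 d)], as
    \<open>simplex_of_near_standard\<close> permits.\<close>
  define S where "S = (\<lambda>(k, l). complex_of_real ` (if k = Some (l :: 'a) then {1..2} else {0..?\<delta>}))"
  have "p - explicit_moment_poly I = 0"
  proof (rule mpol_eq_0_if_vanishes_on_grid[of S])
    fix v :: "'a option \<times> 'a"
    have "infinite {0..?\<delta>}" by (rule infinite_Icc) simp
    moreover have "infinite {1..2::real}" by (rule infinite_Icc) simp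
    moreover have "inj_on complex_of_real A" for A by (simp add: inj_on_def)
    ultimately show "infinite (S v)"
      by (auto simp: S_def finite_image_iff split: prod.splits)
  next
    fix a assume a: "\<And>v. a v \<in> S v"
    define X :: "real^'a^('a option)" where "X = (\<chi> k. \<chi> l. Re (a (k, l)))"
    have "a = (\<lambda>(k, l). complex_of_real (X $ k $ l))"
    proof
      fix v show "a v = (case v of (k, l) \<Rightarrow> complex_of_real (X $ k $ l))"
        using a[of v] by (auto simp: S_def X_def split: prod.splits if_splits)
    qed
    moreover have X: "int CARD('a) simplex simplex_of X"
    proof (rule simplex_of_near_standard)
      show "X $ Some l $ l \<ge> 1" for l using a[of "(Some l, l)"] by (auto simp: S_def X_def)
      show "\<bar>X $ k $ l\<bar> \<le> ?\<delta>" if "k \<noteq> Some l" for k l using a[of "(k, l)"] that by (auto simp: S_def X_def)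
    qed
    ultimately show "meval a (p - explicit_moment_poly I) = 0"
      using p meval_explicit_moment_poly_real[OF X, of I] by (simp add: rhom_diff[OF rhom_msubst[OF rhom_id]])
  qed
  then show "p = explicit_moment_poly I" by simp
qed

lemma moment_map_nth:
  "moment_map X $ I = Poly_Mapping.lookup (hsym (mdeg (exponent I)) (\<lambda>k l. X $ k $ l)) (exponent I) / moment_factor (exponent I)"
  by (simp add: moment_map_def moment_poly_eq meval_explicit_moment_poly)

lemma exponent_zero_exps: "exponent zero_exps = 0"
  by (simp add: zero_exps_def exps_of_inverse)

lemma hsym_0: "hsym 0 (X :: 'k::finite \<Rightarrow> _) = 1"
proof -
  have "{a :: 'k \<Rightarrow> nat. sum a UNIV = 0} = {\<lambda>_. 0}" by auto
  then show ?thesis by (simp add: hsym_def)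
qed

lemma moment_map_zero_exps: "moment_map X $ zero_exps = 1"
  by (simp add: moment_map_nth exponent_zero_exps hsym_0 moment_factor_def)

section \<open>Truncated inversion of the moment generating function\<close>

text \<open>\<open>mdgt N (p - q)\<close> expresses that p and q agree modulo the power N + 1 of the
  ideal generated by the unknowns.\<close>

definition mdgt :: "nat \<Rightarrow> ('v, 'r::comm_ring_1) mpol \<Rightarrow> bool"
  where "mdgt N p \<longleftrightarrow> (\<forall>m\<in>Poly_Mapping.keys p. N < mdeg m)"

lemma mdgt_mult: "mdgt N p \<Longrightarrow> mdgt N (p * q)"
  unfolding mdgt_def
proof
  fix m assume "\<forall>m\<in>Poly_Mapping.keys p. N < mdeg m" "m \<in> Poly_Mapping.keys (p * q)"
  with mdeg_keys_mult[of p "{N<..}" q UNIV m] show "N < mdeg m" by fastforce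
qed

lemma mdgt_add: "mdgt N p \<Longrightarrow> mdgt N q \<Longrightarrow> mdgt N (p + q)"
  using keys_add[of p q] by (auto simp: mdgt_def)

lemma mdgt_uminus: "mdgt N p \<Longrightarrow> mdgt N (- p)"
  by (simp add: mdgt_def in_keys_iff)

lemma mdgt_power: assumes "mdgt 0 p" shows "mdgt N (p ^ Suc N)"
proof (induction N)
  case (Suc N)
  show ?case unfolding mdgt_def
  proof
    fix m assume "m \<in> Poly_Mapping.keys (p ^ Suc (Suc N))"
    then have "m \<in> Poly_Mapping.keys (p * p ^ Suc N)" by simp
    with mdeg_keys_mult[of p "{0<..}" "p ^ Suc N" "{N<..}" m] Suc assms show "Suc N < mdeg m"
      by (fastforce simp: mdgt_def)
  qed
qed (use assms in simp)

lemma lookup_eq_if_mdgt: "mdgt N (p - q) \<Longrightarrow> mdeg I \<le> N \<Longrightarrow> Poly_Mapping.lookup p I = Poly_Mapping.lookup q I"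
  by (metis eq_iff_diff_eq_0 in_keys_iff lookup_minus mdgt_def not_le)

lemma mdgt_diffI: "(\<And>I. mdeg I \<le> N \<Longrightarrow> Poly_Mapping.lookup p I = Poly_Mapping.lookup q I) \<Longrightarrow> mdgt N (p - q)"
  unfolding mdgt_def by (metis eq_iff_diff_eq_0 in_keys_iff lookup_minus not_le)

section \<open>Truncated geometric series\<close>

definition lin_form :: "('d::finite \<Rightarrow> 'r::comm_ring_1) \<Rightarrow> ('d, 'r) mpol"
  where "lin_form x = (\<Sum>l\<in>UNIV. mconst (x l) * mvar l)"

lemma hdeg_lin_form: "hdeg 1 (lin_form x)"
  unfolding lin_form_def using hdeg_mult[OF hdeg_mconst hdeg_mvar] by (intro hdeg_sum) auto

definition geom_prod :: "nat \<Rightarrow> ('k::finite \<Rightarrow> 'd::finite \<Rightarrow> 'r::comm_ring_1) \<Rightarrow> ('d, 'r) mpol"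
  where "geom_prod N X = (\<Prod>k\<in>UNIV. \<Sum>j\<le>N. lin_form (X k) ^ j)"

text \<open>Expanding the product gives summands indexed by exponent vectors a with entries at most
  N, homogeneous of degree \<open>sum a UNIV\<close>. Only those with sum \<open>mdeg I\<close>
  reach the monomial I, and the truncation loses none of them.\<close>

lemma lookup_geom_prod:
  fixes X :: "'k::finite \<Rightarrow> 'd::finite \<Rightarrow> 'r::comm_ring_1"
  assumes "mdeg I \<le> N"
  shows "Poly_Mapping.lookup (geom_prod N X) I = Poly_Mapping.lookup (hsym (mdeg I) X) I"
proof -
  let ?P = "\<lambda>a. \<Prod>k\<in>UNIV. lin_form (X k) ^ a k"
  have h: "hdeg (sum a UNIV) (?P a)" for a
    using hdeg_prod[of UNIV a "\<lambda>k. lin_form (X k) ^ a k"] hdeg_power[OF hdeg_lin_form] by fastforce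
  have "geom_prod N X = (\<Sum>a\<in>PiE UNIV (\<lambda>_. {..N}). ?P a)"
    unfolding geom_prod_def by (rule prod_sum_PiE) auto
  then have "Poly_Mapping.lookup (geom_prod N X) I = (\<Sum>a\<in>PiE UNIV (\<lambda>_. {..N}). Poly_Mapping.lookup (?P a) I)"
    by (simp add: lookup_sum)
  also have "\<dots> = (\<Sum>a | sum a UNIV = mdeg I. Poly_Mapping.lookup (?P a) I)"
  proof (rule sum.mono_neutral_right)
    show "{a :: 'k \<Rightarrow> nat. sum a UNIV = mdeg I} \<subseteq> PiE UNIV (\<lambda>_. {..N})"
    proof
      fix a :: "'k \<Rightarrow> nat" assume "a \<in> {a. sum a UNIV = mdeg I}"
      then have "a k \<le> N" for k using assms member_le_sum[of k UNIV a] by simp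
      then show "a \<in> PiE UNIV (\<lambda>_. {..N})" by auto
    qed
    show "\<forall>a\<in>PiE UNIV (\<lambda>_. {..N}) - {a. sum a UNIV = mdeg I}. Poly_Mapping.lookup (?P a) I = 0"
      using h by (auto simp: hdeg_def in_keys_iff)
  qed (simp add: finite_PiE)
  also have "\<dots> = Poly_Mapping.lookup (hsym (mdeg I) X) I"
    by (simp add: hsym_def lookup_sum lin_form_def)
  finally show ?thesis .
qed

text \<open>Each factor contributes (1 - x)(1 + x + ... + x^N) = 1 - x^(N+1), which is 1 up to
  degree N.\<close>

lemma geom_prod_inverse: "mdgt N (lin_prod X * geom_prod N X - 1)"
proof -
  have "lin_prod X * geom_prod N X = (\<Prod>k\<in>UNIV. (1 - lin_form (X k)) * (\<Sum>j\<le>N. lin_form (X k) ^ j))"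
    by (simp add: lin_prod_def geom_prod_def lin_form_def prod.distrib)
  also have "\<dots> = (\<Prod>k\<in>UNIV. 1 - lin_form (X k) ^ Suc N)"
    by (simp only: sum_gp_basic)
  finally have e: "lin_prod X * geom_prod N X = \<dots>" .
  have "mdgt N ((\<Prod>k\<in>A. 1 - lin_form (X k) ^ Suc N) - 1)" for A
  proof (induction A rule: infinite_finite_induct)
    case (insert k A)
    have "mdgt N (lin_form (X k) ^ Suc N)"
      by (rule mdgt_power) (use hdeg_lin_form[of "X k"] in \<open>auto simp: hdeg_def mdgt_def\<close>)
    then have "mdgt N (- (lin_form (X k) ^ Suc N * (\<Prod>k\<in>A. 1 - lin_form (X k) ^ Suc N)) + ((\<Prod>k\<in>A. 1 - lin_form (X k) ^ Suc N) - 1))"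
      by (intro mdgt_add mdgt_uminus mdgt_mult insert)
    with insert(1,2) show ?case by (simp add: algebra_simps)
  qed (simp_all add: mdgt_def)
  then show ?thesis unfolding e .
qed

section \<open>The inverse of 1 + L for numerical moments\<close>

definition L_eval :: "('d::finite exps \<Rightarrow> complex) \<Rightarrow> ('d, complex) mpol"
  where "L_eval m = (\<Sum>I | 1 \<le> mdeg (exponent I). Poly_Mapping.single (exponent I) (moment_factor (exponent I) * m I))"

definition Inv_eval :: "('d::finite exps \<Rightarrow> complex) \<Rightarrow> ('d, complex) mpol"
  where "Inv_eval m = (\<Sum>j\<le>CARD('d) + 1. (-1) ^ j * L_eval m ^ j)"

lemma L_series_eval: "msubst (\<lambda>p. mconst (meval m p)) mvar L_series = L_eval m"
proof -
  note h = rhom_comp[OF rhom_mconst rhom_msubst[OF rhom_id]]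
  show ?thesis
    unfolding L_series_def L_eval_def msubst_sum[OF h] msubst_single[OF h] mmon_mvar moment_factor_def[symmetric]
    by (intro sum.cong refl)
       (simp only: rhom_mult[OF rhom_msubst[OF rhom_id]] msubst_mconst[OF rhom_id] msubst_mvar[OF rhom_id],
         simp add: mconst_def mult_single)
qed

lemma meval_inverse_coeff: "meval m (inverse_coeff I) = Poly_Mapping.lookup (Inv_eval m) (exponent I)"
proof -
  note h = rhom_msubst[OF rhom_id] note g = rhom_msubst[OF rhom_comp[OF rhom_mconst h]]
  show ?thesis
    unfolding inverse_coeff_def lookup_msubst_coeffs[OF h, symmetric] Inv_eval_def
    by (simp add: rhom_simps[OF g] L_series_eval)
qed

lemma mdgt_L_eval: "mdgt 0 (L_eval m)"
proof -
  have "mdgt 0 (\<Sum>I\<in>A. Poly_Mapping.single (exponent I) (c I))"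
    if "A \<subseteq> {I. 1 \<le> mdeg (exponent I)}" for A and c :: "'a exps \<Rightarrow> complex"
    using that
  proof (induction A rule: infinite_finite_induct)
    case (insert I A)
    then have "mdgt 0 (Poly_Mapping.single (exponent I) (c I))" by (simp add: mdgt_def)
    with insert show ?case by (simp add: mdgt_add)
  qed (simp_all add: mdgt_def)
  then show ?thesis unfolding L_eval_def by this simp
qed

lemma L_eval_inverse: "mdgt (CARD('d::finite) + 1) ((1 + L_eval m) * Inv_eval (m :: 'd exps \<Rightarrow> complex) - 1)"
proof -
  have "(1 + L_eval m) * Inv_eval m = (1 - (- L_eval m)) * (\<Sum>j\<le>CARD('d) + 1. (- L_eval m) ^ j)"
    unfolding Inv_eval_def diff_minus_eq_add
    by (intro arg_cong2[where f = "(*)"] sum.cong refl) (rule power_minus[symmetric])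
  also have "\<dots> = 1 - (- L_eval m) ^ Suc (CARD('d) + 1)"
    by (rule sum_gp_basic)
  finally have "(1 + L_eval m) * Inv_eval m - 1 = - ((- L_eval m) ^ Suc (CARD('d) + 1))" by simp
  moreover have "mdgt (CARD('d) + 1) ((- L_eval m) ^ Suc (CARD('d) + 1))"
    by (intro mdgt_power mdgt_uminus mdgt_L_eval)
  ultimately show ?thesis by (simp only: mdgt_uminus)
qed

lemma lookup_L_eval: "Poly_Mapping.lookup (1 + L_eval m) (exponent I) = (if I = zero_exps then 1 else moment_factor (exponent I) * m I)"
proof -
  have z: "mdeg (exponent J) = 0 \<longleftrightarrow> J = zero_exps" for J :: "'a exps"
  proof
    assume "mdeg (exponent J) = 0"
    then have "exponent J = 0" by (auto simp: mdeg_UNIV intro: poly_mapping_eqI)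
    then show "J = zero_exps" using exponent_zero_exps by (metis exponent_inject)
  qed (simp add: exponent_zero_exps)
  have "Poly_Mapping.lookup (L_eval m) (exponent I) = (\<Sum>J | 1 \<le> mdeg (exponent J). if J = I then moment_factor (exponent I) * m I else 0)"
    unfolding L_eval_def lookup_sum
    by (intro sum.cong refl) (auto simp: lookup_single when_def exponent_inject)
  also have "\<dots> = (if I = zero_exps then 0 else moment_factor (exponent I) * m I)"
    using z[of I] by (auto simp: sum.delta)
  finally show ?thesis
    using exponent_zero_exps z[of I] by (auto simp: lookup_add lookup_one when_def)
qed

lemma ex_exponent: "mdeg (J :: 'd::finite \<Rightarrow>\<^sub>0 nat) \<le> CARD('d) + 1 \<Longrightarrow> \<exists>I. J = exponent I"
  by (metis exps_of_inverse mem_Collect_eq)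

lemma moment_map_iff:
  fixes m :: "complex^('d::finite exps)"
  assumes m0: "m $ zero_exps = 1"
  shows "m = moment_map X \<longleftrightarrow>
    (\<forall>I. meval (\<lambda>i. m $ i) (inverse_coeff I) = Poly_Mapping.lookup (lin_prod (\<lambda>k l. X $ k $ l)) (exponent I))"
proof -
  let ?n = "CARD('d) + 1"
  let ?m = "\<lambda>i. m $ i" and ?X = "\<lambda>k l. X $ k $ l"
  let ?L = "1 + L_eval ?m" and ?I = "Inv_eval ?m" and ?P = "lin_prod ?X" and ?H = "geom_prod ?n ?X"
  have LI: "mdgt ?n (?L * ?I - 1)" by (rule L_eval_inverse)
  have PH: "mdgt ?n (?P * ?H - 1)" by (rule geom_prod_inverse)
  have n: "mdeg (exponent I) \<le> ?n" for I :: "'d exps" by (rule mdeg_exponent)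
  have lH: "Poly_Mapping.lookup ?H (exponent I) = moment_factor (exponent I) * moment_map X $ I" for I
    using lookup_geom_prod[OF n, of ?X I] by (simp add: moment_map_nth moment_factor_nonzero)
  have mom: "m = moment_map X \<longleftrightarrow> mdgt ?n (?L - ?H)"
  proof
    assume m: "m = moment_map X"
    show "mdgt ?n (?L - ?H)"
    proof (rule mdgt_diffI)
      fix J :: "'d \<Rightarrow>\<^sub>0 nat" assume "mdeg J \<le> ?n"
      then obtain I where J: "J = exponent I" using ex_exponent by blast
      show "Poly_Mapping.lookup ?L J = Poly_Mapping.lookup ?H J"
        unfolding J lookup_L_eval lH m
        by (simp add: moment_map_zero_exps exponent_zero_exps moment_factor_def)
    qed
  next
    assume d: "mdgt ?n (?L - ?H)"
    have "m $ I = moment_map X $ I" for I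
    proof (cases "I = zero_exps")
      case False
      then have "moment_factor (exponent I) * m $ I = moment_factor (exponent I) * moment_map X $ I"
        using lookup_eq_if_mdgt[OF d n, of I] unfolding lookup_L_eval lH by simp
      then show ?thesis by (simp add: moment_factor_nonzero)
    qed (simp add: m0 moment_map_zero_exps)
    then show "m = moment_map X" by (simp add: vec_eq_iff)
  qed
  have inv: "(\<forall>I. meval ?m (inverse_coeff I) = Poly_Mapping.lookup ?P (exponent I)) \<longleftrightarrow> mdgt ?n (?I - ?P)"
  proof
    assume c: "\<forall>I. meval ?m (inverse_coeff I) = Poly_Mapping.lookup ?P (exponent I)"
    show "mdgt ?n (?I - ?P)"
    proof (rule mdgt_diffI)
      fix J :: "'d \<Rightarrow>\<^sub>0 nat" assume "mdeg J \<le> ?n"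
      then obtain I where J: "J = exponent I" using ex_exponent by blast
      show "Poly_Mapping.lookup ?I J = Poly_Mapping.lookup ?P J"
        using c by (simp add: J meval_inverse_coeff)
    qed
  qed (simp add: meval_inverse_coeff lookup_eq_if_mdgt[OF _ n])
  \<comment> \<open>With LI = 1 and PH = 1 up to the truncation, I - P = I(PH) - P(LI) = - (L - H) I
    P; the equation keeps track of the two errors.\<close>
  have "?I - ?P = (?L * ?I - 1) * ?P + (- ((?P * ?H - 1) * ?I)) + (- ((?L - ?H) * (?I * ?P)))"
    by (simp add: algebra_simps)
  then have 1: "mdgt ?n (?L - ?H) \<Longrightarrow> mdgt ?n (?I - ?P)"
    by (metis LI PH mdgt_add mdgt_mult mdgt_uminus)
  have "?L - ?H = (?L * ?I - 1) * ?H + (- ((?P * ?H - 1) * ?L)) + (- ((?I - ?P) * (?L * ?H)))"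
    by (simp add: algebra_simps)
  then have 2: "mdgt ?n (?I - ?P) \<Longrightarrow> mdgt ?n (?L - ?H)"
    by (metis LI PH mdgt_add mdgt_mult mdgt_uminus)
  show ?thesis using mom inv 1 2 by blast
qed

section \<open>The affine moment variety\<close>

text \<open>Evaluating every coefficient of the generic form at c is a ring homomorphism, hence
  yields Brill's form with coefficients c, still a polynomial in the unknowns x, y, z.\<close>

lemma brill_equations_vanish_iff:
  "(\<forall>B\<in>brill_equations. meval c B = 0) \<longleftrightarrow>
    brill_form (\<lambda>I. mconst (c I)) (\<lambda>i. mvar (Inl i)) (\<lambda>i. mvar (Inr (Inl i))) (\<lambda>i. mvar (Inr (Inr i))) =
      (0 :: ('d::finite option + 'd option + 'd option, complex) mpol)"
    (is "_ \<longleftrightarrow> ?G = 0")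
proof -
  define G where "G = (brill_form (\<lambda>I. mconst (mvar I)) (\<lambda>i. mvar (Inl i)) (\<lambda>i. mvar (Inr (Inl i))) (\<lambda>i. mvar (Inr (Inr i)))
        :: ('d option + 'd option + 'd option, ('d exps, complex) mpol) mpol)"
  note h = rhom_msubst[OF rhom_id] note g = rhom_comp[OF rhom_mconst h]
  have "msubst (\<lambda>p. mconst (meval c p)) mvar G = ?G"
    unfolding G_def rhom_brill_form[OF rhom_msubst[OF g]] msubst_mconst[OF g] msubst_mvar[OF g] msubst_mvar[OF rhom_id] ..
  then have "meval c (Poly_Mapping.lookup G K) = Poly_Mapping.lookup ?G K" for K
    using lookup_msubst_coeffs[OF h, of c G K] by simp
  then show ?thesis
    unfolding brill_equations_def G_def[symmetric] by (auto simp: poly_mapping_eq_iff fun_eq_iff)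
qed

lemma brill_equations_vanish_iff_lin_prod:
  fixes c :: "'d::finite exps \<Rightarrow> complex"
  assumes c0: "c zero_exps = 1"
  shows "(\<forall>B\<in>brill_equations. meval c B = 0) \<longleftrightarrow>
    (\<exists>X :: 'd option \<Rightarrow> 'd \<Rightarrow> complex. \<forall>I. c I = Poly_Mapping.lookup (lin_prod X) (exponent I))"
proof
  assume B: "\<forall>B\<in>brill_equations. meval c B = 0"
  \<comment> \<open>The form vanishes identically in x, y, z, so polynomials in a parameter may be
    substituted; these are the arcs needed for tangent lines.\<close>
  have "brill_form (\<lambda>I. [:c I:]) x y z = 0" for x y z :: "'d option \<Rightarrow> complex poly"
    using arg_cong[OF B[unfolded brill_equations_vanish_iff],
      of "msubst (\<lambda>c. [:c:]) (\<lambda>v. case v of Inl i \<Rightarrow> x i | Inr (Inl i) \<Rightarrow> y i | Inr (Inr i) \<Rightarrow> z i)"]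
    by (simp add: rhom_brill_form[OF rhom_msubst[OF rhom_pCons]] msubst_mconst[OF rhom_pCons] msubst_mvar[OF rhom_pCons]
      msubst_0)
  then show "\<exists>X :: 'd option \<Rightarrow> 'd \<Rightarrow> complex. \<forall>I. c I = Poly_Mapping.lookup (lin_prod X) (exponent I)"
    by (rule lin_prod_if_brill[where c = c]) (rule c0)
next
  assume "\<exists>X :: 'd option \<Rightarrow> 'd \<Rightarrow> complex. \<forall>I. c I = Poly_Mapping.lookup (lin_prod X) (exponent I)"
  then obtain X :: "'d option \<Rightarrow> 'd \<Rightarrow> complex" where "\<And>I. c I = Poly_Mapping.lookup (lin_prod X) (exponent I)" by blast
  then show "\<forall>B\<in>brill_equations. meval c B = 0"
    unfolding brill_equations_vanish_iff by (simp add: brill_form_lin_prod[OF rhom_mconst])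
qed

lemma moment_brill_equations_vanish_iff:
  fixes m :: "complex^('d::finite exps)"
  assumes m0: "m $ zero_exps = 1"
  shows "(\<forall>F\<in>moment_brill_equations. meval (\<lambda>i. m $ i) F = 0) \<longleftrightarrow> (\<exists>X. m = moment_map X)"
proof -
  let ?c = "\<lambda>I. meval (\<lambda>i. m $ i) (inverse_coeff I)"
  have "meval (\<lambda>i. m $ i) (msubst mconst inverse_coeff B) = meval ?c B" for B
    by (simp add: rhom_of_msubst[OF rhom_msubst[OF rhom_id]] msubst_mconst[OF rhom_id])
  then have "(\<forall>F\<in>moment_brill_equations. meval (\<lambda>i. m $ i) F = 0) \<longleftrightarrow> (\<forall>B\<in>brill_equations. meval ?c B = 0)"
    by (simp add: moment_brill_equations_def)
  also have "?c zero_exps = 1"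
  proof -
    \<comment> \<open>L has no constant term, so the inverse series starts with 1, the normalization
      under which Brill's equations yield factors 1 - x . t.\<close>
    have "Poly_Mapping.lookup ((1 + L_eval (\<lambda>i. m $ i)) * Inv_eval (\<lambda>i. m $ i)) 0 = 1"
      using lookup_eq_if_mdgt[OF L_eval_inverse, of 0] by (simp add: lookup_one)
    moreover have "Poly_Mapping.lookup (L_eval (\<lambda>i. m $ i) * Inv_eval (\<lambda>i. m $ i)) 0 = 0"
      using mdgt_mult[OF mdgt_L_eval] by (force simp: mdgt_def in_keys_iff)
    ultimately show ?thesis
      by (simp add: meval_inverse_coeff exponent_zero_exps distrib_right lookup_add)
  qed
  then have "(\<forall>B\<in>brill_equations. meval ?c B = 0) \<longleftrightarrow>
      (\<exists>X :: 'd option \<Rightarrow> 'd \<Rightarrow> complex. \<forall>I. ?c I = Poly_Mapping.lookup (lin_prod X) (exponent I))"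
    by (rule brill_equations_vanish_iff_lin_prod)
  also have "\<dots> \<longleftrightarrow> (\<exists>X. m = moment_map X)"
  proof
    assume "\<exists>X. m = moment_map X"
    then show "\<exists>X :: 'd option \<Rightarrow> 'd \<Rightarrow> complex. \<forall>I. ?c I = Poly_Mapping.lookup (lin_prod X) (exponent I)"
      using moment_map_iff[OF m0] by blast
  next
    assume "\<exists>X :: 'd option \<Rightarrow> 'd \<Rightarrow> complex. \<forall>I. ?c I = Poly_Mapping.lookup (lin_prod X) (exponent I)"
    then obtain X :: "'d option \<Rightarrow> 'd \<Rightarrow> complex" where "\<forall>I. ?c I = Poly_Mapping.lookup (lin_prod X) (exponent I)" by blast
    then have "m = moment_map (\<chi> k. \<chi> l. X k l)"
      unfolding moment_map_iff[OF m0] by (simp cong: if_cong) (simp add: vec_lambda_beta[abs_def])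
    then show "\<exists>X. m = moment_map X" by blast
  qed
  finally show ?thesis .
qed

text \<open>Setting the total mass to 0 by \<sigma> leaves \<open>L_series\<close> unchanged, as its
  terms have positive order; so \<sigma> fixes the inverse coefficients, while nothing in its image
  involves the total mass.\<close>

lemma zero_exps_notin_inverse_coeff: "zero_exps \<notin> mvars (inverse_coeff I)"
proof -
  define a :: "'a exps \<Rightarrow> ('a exps, complex) mpol" where "a J = (if J = zero_exps then 0 else mvar J)" for J
  define \<sigma> where "\<sigma> = msubst mconst a"
  have \<sigma>: "rhom \<sigma>" unfolding \<sigma>_def by (rule rhom_msubst[OF rhom_mconst])
  note g = rhom_comp[OF rhom_mconst \<sigma>]
  have "msubst (\<lambda>p. mconst (\<sigma> p)) mvar L_series = (L_series :: ('a, _) mpol)"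
    unfolding L_series_def msubst_sum[OF g] msubst_single[OF g] mmon_mvar
  proof (intro sum.cong refl)
    fix I :: "'a exps" assume "I \<in> {I. 1 \<le> mdeg (exponent I)}"
    then have "I \<noteq> zero_exps" using exponent_zero_exps by (metis One_nat_def mdeg_0 mem_Collect_eq not_one_le_zero)
    then have "\<sigma> (mconst c * mvar I) = mconst c * mvar I" for c
      unfolding rhom_mult[OF \<sigma>] by (simp add: \<sigma>_def msubst_mconst[OF rhom_mconst] msubst_mvar[OF rhom_mconst] a_def)
    then show "mconst (\<sigma> (mconst (of_nat (fact (mdeg (exponent I) + CARD('a))) /
          of_nat ((\<Prod>l\<in>UNIV. fact (Poly_Mapping.lookup (exponent I) l)) * fact CARD('a))) * mvar I)) *
         Poly_Mapping.single (exponent I) 1 =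
        Poly_Mapping.single (exponent I) (mconst (of_nat (fact (mdeg (exponent I) + CARD('a))) /
          of_nat ((\<Prod>l\<in>UNIV. fact (Poly_Mapping.lookup (exponent I) l)) * fact CARD('a))) * mvar I)"
      by (simp only: mconst_def mult_single add_0 mult_1_right)
  qed
  then have "\<sigma> (inverse_coeff I) = inverse_coeff I"
    unfolding inverse_coeff_def lookup_msubst_coeffs[OF \<sigma>, symmetric]
    by (simp add: rhom_simps[OF rhom_msubst[OF g]])
  moreover have "mvars (\<sigma> (inverse_coeff I)) \<subseteq> - {zero_exps}"
    unfolding \<sigma>_def by (intro mvars_msubst) (auto simp: a_def mvars_mvar mvars_def[of 0])
  ultimately show ?thesis by auto
qed

lemma zero_exps_notin_moment_brill: "F \<in> moment_brill_equations \<Longrightarrow> zero_exps \<notin> mvars F"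
  unfolding moment_brill_equations_def
  using mvars_msubst[of mconst "- {zero_exps}" _ inverse_coeff] zero_exps_notin_inverse_coeff by fastforce

section \<open>Homogenization and projective closure\<close>

lemma meval_scale_homogeneous:
  assumes "\<forall>m\<in>Poly_Mapping.keys H. mdeg m = k"
  shows "meval (\<lambda>i. s * v i) H = s ^ k * meval v H"
  unfolding msubst_mmon mmon_scale sum_distrib_left
  by (intro sum.cong refl) (use assms in \<open>simp add: mult_ac\<close>)

text \<open>\<open>proj_zeros\<close> asks for some representative that is a zero; for homogeneous
  equations all representatives behave alike.\<close>

lemma proj_point_in_proj_zeros:
  fixes v :: "complex^'n"
  assumes "v \<noteq> 0" and hom: "\<forall>F\<in>S. homogeneous F"
  shows "proj_point v \<in> proj_zeros S \<longleftrightarrow> (\<forall>F\<in>S. meval (\<lambda>i. v $ i) F = 0)"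
proof
  assume "proj_point v \<in> proj_zeros S"
  then obtain w where w: "proj_point v = proj_point w" "\<forall>F\<in>S. meval (\<lambda>i. w $ i) F = 0"
    by (auto simp: proj_zeros_def)
  have "v \<in> proj_point v" unfolding proj_point_def by (auto intro!: exI[of _ 1])
  then obtain c where c: "v = c *s w" using w(1) by (auto simp: proj_point_def)
  show "\<forall>F\<in>S. meval (\<lambda>i. v $ i) F = 0"
  proof
    fix F assume "F \<in> S"
    with hom obtain k where "\<forall>m\<in>Poly_Mapping.keys F. mdeg m = k" by (auto simp: homogeneous_def)
    from meval_scale_homogeneous[OF this, of c "\<lambda>i. w $ i"] w(2) \<open>F \<in> S\<close>
    show "meval (\<lambda>i. v $ i) F = 0" by (simp add: c)
  qed
qed (use assms(1) in \<open>auto simp: proj_zeros_def\<close>)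

lemma proj_zeros_cases:
  assumes "P \<in> proj_zeros S"
  obtains v where "P = proj_point v" "v \<noteq> 0"
  using assms by (auto simp: proj_zeros_def)

lemma mdeg_le_total_deg: "m \<in> Poly_Mapping.keys F \<Longrightarrow> mdeg m \<le> total_deg F"
  unfolding total_deg_def by (intro Max_ge) auto

lemma total_deg_le: "mdle N F \<Longrightarrow> total_deg F \<le> N"
  unfolding total_deg_def mdle_def by (subst Max_le_iff) auto

lemma homogeneous_homogenize: "homogeneous (homogenize v0 F)"
proof -
  have "hdeg (total_deg F) (homogenize v0 F)"
    unfolding homogenize_def
    by (intro hdeg_sum) (auto simp: hdeg_def mdeg_add dest: mdeg_le_total_deg split: if_splits)
  then show ?thesis by (auto simp: homogeneous_def hdeg_def)
qed

lemma meval_homogenize: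
  "meval w (homogenize v0 F) = (\<Sum>m\<in>Poly_Mapping.keys F. Poly_Mapping.lookup F m * mmon w m * w v0 ^ (total_deg F - mdeg m))"
  by (simp add: homogenize_def msubst_sum[OF rhom_id] msubst_single[OF rhom_id] mmon_add mmon_single mult_ac)

lemma meval_homogenize_div:
  fixes w :: "'v \<Rightarrow> complex"
  assumes "w v0 \<noteq> 0"
  shows "meval w (homogenize v0 F) = w v0 ^ total_deg F * meval (\<lambda>i. w i / w v0) F"
proof -
  have e: "mmon w m = w v0 ^ mdeg m * mmon (\<lambda>i. w i / w v0) m" for m
    using mmon_scale[of "w v0" "\<lambda>i. w i / w v0" m] assms by simp
  have "meval w (homogenize v0 F) = (\<Sum>m\<in>Poly_Mapping.keys F.
      w v0 ^ total_deg F * (Poly_Mapping.lookup F m * mmon (\<lambda>i. w i / w v0) m))"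
    unfolding meval_homogenize
  proof (rule sum.cong[OF refl])
    fix m assume "m \<in> Poly_Mapping.keys F"
    then have "total_deg F = mdeg m + (total_deg F - mdeg m)" using mdeg_le_total_deg by fastforce
    then have "w v0 ^ total_deg F = w v0 ^ mdeg m * w v0 ^ (total_deg F - mdeg m)" by (metis power_add)
    then show "Poly_Mapping.lookup F m * mmon w m * w v0 ^ (total_deg F - mdeg m) =
        w v0 ^ total_deg F * (Poly_Mapping.lookup F m * mmon (\<lambda>i. w i / w v0) m)"
      by (subst e) (simp add: mult_ac)
  qed
  then show ?thesis by (simp add: msubst_mmon sum_distrib_left)
qed

lemma mdle_mmon: assumes a: "\<And>v. mdle 1 (a v)" shows "mdle (mdeg m) (mmon a m)"
proof -
  have "mdle k (a v ^ k)" for v k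
    by (induction k) (use mdle_mult[OF a] in \<open>auto simp: mdle_one\<close>)
  then show ?thesis unfolding mmon_def mdeg_def by (intro mdle_prod)
qed

text \<open>On the hyperplane of total mass 0 the homogenization of a power of the dehomogenization of H
  vanishes where H does, by continuity in the coordinate \<^term>\<open>zero_exps\<close>.\<close>

lemma homogeneous_zero_if_dehomogenized_power:
  fixes H :: "('v, complex) mpol"
  assumes H: "homogeneous H"
    and h: "h = msubst mconst (\<lambda>i. if i = v0 then 1 else mvar i) H"
    and zero: "meval v (homogenize v0 (h ^ N)) = 0"
  shows "meval v H = 0"
proof -
  obtain k where k: "\<forall>m\<in>Poly_Mapping.keys H. mdeg m = k" using H by (auto simp: homogeneous_def)
  have "mdle k h"
    unfolding h msubst_mmon
  proof (intro mdle_sum)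
    fix m assume "m \<in> Poly_Mapping.keys H"
    then have "mdeg m = k" using k by blast
    have "mdle (0 + mdeg m) (mconst (Poly_Mapping.lookup H m) * mmon (\<lambda>i. if i = v0 then 1 else mvar i) m)"
      by (intro mdle_mult mdle_mconst mdle_mmon) (auto simp: mdle_one mdle_mvar[unfolded One_nat_def])
    then show "mdle k (mconst (Poly_Mapping.lookup H m) * mmon (\<lambda>i. if i = v0 then 1 else mvar i) m)"
      using \<open>mdeg m = k\<close> by simp
  qed
  then have "mdle (k * N) (h ^ N)"
    by (induction N) (auto simp: mdle_one intro: mdle_mult)
  then have D: "total_deg (h ^ N) \<le> k * N" by (rule total_deg_le)
  \<comment> \<open>Only the total mass moves. The claim becomes an identity between polynomials in
    s, checked for s \<noteq> 0 and then read off at the original coordinate, which may be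
    0.\<close>
  define w where "w s = v(v0 := s)" for s
  have sub: "meval (w s) F = poly (msubst (\<lambda>c. [:c:]) (\<lambda>i. if i = v0 then [:0, 1:] else [:v i:]) F) s" for s F
    unfolding rhom_of_msubst[OF rhom_poly]
    by (rule arg_cong2[where f = "\<lambda>g a. msubst g a F"]) (auto simp: w_def)
  let ?p = "msubst (\<lambda>c. [:c:]) (\<lambda>i. if i = v0 then [:0, 1:] else [:v i:])"
  \<comment> \<open>The power of s makes up for the drop of degree of h^N below k N, which occurs if
    the total mass divides H.\<close>
  have "?p H ^ N = [:0, 1:] ^ (k * N - total_deg (h ^ N)) * ?p (homogenize v0 (h ^ N))"
  proof (rule poly_eq_if_infinite_agree[of "- {0}"])
    show "infinite (- {0 :: complex})" by (simp add: Compl_eq_Diff_UNIV infinite_UNIV_char_0)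
    fix s :: complex assume "s \<in> - {0}"
    then have s: "s \<noteq> 0" by simp
    have w0: "w s v0 = s" by (simp add: w_def)
    have "meval (\<lambda>i. w s i / s) h = meval (\<lambda>i. w s i / s) H"
      unfolding h rhom_of_msubst[OF rhom_msubst[OF rhom_id]]
      by (rule arg_cong2[where f = "\<lambda>g a. msubst g a H"])
         (use s w0 in \<open>auto simp: msubst_mconst[OF rhom_id] msubst_mvar[OF rhom_id] rhom_one[OF rhom_msubst[OF rhom_id]]\<close>)
    moreover have "meval (w s) H = s ^ k * meval (\<lambda>i. w s i / s) H"
      using meval_scale_homogeneous[OF k, of s "\<lambda>i. w s i / s"] s by simp
    ultimately have 1: "meval (w s) H ^ N = s ^ (k * N) * meval (\<lambda>i. w s i / s) h ^ N"
      by (simp add: power_mult_distrib power_mult)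
    have "meval (w s) (homogenize v0 (h ^ N)) = s ^ total_deg (h ^ N) * meval (\<lambda>i. w s i / s) h ^ N"
      using meval_homogenize_div[of "w s" v0 "h ^ N"] s by (simp add: w0 rhom_power[OF rhom_msubst[OF rhom_id]])
    moreover have "s ^ (k * N) = s ^ (k * N - total_deg (h ^ N)) * s ^ total_deg (h ^ N)"
      using D by (simp flip: power_add)
    ultimately have "meval (w s) H ^ N = s ^ (k * N - total_deg (h ^ N)) * meval (w s) (homogenize v0 (h ^ N))"
      using 1 by (simp add: mult_ac)
    then show "poly (?p H ^ N) s = poly ([:0, 1:] ^ (k * N - total_deg (h ^ N)) * ?p (homogenize v0 (h ^ N))) s"
      by (simp add: sub)
  qed
  from arg_cong[OF this, of "\<lambda>p. poly p (v v0)"]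
  have "meval (w (v v0)) H ^ N = v v0 ^ (k * N - total_deg (h ^ N)) * meval (w (v v0)) (homogenize v0 (h ^ N))"
    by (simp add: sub)
  then have "meval v H ^ N = 0" using zero by (simp add: w_def)
  then show ?thesis by simp
qed

lemma moment_variety_eq:
  "(moment_variety :: (complex^('d::finite exps)) set set) =
      proj_zeros {homogenize zero_exps F | F. F \<in> mideal moment_brill_equations \<and> zero_exps \<notin> mvars F}"
    (is "_ = proj_zeros ?R")
proof
  let ?A = "{proj_point (moment_map X) | X. moment_map X \<noteq> (0 :: complex^('d exps))}"
  have nz: "moment_map X \<noteq> (0 :: complex^('d exps))" for X
    using moment_map_zero_exps[of X] by (metis zero_index zero_neq_one)
  have homR: "\<forall>F\<in>?R. homogeneous F" by (auto simp: homogeneous_homogenize)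
  have van: "meval (\<lambda>i. moment_map X $ i) F = 0" if "F \<in> mideal moment_brill_equations" for X :: "complex^'d^('d option)" and F
    using moment_brill_equations_vanish_iff[OF moment_map_zero_exps[of X]] by (intro mideal_vanish[OF that]) blast
  have "?A \<subseteq> proj_zeros ?R"
  proof
    fix P assume "P \<in> ?A"
    then obtain X where P: "P = proj_point (moment_map X)" by blast
    show "P \<in> proj_zeros ?R"
      unfolding P proj_point_in_proj_zeros[OF nz homR]
      using van by (auto simp: meval_homogenize_div moment_map_zero_exps)
  qed
  with homR show "moment_variety \<subseteq> proj_zeros ?R"
    unfolding moment_variety_def zariski_closure_def by blast
  show "proj_zeros ?R \<subseteq> moment_variety"
    unfolding moment_variety_def zariski_closure_def
  proof (intro subsetI InterI)
    fix P T assume "P \<in> proj_zeros ?R" and "T \<in> {proj_zeros S | S. (\<forall>F\<in>S. homogeneous F) \<and> ?A \<subseteq> proj_zeros S}"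
    then obtain S v where T: "T = proj_zeros S" and S: "\<forall>F\<in>S. homogeneous F" and A: "?A \<subseteq> proj_zeros S"
      and P: "P = proj_point v" and v: "v \<noteq> 0" "\<And>F. F \<in> ?R \<Longrightarrow> meval (\<lambda>i. v $ i) F = 0"
      by (auto simp: proj_zeros_def)
    have "meval (\<lambda>i. v $ i) H = 0" if H: "H \<in> S" for H
    proof -
      define h where "h = msubst mconst (\<lambda>i. if i = zero_exps then 1 else mvar i) H"
      have hv: "zero_exps \<notin> mvars (h ^ N)" for N
      proof -
        have "mvars h \<subseteq> - {zero_exps}"
          unfolding h_def by (intro mvars_msubst) (auto simp: mvars_one mvars_mvar)
        from mvars_power[OF this, of N] show ?thesis by blast
      qed
      have "\<exists>N. h ^ N \<in> mideal moment_brill_equations"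
      proof (rule nullstellensatz)
        fix a :: "'d exps \<Rightarrow> complex" assume a: "\<And>F. F \<in> moment_brill_equations \<Longrightarrow> meval a F = 0"
        \<comment> \<open>The substituted equations do not involve the total mass, so that
          coordinate can be reset to 1, the value that was put into H to obtain h.\<close>
        define m :: "complex^('d exps)" where "m = (\<chi> i. if i = zero_exps then 1 else a i)"
        have "meval (\<lambda>i. m $ i) F = 0" if "F \<in> moment_brill_equations" for F
        proof -
          have "meval (\<lambda>i. m $ i) F = meval a F"
            by (rule msubst_cong_vars) (use zero_exps_notin_moment_brill[OF that] in \<open>auto simp: m_def\<close>)
          with a[OF that] show ?thesis by simp
        qed
        moreover have "m $ zero_exps = 1" by (simp add: m_def)
        ultimately obtain X where X: "m = moment_map X"
          using moment_brill_equations_vanish_iff by blast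
        have "meval a h = meval (\<lambda>i. m $ i) H"
          unfolding h_def rhom_of_msubst[OF rhom_msubst[OF rhom_id]]
          by (rule arg_cong2[where f = "\<lambda>g a. msubst g a H"])
             (auto simp: m_def msubst_mconst[OF rhom_id] msubst_mvar[OF rhom_id] rhom_one[OF rhom_msubst[OF rhom_id]])
        also have "\<dots> = 0"
        proof -
          have "proj_point m \<in> proj_zeros S" using A nz X by blast
          then show ?thesis using proj_point_in_proj_zeros[of m S] S nz X H by auto
        qed
        finally show "meval a h = 0" .
      qed
      then obtain N where "h ^ N \<in> mideal moment_brill_equations" by blast
      then have "meval (\<lambda>i. v $ i) (homogenize zero_exps (h ^ N)) = 0"
        using hv by (intro v(2)) blast
      then show ?thesis
        using S H by (intro homogeneous_zero_if_dehomogenized_power[OF _ h_def]) auto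
    qed
    then show "P \<in> T" unfolding T P proj_point_in_proj_zeros[OF v(1) S] by blast
  qed
qed

text \<open>Where the total mass is not 0, it can be scaled to 1. There a homogenization vanishes
  exactly when the original polynomial does, and an ideal vanishes where its generators do; so in
  this chart the homogenized generators cut out the same set as the homogenized ideal.\<close>

theorem corollary4p2:
  shows "(moment_variety :: (complex^('d::finite exps)) set set) =
      proj_zeros {homogenize zero_exps F | F. F \<in> mideal moment_brill_equations \<and> zero_exps \<notin> mvars F}
    \<and> (moment_variety :: (complex^('d exps)) set set) - proj_zeros {mvar zero_exps} =
      proj_zeros (homogenize zero_exps ` moment_brill_equations) - proj_zeros {mvar zero_exps}"
proof
  let ?R = "{homogenize zero_exps F | F. F \<in> mideal moment_brill_equations \<and> zero_exps \<notin> mvars F}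
    :: ('d exps, complex) mpol set"
  let ?E = "homogenize zero_exps ` moment_brill_equations :: ('d exps, complex) mpol set"
  let ?Z = "proj_zeros {mvar zero_exps} :: (complex^('d exps)) set set"
  show "moment_variety = proj_zeros ?R" by (rule moment_variety_eq)
  have homR: "\<forall>F\<in>?R. homogeneous F" and homE: "\<forall>F\<in>?E. homogeneous F"
    by (auto simp: homogeneous_homogenize)
  have homZ: "\<forall>F\<in>{mvar zero_exps :: ('d exps, complex) mpol}. homogeneous F"
    using hdeg_mvar[of zero_exps, where 'b = complex] unfolding homogeneous_def hdeg_def by auto
  have "proj_point v \<in> proj_zeros ?R - ?Z \<longleftrightarrow> proj_point v \<in> proj_zeros ?E - ?Z" if v: "v \<noteq> 0" for v :: "complex^('d exps)"
  proof -
    have "(\<forall>F\<in>?R. meval (\<lambda>i. v $ i) F = 0) \<longleftrightarrow> (\<forall>F\<in>?E. meval (\<lambda>i. v $ i) F = 0)" if v0: "v $ zero_exps \<noteq> 0"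
    proof -
      let ?w = "\<lambda>i. v $ i / v $ zero_exps"
      have "(\<forall>F\<in>?R. meval (\<lambda>i. v $ i) F = 0) \<longleftrightarrow>
          (\<forall>F. F \<in> mideal moment_brill_equations \<and> zero_exps \<notin> mvars F \<longrightarrow> meval ?w F = 0)"
        using v0 by (auto simp: meval_homogenize_div)
      also have "\<dots> \<longleftrightarrow> (\<forall>F\<in>moment_brill_equations. meval ?w F = 0)"
        using zero_exps_notin_moment_brill mideal_vanish module.span_base[OF module_times] by blast
      also have "\<dots> \<longleftrightarrow> (\<forall>F\<in>?E. meval (\<lambda>i. v $ i) F = 0)"
        using v0 by (auto simp: meval_homogenize_div)
      finally show ?thesis .
    qed
    then show ?thesis
      by (auto simp only: Diff_iff proj_point_in_proj_zeros[OF v homR] proj_point_in_proj_zeros[OF v homE]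
        proj_point_in_proj_zeros[OF v homZ] ball_simps msubst_mvar[OF rhom_id])
  qed
  then have "P \<in> proj_zeros ?R - ?Z \<longleftrightarrow> P \<in> proj_zeros ?E - ?Z" if "P = proj_point v" "v \<noteq> 0" for P v
    using that by (simp only:)
  then have "P \<in> proj_zeros ?R - ?Z \<longleftrightarrow> P \<in> proj_zeros ?E - ?Z" for P
    by (meson DiffD1 proj_zeros_cases)
  then have "proj_zeros ?R - ?Z = proj_zeros ?E - ?Z" by (rule set_eqI)
  then show "moment_variety - ?Z = proj_zeros ?E - ?Z" unfolding moment_variety_eq .
qed

end
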